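(* Let $T>0$, let $(u_0,v_0)$ be LEFM initial data, $b\in C^1([0,T];L^2(D))$, and for a sequence of horizons $\epsilon_k>0$, $\epsilon_k\searrow 0$, let $u^{\epsilon_k}$ be the peridynamic evolutions with data $(u_0,v_0)$, $b$. There exists a positive constant $C$ depending only on $T$ (for the given data) and independent of the index $\epsilon_k$ such that $$\sup_{0\le t\le T}\left\{PD^{\epsilon_k}(u^{\epsilon_k}(t))+\frac\rho2\|u^{\epsilon_k}_t(t)\|^2_{L^2(D)}\right\}\le C .$$
   Context: $D\subset\mathbb{R}^2$ is a bounded convex domain, $\alpha$ is a fixed number larger than all horizons $\epsilon$ considered, $D_\alpha=\{x:\mathrm{dist}(x,D)<\alpha\}$, and $L^2_0(D)$ is the space of functions that are square integrable over $D$ and zero on $D_\alpha\setminus D$. $\mathcal H_1(0)$ is the unit disk centered at $0$. The mass density $\rho>0$ is constant. The influence function $J$ satisfies $0\le J(r)<M$ for $0\le r\le 1$ and $J(r)=0$ for $r>1$. The function $f:[0,\infty)\to\mathbb{R}$ is positive (on $(0,\infty)$), smooth and concave, with $\lim_{r\to0^+}f(r)/r=f'(0)>0$ and $\lim_{r\to\infty}f(r)=f_\infty<\infty$. The map $r\mapsto f(r^2)$ on $[0,\infty)$ is convex-concave with inflection point $\overline r>0$. Define $$W^\epsilon(\eta,\epsilon\xi)=\frac1{\epsilon^3}J(|\xi|)f\Big(\frac{|\eta|^2}{\epsilon|\xi|}\Big),\qquad PD^\epsilon(u)=\epsilon^2\int_D\int_{\mathcal H_1(0)}W^\epsilon(u(x+\epsilon\xi)-u(x),\epsilon\xi)\,d\xi\,dx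 .$$ With $e=\xi/|\xi|$ and $D_{-e}^{\epsilon|\xi|}\psi(x)=\frac{\psi(x-\epsilon\xi)-\psi(x)}{\epsilon|\xi|}$, for $u\in L^2_0(D)$ and $x\in D$ set $$\nabla PD^\epsilon(u)(x)=\epsilon^3\int_{\mathcal H_1(0)} D_{-e}^{\epsilon|\xi|}\big[\partial_\eta W^\epsilon(u(\cdot+\epsilon\xi)-u(\cdot),\epsilon\xi)\big](x)\,|\xi|\,d\xi .$$ LEFM initial data: with $\mu=\pi f'(0)\int_0^1r^2J(r)\,dr$ and $\mathcal G_c=2\pi f_\infty\int_0^1r^2J(r)\,dr$, $u_0,v_0\in L^2_0(D)$ with $u_0|_D\in SBV(D)$, $\sup_D|u_0|<\infty$, $\sup_D|v_0|<\infty$, and $\int_D\mu|\nabla u_0|^2dx+\mathcal G_c\mathcal H^1(S_{u_0})<\infty$ ($\nabla u_0$ approximate gradient, $S_{u_0}$ jump set, $\mathcal H^1$ one-dimensional Hausdorff measure). The peridynamic evolution with horizon $\epsilon$ is the unique $u^\epsilon\in C^2([0,T];L^2_0(D))$ with $\rho u^\epsilon_{tt}=-\nabla PD^\epsilon(u^\epsilon)+b$ in $D$ for $0<t\le T$, $u^\epsilon(0)=u_0$, $u^\epsilon_t(0)=v_0$. *)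

theory Defs
  imports "HOL-Analysis.Analysis"
begin

type_synonym plane = "real^2"

(* Elements of the Lebesgue spaces are represented by functions on the whole plane; they are
   only ever compared almost everywhere, and their values off the stated domain are irrelevant. *)

definition L2_on :: "plane set \<Rightarrow> (plane \<Rightarrow> real) \<Rightarrow> bool" where
  "L2_on D u \<longleftrightarrow> u \<in> borel_measurable (lebesgue_on D) \<and> integrable (lebesgue_on D) (\<lambda>x. (u x)\<^sup>2)"

definition L2_norm :: "plane set \<Rightarrow> (plane \<Rightarrow> real) \<Rightarrow> real" where
  "L2_norm D u = sqrt (\<integral>x. (u x)\<^sup>2 \<partial>lebesgue_on D)"

definition enlargement :: "plane set \<Rightarrow> real \<Rightarrow> plane set" where
  "enlargement D \<alpha> = {x. infdist x D < \<alpha>}"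

definition L2_0 :: "plane set \<Rightarrow> real \<Rightarrow> (plane \<Rightarrow> real) \<Rightarrow> bool" where
  "L2_0 D \<alpha> u \<longleftrightarrow> L2_on D u \<and> (AE x in lebesgue_on (enlargement D \<alpha> - D). u x = 0)"

(* w lies in C^1([0,T]; X) with time derivative w', where X is a space of functions normed by
   the L^2(D) norm (for L2_0 this is the whole norm, as its elements vanish off D). *)
definition C1_L2 ::
  "((plane \<Rightarrow> real) \<Rightarrow> bool) \<Rightarrow> plane set \<Rightarrow> real \<Rightarrow> (real \<Rightarrow> plane \<Rightarrow> real) \<Rightarrow> (real \<Rightarrow> plane \<Rightarrow> real) \<Rightarrow> bool"
where
  "C1_L2 X D T w w' \<longleftrightarrow>
     (\<forall>t\<in>{0..T}. X (w t) \<and> X (w' t) \<and>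
        ((\<lambda>s. L2_norm D (\<lambda>x. (w s x - w t x) / (s - t) - w' t x)) \<longlongrightarrow> 0) (at t within {0..T}) \<and>
        ((\<lambda>s. L2_norm D (\<lambda>x. w' s x - w' t x)) \<longlongrightarrow> 0) (at t within {0..T}))"

(* One-sided derivatives at boundary points of S. *)
definition smooth_on :: "real set \<Rightarrow> (real \<Rightarrow> real) \<Rightarrow> bool" where
  "smooth_on S f \<longleftrightarrow>
     (\<exists>F :: nat \<Rightarrow> real \<Rightarrow> real. F 0 = f \<and>
        (\<forall>n. \<forall>x\<in>S. (F n has_real_derivative F (Suc n) x) (at x within S)))"

(* pd_W J f \<epsilon> \<eta> \<xi> is W^\<epsilon>(\<eta>, \<epsilon> \<xi>): the last argument is the rescaled bond \<xi>, not \<epsilon> \<xi>. *)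
definition pd_W :: "(real \<Rightarrow> real) \<Rightarrow> (real \<Rightarrow> real) \<Rightarrow> real \<Rightarrow> real \<Rightarrow> plane \<Rightarrow> real" where
  "pd_W J f \<epsilon> \<eta> \<xi> = 1 / \<epsilon>^3 * J (norm \<xi>) * f (\<bar>\<eta>\<bar>\<^sup>2 / (\<epsilon> * norm \<xi>))"

definition PD :: "plane set \<Rightarrow> (real \<Rightarrow> real) \<Rightarrow> (real \<Rightarrow> real) \<Rightarrow> real \<Rightarrow> (plane \<Rightarrow> real) \<Rightarrow> real" where
  "PD D J f \<epsilon> u =
     \<epsilon>\<^sup>2 * (\<integral>x. (\<integral>\<xi>. pd_W J f \<epsilon> (u (x + \<epsilon> *\<^sub>R \<xi>) - u x) \<xi> \<partial>lebesgue_on (cball 0 1)) \<partial>lebesgue_on D)"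

(* The difference quotient of step \<epsilon> |\<xi>| in direction -e, e = \<xi> / |\<xi>|. *)
definition back_quot :: "real \<Rightarrow> plane \<Rightarrow> (plane \<Rightarrow> real) \<Rightarrow> plane \<Rightarrow> real" where
  "back_quot \<epsilon> \<xi> \<psi> x = (\<psi> (x - \<epsilon> *\<^sub>R \<xi>) - \<psi> x) / (\<epsilon> * norm \<xi>)"

definition grad_PD :: "(real \<Rightarrow> real) \<Rightarrow> (real \<Rightarrow> real) \<Rightarrow> real \<Rightarrow> (plane \<Rightarrow> real) \<Rightarrow> plane \<Rightarrow> real" where
  "grad_PD J f \<epsilon> u x =
     \<epsilon>^3 * (\<integral>\<xi>. back_quot \<epsilon> \<xi>
                    (\<lambda>y. deriv (\<lambda>\<eta>. pd_W J f \<epsilon> \<eta> \<xi>) (u (y + \<epsilon> *\<^sub>R \<xi>) - u y)) x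
                  * norm \<xi> \<partial>lebesgue_on (cball 0 1))"

(* u is a C^2([0,T]; L2_0) solution, with time derivative ut. *)
definition peridynamic_evolution ::
  "plane set \<Rightarrow> real \<Rightarrow> (real \<Rightarrow> real) \<Rightarrow> (real \<Rightarrow> real) \<Rightarrow> real \<Rightarrow> (real \<Rightarrow> plane \<Rightarrow> real) \<Rightarrow>
   (plane \<Rightarrow> real) \<Rightarrow> (plane \<Rightarrow> real) \<Rightarrow> real \<Rightarrow> real \<Rightarrow>
   (real \<Rightarrow> plane \<Rightarrow> real) \<Rightarrow> (real \<Rightarrow> plane \<Rightarrow> real) \<Rightarrow> bool"
where
  "peridynamic_evolution D \<alpha> J f \<rho> b u0 v0 T \<epsilon> u ut \<longleftrightarrow>
     (\<exists>utt. C1_L2 (L2_0 D \<alpha>) D T u ut \<and> C1_L2 (L2_0 D \<alpha>) D T ut utt \<and>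
        (\<forall>t\<in>{0<..T}. AE x in lebesgue_on D. \<rho> * utt t x = - grad_PD J f \<epsilon> (u t) x + b t x)) \<and>
     (AE x in lebesgue_on D. u 0 x = u0 x) \<and>
     (AE x in lebesgue_on D. ut 0 x = v0 x)"

definition mean_on :: "plane set \<Rightarrow> (plane \<Rightarrow> real) \<Rightarrow> real" where
  "mean_on A g = (\<integral>y. g y \<partial>lebesgue_on A) / measure lebesgue A"

definition approx_differential :: "(plane \<Rightarrow> real) \<Rightarrow> plane \<Rightarrow> plane \<Rightarrow> bool" where
  "approx_differential u x L \<longleftrightarrow>
     (\<exists>z. ((\<lambda>r. mean_on (ball x r) (\<lambda>y. \<bar>u y - z\<bar>)) \<longlongrightarrow> 0) (at_right 0) \<and>
          ((\<lambda>r. mean_on (ball x r) (\<lambda>y. \<bar>u y - z - L \<bullet> (y - x)\<bar> / r)) \<longlongrightarrow> 0) (at_right 0))"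

definition approx_grad :: "(plane \<Rightarrow> real) \<Rightarrow> plane \<Rightarrow> plane" where
  "approx_grad u x = (THE L. approx_differential u x L)"

definition jump_set :: "plane set \<Rightarrow> (plane \<Rightarrow> real) \<Rightarrow> plane set" where
  "jump_set D u =
     {x \<in> D. \<exists>a c \<nu>. a \<noteq> c \<and> norm \<nu> = 1 \<and>
        ((\<lambda>r. mean_on (ball x r \<inter> {y. \<nu> \<bullet> (y - x) > 0}) (\<lambda>y. \<bar>u y - a\<bar>)) \<longlongrightarrow> 0) (at_right 0) \<and>
        ((\<lambda>r. mean_on (ball x r \<inter> {y. \<nu> \<bullet> (y - x) < 0}) (\<lambda>y. \<bar>u y - c\<bar>)) \<longlongrightarrow> 0) (at_right 0)}"

(* One-dimensional Hausdorff (outer) measure; the normalising constant in dimension one is 1. *)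
definition hausdorff1 :: "'a::metric_space set \<Rightarrow> ennreal" where
  "hausdorff1 A =
     (SUP \<delta>\<in>{0<..}.
        INF C\<in>{C :: nat \<Rightarrow> 'a set. A \<subseteq> (\<Union>i. C i) \<and> (\<forall>i. bounded (C i) \<and> diameter (C i) \<le> \<delta>)}.
          \<Sum>i. ennreal (diameter (C i)))"

(* \<phi> is a C^1 function with gradient g and compact support in D. *)
definition test_function :: "plane set \<Rightarrow> (plane \<Rightarrow> real) \<Rightarrow> (plane \<Rightarrow> plane) \<Rightarrow> bool" where
  "test_function D \<phi> g \<longleftrightarrow>
     (\<forall>x. GDERIV \<phi> x :> g x) \<and> continuous_on UNIV g \<and>
     compact (closure {x. \<phi> x \<noteq> 0}) \<and> closure {x. \<phi> x \<noteq> 0} \<subseteq> D"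

(* The distributional derivative Du is a finite measure on D without Cantor part. It is the sum of
   its absolutely continuous part, with density the approximate gradient, and of its jump part,
   written \<sigma> m with m the total variation of that part and |\<sigma>| = 1. As m is carried by the jump set,
   which is Lebesgue null, it is singular, and no part of Du other than these two is left. *)
definition SBV :: "plane set \<Rightarrow> (plane \<Rightarrow> real) \<Rightarrow> bool" where
  "SBV D u \<longleftrightarrow>
     integrable (lebesgue_on D) u \<and>
     (AE x in lebesgue_on D. \<exists>L. approx_differential u x L) \<and>
     integrable (lebesgue_on D) (approx_grad u) \<and>
     (\<exists>(m :: plane measure) (\<sigma> :: plane \<Rightarrow> plane).
        finite_measure m \<and> sets m = sets (restrict_space borel D) \<and>
        \<sigma> \<in> borel_measurable m \<and> (AE x in m. norm (\<sigma> x) = 1) \<and>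
        (AE x in m. x \<in> jump_set D u) \<and>
        (\<forall>\<phi> g. test_function D \<phi> g \<longrightarrow>
           (\<integral>x. u x *\<^sub>R g x \<partial>lebesgue_on D) =
             - ((\<integral>x. \<phi> x *\<^sub>R approx_grad u x \<partial>lebesgue_on D) + (\<integral>x. \<phi> x *\<^sub>R \<sigma> x \<partial>m))))"

definition LEFM_data ::
  "plane set \<Rightarrow> real \<Rightarrow> real \<Rightarrow> real \<Rightarrow> (plane \<Rightarrow> real) \<Rightarrow> (plane \<Rightarrow> real) \<Rightarrow> bool"
where
  "LEFM_data D \<alpha> \<mu> Gc u0 v0 \<longleftrightarrow>
     L2_0 D \<alpha> u0 \<and> L2_0 D \<alpha> v0 \<and> SBV D u0 \<and>
     (\<exists>B. AE x in lebesgue_on D. \<bar>u0 x\<bar> \<le> B) \<and>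
     (\<exists>B. AE x in lebesgue_on D. \<bar>v0 x\<bar> \<le> B) \<and>
     (\<integral>\<^sup>+x. ennreal (\<mu> * (norm (approx_grad u0 x))\<^sup>2) \<partial>lebesgue_on D)
       + ennreal Gc * hausdorff1 (jump_set D u0) < \<infinity>"

end

(* Count every bond from both of its ends, also across the boundary of D. This energy E dominates
   PD, and grad_PD is its L^2 gradient. The bonds are concave in |eta|^2, so
   E(z) - E(w) <= <grad E(w), z - w> + A |z - w|^2; along the evolution the total energy
   E + (rho/2) |u_t|^2 therefore has upper right Dini derivative at most <b, u_t>, and a Gronwall
   argument bounds it by its initial value and b.

   That E(u_0) is bounded uniformly in the horizon follows from
   int min(1, |u_0(x + v) - u_0(x)|^2 / |v|) dx <= C |v|, the integral being over x, x + v in D.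
   Apart from the x whose segment [x, x + v] meets a neighbourhood of the jump set, a set of measure
   O(|v| H^1(S)), integration by parts against segment averages of test functions shows by duality
   that u_0(x + v) - u_0(x) is, up to a small error in L^1, the integral of the approximate gradient
   along [x, x + v], and Jensen's inequality gives the bound. *)

theory Submission
  imports Defs
begin

section \<open>Test functions\<close>

text \<open>Uniformity in the horizon is a matter of scaling: \<open>energy\<close> carries the
  prefactor 1/\<epsilon> = \<epsilon>^2/\<epsilon>^3, while the bonds in direction \<xi> cost O(|v|)
  with |v| = \<epsilon> |\<xi>| once integrated over their base points, so the powers of \<epsilon>
  cancel. The truncation min(1, .) stems from f(s) <= (f'(0) + f_inf) min(1, s): concavity with f(0)
  = 0 gives the linear bound, boundedness the constant one. Duality sees only a total variation, so
  the error between a difference and its gradient average is controlled in L^1 and not in L^2. The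
  inequality min(1, t^2) <= t makes this enough, provided that the jump mass left over is as small
  as sqrt |v|. The bound on the gradient of the energy and the constant A of the quadratic remainder
  are of order up to 1/\<epsilon>^2 and must stay out of the result. They serve only for continuity
  in time and for a limit s -> t in which A is multiplied by s - t. Displacements are Lebesgue
  functions given up to null sets; the analysis is done for Borel functions on the plane that vanish
  off D, and the results are transferred.\<close>

lemma GDERIV_square_max_0:
  fixes B :: "plane \<Rightarrow> real"
  assumes "GDERIV B x :> g"
  shows "GDERIV (\<lambda>x. (max 0 (B x))\<^sup>2) x :> (2 * max 0 (B x)) *\<^sub>R g"
proof -
  have "((\<lambda>t::real. (max 0 t)\<^sup>2) has_real_derivative 2 * max 0 t) (at t)" for t
  proof (cases t "0::real" rule: linorder_cases)
    case less
    have "((\<lambda>t::real. 0) has_real_derivative 2 * max 0 t) (at t)" using less by simp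
    then show ?thesis by (rule has_field_derivative_transform_within_open[of _ _ _ "{..<0}"]) (use less in auto)
  next
    case equal
    have "((\<lambda>t::real. (max 0 t)\<^sup>2) has_real_derivative 0) (at 0)" unfolding has_field_derivative_iff
      by (rule tendsto_0_le[OF tendsto_ident_at, where K=1]) (auto simp: max_def power2_eq_square)
    then show ?thesis using equal by simp
  next
    case greater
    have "((\<lambda>t::real. t\<^sup>2) has_real_derivative 2 * max 0 t) (at t)" using greater by (auto intro!: derivative_eq_intros)
    then show ?thesis by (rule has_field_derivative_transform_within_open[of _ _ _ "{0<..}"]) (use greater in auto)
  qed
  from GDERIV_DERIV_compose[OF assms this] show ?thesis .
qed

lemma test_functionI:
  assumes gd: "\<And>x. GDERIV \<phi> x :> g x" and cont: "continuous_on UNIV g"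
    and K: "compact K" "K \<subseteq> V" "{x. \<phi> x \<noteq> 0} \<subseteq> K"
  shows "test_function V \<phi> g"
proof -
  have "closure {x. \<phi> x \<noteq> 0} \<subseteq> K" by (rule closure_minimal[OF K(3) compact_imp_closed[OF K(1)]])
  moreover from this have "compact (closure {x. \<phi> x \<noteq> 0})"
    using bounded_subset[OF compact_imp_bounded[OF K(1)]] by (simp add: compact_eq_bounded_closed)
  ultimately show ?thesis unfolding test_function_def using gd cont K(2) by auto
qed

text \<open>Finitely many balls inside \<open>V\<close> cover \<open>C\<close>, and the sum
  \<open>B\<close> of the squared positive parts of r^2 - |y - x|^2 is C^1, positive on
  \<open>C\<close> and zero off the balls. Squaring the positive part is what keeps the construction
  C^1, the regularity that \<open>test_function\<close> asks for.\<close>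

lemma C1_urysohn:
  fixes C V :: "plane set"
  assumes "compact C" and "open V" and "C \<subseteq> V"
  shows "\<exists>\<psi> g. test_function V \<psi> g \<and> (\<forall>x. 0 \<le> \<psi> x \<and> \<psi> x \<le> 1) \<and> (\<forall>x\<in>C. \<psi> x = 1)"
proof -
  have "\<forall>x\<in>C. \<exists>r>0. cball x r \<subseteq> V" using assms open_contains_cball by blast
  then obtain r where r: "\<And>x. x \<in> C \<Longrightarrow> r x > 0" "\<And>x. x \<in> C \<Longrightarrow> cball x (r x) \<subseteq> V" by metis
  obtain F where F: "F \<subseteq> C" "finite F" "C \<subseteq> (\<Union>x\<in>F. ball x (r x))"
  proof (rule compactE_image[OF assms(1), of C "\<lambda>x. ball x (r x)"])
    show "C \<subseteq> (\<Union>x\<in>C. ball x (r x))" using r(1) by (auto intro!: bexI)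
  qed auto
  define B where "B y = (\<Sum>x\<in>F. (max 0 ((r x)\<^sup>2 - (y - x) \<bullet> (y - x)))\<^sup>2)" for y
  define gB where "gB y = (\<Sum>x\<in>F. (2 * max 0 ((r x)\<^sup>2 - (y - x) \<bullet> (y - x))) *\<^sub>R (- 2 *\<^sub>R (y - x)))" for y
  have gd1: "GDERIV (\<lambda>y. (r x)\<^sup>2 - (y - x) \<bullet> (y - x)) y :> - 2 *\<^sub>R (y - x)" for x y :: plane
    unfolding gderiv_def by (auto intro!: derivative_eq_intros ext simp: inner_simps inner_commute algebra_simps)
  have gdB: "GDERIV B y :> gB y" for y
  proof -
    have "((\<lambda>y. \<Sum>x\<in>F. (max 0 ((r x)\<^sup>2 - (y - x) \<bullet> (y - x)))\<^sup>2) has_derivative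
        (\<lambda>h. \<Sum>x\<in>F. h \<bullet> ((2 * max 0 ((r x)\<^sup>2 - (y - x) \<bullet> (y - x))) *\<^sub>R (- 2 *\<^sub>R (y - x))))) (at y)"
      by (rule has_derivative_sum) (use GDERIV_square_max_0[OF gd1] in \<open>simp add: gderiv_def\<close>)
    then show ?thesis unfolding gderiv_def B_def gB_def by (simp add: inner_sum_right)
  qed
  have contB: "continuous_on UNIV B" "continuous_on UNIV gB" unfolding B_def gB_def by (intro continuous_intros)+
  have Bpos: "B y > 0" if yC: "y \<in> C" for y
  proof -
    obtain x where x: "x \<in> F" "dist x y < r x" using yC F(3) by auto
    then have "(y - x) \<bullet> (y - x) < (r x)\<^sup>2"
      by (auto simp: dist_norm norm_minus_commute dot_square_norm intro!: power_strict_mono)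
    then show ?thesis unfolding B_def using x F(2) by (intro sum_pos2[where i=x]) auto
  qed
  have "\<exists>m>0. \<forall>y\<in>C. m \<le> B y"
  proof (cases "C = {}")
    case False
    then obtain y0 where "y0 \<in> C" "\<forall>y\<in>C. B y0 \<le> B y"
      using continuous_attains_inf[OF assms(1) False continuous_on_subset[OF contB(1)]] by auto
    then show ?thesis using Bpos by blast
  qed (auto intro: exI[of _ 1])
  then obtain m where m: "m > 0" "\<And>y. y \<in> C \<Longrightarrow> m \<le> B y" by blast
  \<comment> \<open>A second squared positive part flattens \<open>B\<close>: the value is 1
    wherever \<open>B\<close> is at least \<open>m\<close>, hence on \<open>C\<close>, and 0 exactly
    where \<open>B\<close> vanishes.\<close>
  define \<psi> where "\<psi> y = 1 - (max 0 (1 - B y / m))\<^sup>2" for y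
  define g where "g y = - ((2 * max 0 (1 - B y / m)) *\<^sub>R (- (1 / m) *\<^sub>R gB y))" for y
  have B0: "B y \<ge> 0" for y unfolding B_def by (intro sum_nonneg) auto
  have "GDERIV (\<lambda>y. 1 - B y / m) y :> - (1 / m) *\<^sub>R gB y" for y using gdB[of y] m(1) unfolding gderiv_def
    by (auto intro!: derivative_eq_intros ext simp: inner_simps)
  note gd0 = GDERIV_square_max_0[OF this]
  have gd: "GDERIV \<psi> y :> g y" for y using has_derivative_diff[OF has_derivative_const[of 1] gd0[unfolded gderiv_def]]
    unfolding gderiv_def \<psi>_def g_def inner_minus_right by simp
  have cont: "continuous_on UNIV g" unfolding g_def by (intro continuous_intros contB) (use m in auto)
  let ?K = "\<Union>x\<in>F. cball x (r x)"
  have K: "compact ?K" "?K \<subseteq> V" using F(1,2) r(2) by (auto intro!: compact_UN simp: subset_iff)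
  have "{x. \<psi> x \<noteq> 0} \<subseteq> ?K"
  proof
    fix y assume "y \<in> {x. \<psi> x \<noteq> 0}"
    then have "B y \<noteq> 0" using m unfolding \<psi>_def by auto
    then obtain x where x: "x \<in> F" "(max 0 ((r x)\<^sup>2 - (y - x) \<bullet> (y - x)))\<^sup>2 \<noteq> 0"
      unfolding B_def by (metis (mono_tags, lifting) sum.neutral)
    then have "(y - x) \<bullet> (y - x) < (r x)\<^sup>2" by (auto simp: max_def split: if_splits)
    then have "norm (y - x) < r x" using power_less_imp_less_base[of "norm (y - x)" 2 "r x"] r x F
      by (force simp: dot_square_norm intro: less_imp_le)
    then show "y \<in> ?K" using x by (force simp: dist_norm norm_minus_commute)
  qed
  with K have "test_function V \<psi> g" by (intro test_functionI[OF gd cont])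
  moreover have "0 \<le> \<psi> x \<and> \<psi> x \<le> 1" for x unfolding \<psi>_def using B0[of x] m by (auto simp: max_def power_le_one)
  moreover have "\<psi> x = 1" if "x \<in> C" for x unfolding \<psi>_def using m(2)[OF that] m(1) by (auto simp: max_def)
  ultimately show ?thesis by blast
qed

section \<open>Integrals over sets recovered from test functions\<close>

lemma finite_measure_compact_inner:
  fixes M :: "plane measure"
  assumes "finite_measure M" and "sets M = sets borel" and "A \<in> sets borel" and "0 < e"
  shows "\<exists>K. compact K \<and> K \<subseteq> A \<and> measure M (A - K) < e"
proof -
  interpret finite_measure M by fact
  have "emeasure M A = (SUP K \<in> {K. K \<subseteq> A \<and> compact K}. emeasure M K)"
    by (rule inner_regular[OF assms(2) _ assms(3)]) simp
  moreover have "emeasure M A \<noteq> \<infinity>" by (simp add: emeasure_eq_measure)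
  moreover have "{K. K \<subseteq> A \<and> compact K} \<noteq> {}" using compact_empty by blast
  ultimately have "\<exists>K\<in>{K. K \<subseteq> A \<and> compact K}. emeasure M A < emeasure M K + ennreal e"
    using assms(4) by (intro SUP_approx_ennreal) simp_all
  then obtain K where K: "K \<subseteq> A" "compact K" "emeasure M A < emeasure M K + ennreal e" by blast
  then have "measure M A < measure M K + e" using assms(4) by (simp add: emeasure_eq_measure ennreal_less_iff flip: ennreal_plus)
  moreover have "measure M (A - K) = measure M A - measure M K" using K assms by (intro finite_measure_Diff) (auto intro: borel_compact)
  ultimately show ?thesis using K by auto
qed

lemma finite_measure_open_outer:
  fixes M :: "plane measure"
  assumes "finite_measure M" and "sets M = sets borel" and "A \<in> sets borel" and "0 < e"
  shows "\<exists>V. open V \<and> A \<subseteq> V \<and> measure M (V - A) < e"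
proof -
  interpret finite_measure M by fact
  have "emeasure M A = (INF U \<in> {U. A \<subseteq> U \<and> open U}. emeasure M U)" by (rule outer_regular[OF assms(2) _ assms(3)]) simp
  moreover have "emeasure M A < emeasure M A + ennreal e"
    using assms(4) by (simp add: emeasure_eq_measure ennreal_less_iff flip: ennreal_plus)
  ultimately have "(INF U \<in> {U. A \<subseteq> U \<and> open U}. emeasure M U) < emeasure M A + ennreal e" by simp
  then have "\<exists>U\<in>{U. A \<subseteq> U \<and> open U}. emeasure M U < emeasure M A + ennreal e" by (simp only: INF_less_iff)
  then obtain U where U: "A \<subseteq> U" "open U" "emeasure M U < emeasure M A + ennreal e" by blast
  then have "measure M U < measure M A + e" using assms(4) by (simp add: emeasure_eq_measure ennreal_less_iff flip: ennreal_plus)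
  moreover have "measure M (U - A) = measure M U - measure M A" using U assms by (intro finite_measure_Diff) auto
  ultimately show ?thesis using U by auto
qed

lemma test_function_mono: "test_function V \<psi> g \<Longrightarrow> V \<subseteq> W \<Longrightarrow> test_function W \<psi> g"
  unfolding test_function_def by blast

lemma test_function_continuous: "test_function V \<psi> g \<Longrightarrow> continuous_on UNIV \<psi>"
  unfolding test_function_def gderiv_def by (meson continuous_at_imp_continuous_on has_derivative_continuous)

text \<open>The indicator of \<open>A\<close> is replaced by a test function equal to 1 on a compact
  \<open>K\<close> inside \<open>A\<close> and to 0 off an open \<open>V\<close> around
  \<open>K\<close>. Both sets come from the regularity of the finite measure with density |h|, so
  that each replacement error is below e/2.\<close>

lemma set_integral_le_of_test_functions:
  fixes h :: "plane \<Rightarrow> real"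
  assumes "open U" and h: "integrable lborel h" and A: "A \<in> sets borel" "A \<subseteq> U"
    and test: "\<And>\<psi> g. test_function U \<psi> g \<Longrightarrow> (\<And>x. 0 \<le> \<psi> x \<and> \<psi> x \<le> 1) \<Longrightarrow> (LBINT x. \<psi> x * h x) \<le> c"
  shows "(LBINT x. indicator A x * h x) \<le> c"
proof (rule field_le_epsilon)
  fix e :: real assume "0 < e"
  have h': "h \<in> borel_measurable borel" using h by auto
  define N where "N = density lborel (\<lambda>x. ennreal \<bar>h x\<bar>)"
  have emN: "emeasure N B = ennreal (LBINT x. indicator B x * \<bar>h x\<bar>)" if "B \<in> sets borel" for B
  proof -
    have "emeasure N B = (\<integral>\<^sup>+x. ennreal (indicator B x * \<bar>h x\<bar>) \<partial>lborel)"
      unfolding N_def using that h' by (subst emeasure_density) (auto intro!: nn_integral_cong simp: indicator_def)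
    also have "\<dots> = ennreal (LBINT x. indicator B x * \<bar>h x\<bar>)"
      using that h' by (intro nn_integral_eq_integral Bochner_Integration.integrable_bound[OF h] AE_I2)
        (auto simp: indicator_def)
    finally show ?thesis .
  qed
  have fN: "finite_measure N" using emN[of UNIV] by (intro finite_measureI) (auto simp: N_def space_density)
  have sN: "sets N = sets borel" by (simp add: N_def)
  have mN: "measure N B = (LBINT x. indicator B x * \<bar>h x\<bar>)" if "B \<in> sets borel" for B
    using emN[OF that] unfolding measure_def by (simp add: integral_nonneg_AE)
  obtain K where K: "compact K" "K \<subseteq> A" "measure N (A - K) < e / 2"
    using finite_measure_compact_inner[OF fN sN A(1), of "e/2"] \<open>0 < e\<close> by auto
  have Kb: "K \<in> sets borel" using K(1) by (rule borel_compact)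
  obtain V where V: "open V" "K \<subseteq> V" "measure N (V - K) < e / 2"
    using finite_measure_open_outer[OF fN sN Kb, of "e/2"] \<open>0 < e\<close> by auto
  obtain \<psi> g where \<psi>: "test_function (V \<inter> U) \<psi> g" "\<And>x. 0 \<le> \<psi> x \<and> \<psi> x \<le> 1" "\<And>x. x \<in> K \<Longrightarrow> \<psi> x = 1"
    using C1_urysohn[OF K(1), of "V \<inter> U"] K(2) V(1,2) A(2) assms(1) by (metis le_inf_iff open_Int order_trans)
  have supp: "\<psi> x = 0" if "x \<notin> V" for x
    using \<psi>(1) that closure_subset[of "{x. \<psi> x \<noteq> 0}"] unfolding test_function_def by auto
  have [measurable]: "\<psi> \<in> borel_measurable borel"
    using test_function_continuous[OF \<psi>(1)] by (rule borel_measurable_continuous_onI)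
  have [measurable]: "A \<in> sets borel" "K \<in> sets borel" "V \<in> sets borel" using A Kb V by auto
  have i1: "integrable lborel (\<lambda>x. indicator B x * h x)" if [measurable]: "B \<in> sets borel" for B
    by (rule Bochner_Integration.integrable_bound[OF h]) (use h' in \<open>auto simp: indicator_def\<close>)
  have i2: "integrable lborel (\<lambda>x. indicator B x * \<bar>h x\<bar>)" if [measurable]: "B \<in> sets borel" for B
    by (rule Bochner_Integration.integrable_bound[OF h]) (use h' in \<open>auto simp: indicator_def\<close>)
  have i3: "integrable lborel (\<lambda>x. \<psi> x * h x)" by (rule Bochner_Integration.integrable_bound[OF h])
      (use h' \<psi>(2) in \<open>auto simp: abs_mult intro!: mult_left_le_one_le\<close>)
  \<comment> \<open>On \<open>A - K\<close> the error is (1 - \<psi>) h, on the part of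
    \<open>V - K\<close> outside \<open>A\<close> it is - \<psi> h; both are at most |h| because
    \<psi> takes values in [0, 1].\<close>
  have le: "indicator A x * h x \<le> \<psi> x * h x + indicator (A - K) x * \<bar>h x\<bar> + indicator (V - K) x * \<bar>h x\<bar>" for x
  proof -
    have "\<bar>(1 - \<psi> x) * h x\<bar> \<le> \<bar>h x\<bar>" "\<bar>\<psi> x * h x\<bar> \<le> \<bar>h x\<bar>"
      using \<psi>(2)[of x] by (simp_all add: abs_mult mult_left_le_one_le)
    then have 1: "(1 - \<psi> x) * h x \<le> \<bar>h x\<bar>" "- (\<psi> x * h x) \<le> \<bar>h x\<bar>" by linarith+
    then show ?thesis using \<psi>(3)[of x] supp[of x] K(2) V(2) by (auto simp: indicator_def algebra_simps)
  qed
  have "(LBINT x. indicator A x * h x) \<le>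
      (LBINT x. \<psi> x * h x + indicator (A - K) x * \<bar>h x\<bar> + indicator (V - K) x * \<bar>h x\<bar>)"
    using le by (intro integral_mono i1 i2 i3 Bochner_Integration.integrable_add) auto
  also have "\<dots> = (LBINT x. \<psi> x * h x) + measure N (A - K) + measure N (V - K)"
    using i2[of "A - K"] i2[of "V - K"] i3 by (simp add: mN)
  also have "\<dots> \<le> c + e" using test[OF test_function_mono[OF \<psi>(1)] \<psi>(2)] K(3) V(3) by simp
  finally show "(LBINT x. indicator A x * h x) \<le> c + e" .
qed

text \<open>Test functions with values in [0, 1] cannot imitate the sign of \<open>h\<close>, so the
  sets where \<open>h\<close> is positive and negative are treated separately; hence the factor
  2.\<close>

lemma set_integral_abs_le_of_test_functions:
  fixes h :: "plane \<Rightarrow> real"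
  assumes "open U" and h: "integrable lborel h"
    and test: "\<And>\<psi> g. test_function U \<psi> g \<Longrightarrow> (\<And>x. 0 \<le> \<psi> x \<and> \<psi> x \<le> 1) \<Longrightarrow> \<bar>\<integral>x. \<psi> x * h x \<partial>lborel\<bar> \<le> c"
  shows "(LBINT x. indicator U x * \<bar>h x\<bar>) \<le> 2 * c"
proof -
  have h'[measurable]: "h \<in> borel_measurable borel" using h by auto
  have U[measurable]: "U \<in> sets borel" using assms(1) by simp
  define P where "P = U \<inter> {x. h x > 0}"
  define N where "N = U \<inter> {x. h x < 0}"
  have PN[measurable]: "P \<in> sets borel" "N \<in> sets borel" unfolding P_def N_def by measurable
  have "(LBINT x. indicator P x * h x) \<le> c"
  proof (rule set_integral_le_of_test_functions[OF assms(1) h])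
    show "(LBINT x. \<psi> x * h x) \<le> c" if "test_function U \<psi> g" "\<And>x. 0 \<le> \<psi> x \<and> \<psi> x \<le> 1" for \<psi> g
      using test[OF that] by (simp add: abs_le_iff)
  qed (use PN in \<open>auto simp: P_def\<close>)
  moreover have "(LBINT x. indicator N x * - h x) \<le> c"
  proof (rule set_integral_le_of_test_functions[OF assms(1)])
    show "integrable lborel (\<lambda>x. - h x)" using h by simp
    show "(LBINT x. \<psi> x * - h x) \<le> c" if "test_function U \<psi> g" "\<And>x. 0 \<le> \<psi> x \<and> \<psi> x \<le> 1" for \<psi> g
      using test[OF that] by (simp add: abs_le_iff)
  qed (use PN in \<open>auto simp: N_def\<close>)
  moreover have "(LBINT x. indicator U x * \<bar>h x\<bar>) =
      (LBINT x. indicator P x * h x + indicator N x * - h x)"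
    by (rule Bochner_Integration.integral_cong) (auto simp: P_def N_def indicator_def)
  moreover have "(LBINT x. indicator P x * h x + indicator N x * - h x) =
      (LBINT x. indicator P x * h x) + (LBINT x. indicator N x * - h x)"
    by (intro Bochner_Integration.integral_add Bochner_Integration.integrable_bound[OF h])
      (auto simp: indicator_def)
  ultimately show ?thesis by simp
qed

text \<open>Averaging over the translates \<open>y - s *\<^sub>R v\<close> spreads the support of
  \<psi> along the segments [x, x + v] that start in it, and these stay in \<open>W\<close> by
  assumption. The derivative of the average along \<open>v\<close> collapses, by the fundamental
  theorem of calculus, to a finite difference of \<psi>; this is how differences enter an
  integration by parts formula.\<close>

lemma test_function_segment_average:
  fixes v :: plane
  assumes \<psi>: "test_function {x. \<forall>s\<in>{0..1}. x + s *\<^sub>R v \<in> W} \<psi> g"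
  shows "test_function W (\<lambda>y. integral {0..1} (\<lambda>s. \<psi> (y - s *\<^sub>R v))) (\<lambda>y. integral {0..1} (\<lambda>s. g (y - s *\<^sub>R v)))"
    and "v \<bullet> integral {0..1} (\<lambda>s. g (y - s *\<^sub>R v)) = \<psi> y - \<psi> (y - v)"
proof -
  have gd: "(\<psi> has_derivative (\<lambda>h. h \<bullet> g x)) (at x)" for x using \<psi> unfolding test_function_def gderiv_def by blast
  have cg: "continuous_on UNIV g" and c\<psi>: "continuous_on UNIV \<psi>"
    using \<psi> test_function_continuous[OF \<psi>] unfolding test_function_def by auto
  have c1: "continuous_on S (\<lambda>p. g (fst p - snd p *\<^sub>R v))" for S
    by (rule continuous_on_compose2[OF cg]) (auto intro!: continuous_intros)
  have c2: "continuous_on S (\<lambda>s. \<psi> (y - s *\<^sub>R v))" for S y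
    by (rule continuous_on_compose2[OF c\<psi>]) (auto intro!: continuous_intros)
  have c3: "continuous_on S (\<lambda>s. g (y - s *\<^sub>R v))" for S y
    by (rule continuous_on_compose2[OF cg]) (auto intro!: continuous_intros)
  let ?\<Phi> = "\<lambda>y. integral {0..1} (\<lambda>s. \<psi> (y - s *\<^sub>R v))"
  let ?g = "\<lambda>y. integral {0..1} (\<lambda>s. g (y - s *\<^sub>R v))"
  let ?S = "closure {x. \<psi> x \<noteq> 0}"
  let ?K = "(\<lambda>p. fst p + snd p *\<^sub>R v) ` (?S \<times> {0..1})"
  have gi: "(\<lambda>s. g (y - s *\<^sub>R v)) integrable_on {0..1}" for y by (rule integrable_continuous_real[OF c3])
  have "GDERIV ?\<Phi> y :> ?g y" for y
  proof -
    have "((\<lambda>y. integral (cbox 0 1) (\<lambda>s. \<psi> (y - s *\<^sub>R v))) has_derivative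
       blinfun_apply (integral (cbox 0 1) (\<lambda>s. blinfun_inner_left (g (y - s *\<^sub>R v))))) (at y within UNIV)"
    proof (rule leibniz_rule)
      show "((\<lambda>x. \<psi> (x - t *\<^sub>R v)) has_derivative blinfun_apply (blinfun_inner_left (g (x - t *\<^sub>R v)))) (at x within UNIV)" for x t
      proof -
        have "((\<lambda>x. \<psi> (x - t *\<^sub>R v)) has_derivative (\<lambda>h. h \<bullet> g (x - t *\<^sub>R v))) (at x)"
          by (rule has_derivative_compose[OF _ gd]) (auto intro!: derivative_eq_intros)
        moreover have "blinfun_apply (blinfun_inner_left (g (x - t *\<^sub>R v))) = (\<lambda>h. h \<bullet> g (x - t *\<^sub>R v))" by auto
        ultimately show ?thesis by simp
      qed
      show "(\<lambda>s. \<psi> (x - s *\<^sub>R v)) integrable_on cbox 0 1" for x by (rule integrable_continuous[OF c2])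
      show "continuous_on (UNIV \<times> cbox 0 1) (\<lambda>(x, t). blinfun_inner_left (g (x - t *\<^sub>R v)))"
        using c1 by (auto simp: split_def intro!: bounded_linear.continuous_on[OF bounded_linear_blinfun_inner_left])
    qed auto
    moreover have "integral (cbox 0 1) (\<lambda>s. blinfun_inner_left (g (y - s *\<^sub>R v))) = blinfun_inner_left (?g y)"
      using integral_linear[OF gi[of y] bounded_linear_blinfun_inner_left] by (simp add: o_def)
    ultimately show ?thesis unfolding gderiv_def by (simp add: blinfun_inner_left.rep_eq)
  qed
  moreover have "continuous_on UNIV ?g"
    using integral_continuous_on_param[of UNIV 0 1 "\<lambda>y s. g (y - s *\<^sub>R v)"] c1 by (auto simp: split_def)
  moreover have "compact ?K" "?K \<subseteq> W"
  proof -
    have S: "compact ?S" "?S \<subseteq> {x. \<forall>s\<in>{0..1}. x + s *\<^sub>R v \<in> W}"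
      using \<psi> unfolding test_function_def by auto
    show "compact ?K" by (intro compact_continuous_image continuous_intros compact_Times S compact_Icc)
    show "?K \<subseteq> W" using S(2) by auto
  qed
  moreover have "{x. ?\<Phi> x \<noteq> 0} \<subseteq> ?K"
  proof
    fix y assume "y \<in> {x. ?\<Phi> x \<noteq> 0}"
    then obtain s where s: "s \<in> {0..1}" "\<psi> (y - s *\<^sub>R v) \<noteq> 0"
      using integral_cong[of "{0..1}" "\<lambda>s. \<psi> (y - s *\<^sub>R v)" "\<lambda>s. 0"] by auto
    then have "y - s *\<^sub>R v \<in> ?S" using closure_subset[of "{x. \<psi> x \<noteq> 0}"] by auto
    then show "y \<in> ?K" using s by (auto intro!: image_eqI[of _ _ "(y - s *\<^sub>R v, s)"])
  qed
  ultimately show "test_function W ?\<Phi> ?g" by (rule test_functionI)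
  have "((\<lambda>s. v \<bullet> g (y - s *\<^sub>R v)) has_integral - \<psi> (y - 1 *\<^sub>R v) - (- \<psi> (y - 0 *\<^sub>R v))) {0..1}"
  proof (rule fundamental_theorem_of_calculus)
    show "((\<lambda>s. - \<psi> (y - s *\<^sub>R v)) has_vector_derivative v \<bullet> g (y - s *\<^sub>R v)) (at s within {0..1})" for s
    proof -
      have "((\<lambda>s. \<psi> (y - s *\<^sub>R v)) has_derivative (\<lambda>h. (- (h *\<^sub>R v)) \<bullet> g (y - s *\<^sub>R v))) (at s within {0..1})"
        by (rule has_derivative_compose[OF _ gd]) (auto intro!: derivative_eq_intros)
      from has_derivative_minus[OF this] show ?thesis unfolding has_vector_derivative_def by simp
    qed
  qed simp
  then have "integral {0..1} (\<lambda>s. v \<bullet> g (y - s *\<^sub>R v)) = \<psi> y - \<psi> (y - v)" by (simp add: integral_unique)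
  then show "v \<bullet> ?g y = \<psi> y - \<psi> (y - v)"
    using integral_linear[OF gi[of y] bounded_linear_inner_right[of v]] by (simp add: o_def)
qed

section \<open>Segments meeting a set\<close>

lemma open_segment_tube:
  fixes V :: "plane set"
  assumes "open V"
  shows "open {x. \<exists>s\<in>{0..1}. x + s *\<^sub>R v \<in> V}"
proof -
  have "{x. \<exists>s\<in>{0..1}. x + s *\<^sub>R v \<in> V} = (\<Union>s\<in>{0..1}. (\<lambda>x. x + s *\<^sub>R v) -` V)" by auto
  moreover have "open ((\<lambda>x. x + s *\<^sub>R v) -` V)" for s by (rule open_vimage[OF assms]) (intro continuous_intros)
  ultimately show ?thesis by auto
qed

lemma emeasure_ball_plane: "0 \<le> r \<Longrightarrow> emeasure lborel (ball (c :: plane) r) = ennreal (pi * r\<^sup>2)"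
  using emeasure_ball[of r c] by (simp add: unit_ball_vol_2)

text \<open>The tube is covered by the \<open>\<lfloor>\<bar>v\<bar> / r\<rfloor> + 1\<close> balls of radius \<open>2 r\<close> centred at spacing \<open>r\<close> along its axis.\<close>

lemma emeasure_segment_tube_ball:
  fixes v c :: plane
  assumes "0 < r"
  shows "emeasure lborel {x. \<exists>s\<in>{0..1}. x + s *\<^sub>R v \<in> ball c r} \<le> ennreal (4 * pi * r * (norm v + r))"
proof -
  define q where "q = nat \<lfloor>norm v / r\<rfloor>"
  let ?b = "\<lambda>j::nat. ball (c - (j * r / norm v) *\<^sub>R v) (2 * r)"
  have "{x. \<exists>s\<in>{0..1}. x + s *\<^sub>R v \<in> ball c r} \<subseteq> (\<Union>j\<in>{..q}. ?b j)"
  proof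
    fix x assume "x \<in> {x. \<exists>s\<in>{0..1}. x + s *\<^sub>R v \<in> ball c r}"
    then obtain s where s: "0 \<le> s" "s \<le> 1" "norm (c - (x + s *\<^sub>R v)) < r" by (auto simp: dist_norm)
    \<comment> \<open>\<open>j * r\<close> is the grid length just below s |v|. The rounding error
      is less than \<open>r\<close> and accounts for the doubled radius. For \<open>v = 0\<close>
      the quotient \<open>j * r / norm v\<close> is 0.\<close>
    define j where "j = nat \<lfloor>s * norm v / r\<rfloor>"
    have j: "real j \<le> s * norm v / r" "s * norm v / r < real j + 1" unfolding j_def using s assms by (auto simp: of_nat_floor)
    have "j \<le> q" unfolding j_def q_def using s assms by (intro nat_mono floor_mono divide_right_mono mult_left_le_one_le) auto
    moreover have "norm ((s - j * r / norm v) *\<^sub>R v) \<le> r"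
    proof (cases "v = 0")
      case False
      have "norm ((s - j * r / norm v) *\<^sub>R v) = \<bar>s * norm v - j * r\<bar>"
      proof -
        have "norm ((s - j * r / norm v) *\<^sub>R v) = \<bar>(s - j * r / norm v) * norm v\<bar>" by (simp add: abs_mult)
        also have "(s - j * r / norm v) * norm v = s * norm v - j * r" using False by (simp add: left_diff_distrib)
        finally show ?thesis .
      qed
      also have "\<dots> \<le> r" using j assms by (simp add: field_simps abs_le_iff)
      finally show ?thesis .
    qed (use assms in simp)
    then have "norm (c - (j * r / norm v) *\<^sub>R v - x) < 2 * r"
      using s(3) norm_triangle_ineq[of "c - (x + s *\<^sub>R v)" "(s - j * r / norm v) *\<^sub>R v"] by (simp add: algebra_simps)
    ultimately show "x \<in> (\<Union>j\<in>{..q}. ?b j)" by (auto simp: dist_norm)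
  qed
  then have "emeasure lborel {x. \<exists>s\<in>{0..1}. x + s *\<^sub>R v \<in> ball c r} \<le> emeasure lborel (\<Union>j\<in>{..q}. ?b j)"
    by (intro emeasure_mono) auto
  also have "\<dots> \<le> (\<Sum>j\<in>{..q}. emeasure lborel (?b j))" by (rule emeasure_subadditive_finite) auto
  also have "\<dots> = (\<Sum>j\<in>{..q}. ennreal (pi * (2 * r)\<^sup>2))" using assms by (intro sum.cong refl emeasure_ball_plane) simp
  also have "\<dots> = ennreal (\<Sum>j\<in>{..q}. pi * (2 * r)\<^sup>2)" by (rule sum_ennreal) (simp add: assms)
  also have "\<dots> \<le> ennreal (4 * pi * r * (norm v + r))"
  proof (rule ennreal_leI)
    have "real q \<le> norm v / r" unfolding q_def using assms by (simp add: of_nat_floor)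
    then have "r * (real q + 1) \<le> norm v + r" using assms by (simp add: field_simps)
    then have "(4 * pi * r) * (r * (real q + 1)) \<le> (4 * pi * r) * (norm v + r)" using assms by (intro mult_left_mono) auto
    then show "(\<Sum>j\<in>{..q}. pi * (2 * r)\<^sup>2) \<le> 4 * pi * r * (norm v + r)" by (simp add: power2_eq_square algebra_simps)
  qed
  finally show ?thesis .
qed

text \<open>A nearly optimal cover by sets of diameter at most \<delta>/2 is inflated to open balls,
  whose radii have to exceed the diameters strictly, even where these are 0. Of the additional 1,
  one half pays for the infimum not being attained and one half for the inflation.\<close>

lemma hausdorff1_cover:
  fixes S :: "plane set"
  assumes H: "hausdorff1 S < \<infinity>" and "0 < \<delta>"
  obtains c :: "nat \<Rightarrow> plane" and r where "S \<subseteq> (\<Union>i. ball (c i) (r i))" "\<And>i. 0 < r i" "\<And>i. r i \<le> \<delta>"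
    "(\<Sum>i. ennreal (r i)) \<le> ennreal (enn2real (hausdorff1 S) + 1)"
proof -
  let ?F = "{C :: nat \<Rightarrow> plane set. S \<subseteq> (\<Union>i. C i) \<and> (\<forall>i. bounded (C i) \<and> diameter (C i) \<le> \<delta>/2)}"
  have "(INF C\<in>?F. \<Sum>i. ennreal (diameter (C i))) \<le> hausdorff1 S"
    unfolding hausdorff1_def using assms(2) by (intro SUP_upper) auto
  also have "\<dots> < hausdorff1 S + ennreal (1/2)"
    using H by (cases "hausdorff1 S") (auto simp: ennreal_less_iff simp del: ennreal_half simp flip: ennreal_plus)
  finally obtain C where C: "C \<in> ?F" "(\<Sum>i. ennreal (diameter (C i))) < hausdorff1 S + ennreal (1/2)"
    unfolding INF_less_iff by blast
  \<comment> \<open>The powers 2^-(i+2) sum to 1/2, which bounds the total padding; the factor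
    \<open>min (\<delta>/2) 1\<close> keeps each radius at most \<delta>.\<close>
  define r where "r i = diameter (C i) + min (\<delta>/2) 1 * (1/2) ^ Suc (Suc i)" for i
  define c where "c i = (SOME x. x \<in> C i)" for i
  have d0: "0 \<le> diameter (C i)" for i using C(1) by (auto intro: diameter_ge_0)
  show ?thesis
  proof
    show "0 < r i" for i unfolding r_def using d0[of i] assms(2) by (intro add_nonneg_pos) auto
    have "min (\<delta>/2) 1 * (1/2) ^ Suc (Suc i) \<le> \<delta>/2 * 1" for i using assms(2) by (intro mult_mono power_le_one) auto
    moreover have "diameter (C i) \<le> \<delta>/2" for i using C(1) by auto
    ultimately show "r i \<le> \<delta>" for i unfolding r_def
      by (metis (no_types, lifting) add_mono field_sum_of_halves mult.right_neutral)
    show "S \<subseteq> (\<Union>i. ball (c i) (r i))"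
    proof
      fix x assume "x \<in> S"
      then obtain i where i: "x \<in> C i" using C(1) by auto
      then have "c i \<in> C i" unfolding c_def by (rule someI)
      then have "dist (c i) x \<le> diameter (C i)" using i C(1) by (intro diameter_bounded_bound) auto
      also have "\<dots> < r i" unfolding r_def using assms(2) by simp
      finally show "x \<in> (\<Union>i. ball (c i) (r i))" by auto
    qed
    have geo: "(\<Sum>i. ennreal (min (\<delta>/2) 1 * (1/2) ^ Suc (Suc i))) \<le> ennreal (1/2)"
    proof -
      have s: "(\<lambda>i. (1/2) ^ Suc (Suc i)) sums (1/2 :: real)" using sums_mult[OF power_half_series, of "1/2"] by simp
      have "(\<Sum>i. ennreal (min (\<delta>/2) 1 * (1/2) ^ Suc (Suc i))) \<le> (\<Sum>i. ennreal ((1/2) ^ Suc (Suc i)))"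
        by (intro suminf_le summableI ennreal_leI) (auto simp: mult_le_cancel_right2)
      also have "\<dots> = ennreal (1/2)" by (rule suminf_ennreal_eq[OF _ s]) simp
      finally show ?thesis .
    qed
    have "(\<Sum>i. ennreal (r i)) = (\<Sum>i. ennreal (diameter (C i)) + ennreal (min (\<delta>/2) 1 * (1/2) ^ Suc (Suc i)))"
      unfolding r_def using d0 assms(2) by (intro suminf_cong ennreal_plus) auto
    also have "\<dots> = (\<Sum>i. ennreal (diameter (C i))) + (\<Sum>i. ennreal (min (\<delta>/2) 1 * (1/2) ^ Suc (Suc i)))"
      by (rule suminf_add[symmetric]) (auto intro: summableI)
    also have "\<dots> \<le> (hausdorff1 S + ennreal (1/2)) + ennreal (1/2)" using C(2) geo by (intro add_mono) auto
    also have "\<dots> = ennreal (enn2real (hausdorff1 S) + 1)"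
    proof (cases "hausdorff1 S")
      case (real h)
      have "(ennreal h + ennreal (1/2)) + ennreal (1/2) = ennreal (h + 1/2 + 1/2)"
        using real(1) by (subst ennreal_plus[symmetric], simp, simp)+ simp
      then show ?thesis using real by simp
    qed (use H in simp)
    finally show "(\<Sum>i. ennreal (r i)) \<le> ennreal (enn2real (hausdorff1 S) + 1)" .
  qed
qed

text \<open>Covering at scale |v| makes the area 4 pi r (|v| + r) of each tube at most 8 pi |v| r.
  This is linear in the radius, so the areas add up to a multiple of the sum of the radii.\<close>

lemma hausdorff1_segment_tube:
  fixes S :: "plane set"
  assumes "hausdorff1 S < \<infinity>" and "v \<noteq> 0"
  obtains V where "open V" "S \<subseteq> V"
    "emeasure lborel {x. \<exists>s\<in>{0..1}. x + s *\<^sub>R v \<in> V} \<le> ennreal (8 * pi * norm v * (enn2real (hausdorff1 S) + 1))"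
proof -
  obtain c :: "nat \<Rightarrow> plane" and r where r: "S \<subseteq> (\<Union>i. ball (c i) (r i))" "\<And>i. 0 < r i" "\<And>i. r i \<le> norm v"
    "(\<Sum>i. ennreal (r i)) \<le> ennreal (enn2real (hausdorff1 S) + 1)"
    using hausdorff1_cover[OF assms(1), of "norm v"] assms(2) by auto
  let ?V = "\<Union>i. ball (c i) (r i)"
  show ?thesis
  proof
    have "emeasure lborel {x. \<exists>s\<in>{0..1}. x + s *\<^sub>R v \<in> ?V} =
        emeasure lborel (\<Union>i. {x. \<exists>s\<in>{0..1}. x + s *\<^sub>R v \<in> ball (c i) (r i)})"
      by (rule arg_cong[where f="emeasure lborel"]) auto
    also have "\<dots> \<le> (\<Sum>i. emeasure lborel {x. \<exists>s\<in>{0..1}. x + s *\<^sub>R v \<in> ball (c i) (r i)})"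
      by (rule emeasure_subadditive_countably) (use open_segment_tube[OF open_ball] in auto)
    also have "\<dots> \<le> (\<Sum>i. ennreal (8 * pi * norm v) * ennreal (r i))"
    proof (intro suminf_le summableI)
      fix i
      have "4 * pi * r i * (norm v + r i) \<le> 4 * pi * r i * (norm v + norm v)" using r(2,3)[of i] by (intro mult_left_mono) auto
      then show "emeasure lborel {x. \<exists>s\<in>{0..1}. x + s *\<^sub>R v \<in> ball (c i) (r i)} \<le> ennreal (8 * pi * norm v) * ennreal (r i)"
        using r(2)[of i] by (intro order_trans[OF emeasure_segment_tube_ball[OF r(2)]])
          (auto simp: algebra_simps simp del: ennreal_plus simp flip: ennreal_mult intro!: ennreal_leI)
    qed
    also have "\<dots> = ennreal (8 * pi * norm v) * (\<Sum>i. ennreal (r i))" by (rule ennreal_suminf_cmult)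
    also have "\<dots> \<le> ennreal (8 * pi * norm v) * ennreal (enn2real (hausdorff1 S) + 1)" by (intro mult_left_mono r(4)) simp
    finally show "emeasure lborel {x. \<exists>s\<in>{0..1}. x + s *\<^sub>R v \<in> ?V} \<le> ennreal (8 * pi * norm v * (enn2real (hausdorff1 S) + 1))"
      by (simp add: ennreal_mult)
  qed (use r in auto)
qed

text \<open>If \<open>D\<close> contains a ball of radius \<open>r\<close>, then its boundary layer of width \<open>\<bar>v\<bar>\<close> misses the copy of
  \<open>D\<close> contracted by \<open>1 - \<bar>v\<bar> / r\<close> towards the centre of the ball.\<close>

lemma convex_boundary_layer:
  fixes D :: "plane set"
  assumes "open D" and "D \<noteq> {}" and "bounded D" and "convex D"
  obtains C where "0 \<le> C" "\<And>v. measure lborel {x \<in> D. x + v \<notin> D} \<le> C * norm v"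
proof -
  obtain a where a: "a \<in> D" using assms(2) by auto
  then obtain r where r: "0 < r" "cball a r \<subseteq> D" using assms(1) open_contains_cball by blast
  have Dm: "D \<in> sets lborel" "emeasure lborel D < \<infinity>" using assms emeasure_bounded_finite by auto
  then have Dl: "D \<in> lmeasurable" by (simp add: fmeasurable_def sets_completionI_sets)
  have fin: "emeasure lborel B < \<infinity>" if "B \<subseteq> D" for B
    using emeasure_mono[OF that Dm(1)] Dm(2) by (rule order_le_less_trans)
  have meas: "{x \<in> D. x + v \<notin> D} \<in> sets lborel" for v
  proof -
    have "{x \<in> D. x + v \<notin> D} = D - (\<lambda>x. x + v) -` D" by auto
    moreover have "open ((\<lambda>x. x + v) -` D)" by (rule open_vimage[OF assms(1)]) (intro continuous_intros)
    ultimately show ?thesis using Dm(1) by auto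
  qed
  have "measure lborel {x \<in> D. x + v \<notin> D} \<le> 2 * measure lborel D / r * norm v" for v
  proof (cases "norm v < r")
    \<comment> \<open>For shifts of length at least \<open>r\<close> the area of all of
      \<open>D\<close> is already a sufficient bound, as |v| / r >= 1.\<close>
    case False
    then have "1 \<le> norm v / r" using r by (simp add: field_simps)
    then have "2 * measure lborel D * 1 \<le> 2 * measure lborel D * (norm v / r)" by (intro mult_left_mono) auto
    moreover have "measure lborel {x \<in> D. x + v \<notin> D} \<le> measure lborel D"
      using Dm meas by (intro measure_mono_fmeasurable) (auto simp: fmeasurable_def)
    ultimately have "measure lborel {x \<in> D. x + v \<notin> D} \<le> 2 * measure lborel D * (norm v / r)"
      using measure_nonneg[of lborel D] by linarith
    then show ?thesis by simp
  next
    case True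
    define l where "l = norm v / r"
    have l: "0 \<le> l" "l < 1" "norm v = l * r" unfolding l_def using True r by (auto simp: field_simps)
    define A where "A = (\<lambda>x. (1 - l) *\<^sub>R x + l *\<^sub>R a) ` D"
    have A1: "x + v \<in> D" if "x \<in> A" for x
    proof (cases "l = 0")
      case True
      then show ?thesis using that l unfolding A_def by auto
    next
      case False
      obtain d where d: "d \<in> D" "x = (1 - l) *\<^sub>R d + l *\<^sub>R a" using \<open>x \<in> A\<close> unfolding A_def by auto
      \<comment> \<open>Since |v| = l r, the point a + v/l lies in the closed ball around
        \<open>a\<close>, and x + v is a convex combination of it and \<open>d\<close>.\<close>
      have "a + (1 / l) *\<^sub>R v \<in> D" using r l False by (intro subsetD[OF r(2)]) (auto simp: dist_norm)
      then have "(1 - l) *\<^sub>R d + l *\<^sub>R (a + (1 / l) *\<^sub>R v) \<in> D" using l d by (intro convexD[OF assms(4)]) auto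
      then show ?thesis using d(2) False by (simp add: scaleR_add_right add.assoc)
    qed
    have A2: "A \<subseteq> D" unfolding A_def using a l by (auto intro!: convexD[OF assms(4)])
    have "A = (+) (l *\<^sub>R a) ` ((*\<^sub>R) (1 - l) ` D)" unfolding A_def image_image by (simp add: add.commute)
    then have "open A" using l assms(1) by (auto intro!: open_translation open_scaling)
    then have Am: "A \<in> sets lborel" by simp
    have mA: "measure lborel A = (1 - l)\<^sup>2 * measure lborel D"
    proof -
      have "measure lebesgue A = \<bar>1 - l\<bar> ^ DIM(plane) * measure lebesgue D" unfolding A_def by (rule measure_lebesgue_affine)
      then show ?thesis using Am Dm by (simp add: measure_completion)
    qed
    have "measure lborel {x \<in> D. x + v \<notin> D} \<le> measure lborel (D - A)"
      using A1 Am Dm meas fin[of "D - A"] by (intro measure_mono_fmeasurable) (auto simp: fmeasurable_def)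
    also have "\<dots> = measure lborel D - measure lborel A" using Am Dm A2 by (intro measure_Diff) auto
    also have "\<dots> = (2 * l - l\<^sup>2) * measure lborel D" unfolding mA by (simp add: algebra_simps power2_eq_square)
    also have "\<dots> \<le> 2 * l * measure lborel D" by (intro mult_right_mono) auto
    finally show ?thesis unfolding l_def by (simp add: algebra_simps)
  qed
  then show ?thesis using r by (intro that[of "2 * measure lborel D / r"]) auto
qed

section \<open>Truncated differences\<close>

lemma
  fixes a :: "'a::euclidean_space" and f :: "'a \<Rightarrow> ennreal"
  assumes "f \<in> borel_measurable borel"
  shows nn_integral_lborel_translate: "(\<integral>\<^sup>+x. f (x + a) \<partial>lborel) = (\<integral>\<^sup>+x. f x \<partial>lborel)"
  using assms by (subst (2) lborel_distr_plus[of a, symmetric], subst nn_integral_distr) (auto simp: add.commute)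

lemma
  fixes a :: "'a::euclidean_space" and f :: "'a \<Rightarrow> 'b::{banach, second_countable_topology}"
  assumes "f \<in> borel_measurable borel"
  shows integral_lborel_translate: "(LBINT x. f (x + a)) = (LBINT x. f x)"
    and integrable_lborel_translate: "integrable lborel (\<lambda>x. f (x + a)) \<longleftrightarrow> integrable lborel f"
proof -
  show "(LBINT x. f (x + a)) = (LBINT x. f x)"
    using assms by (subst (2) lborel_distr_plus[of a, symmetric], subst integral_distr) (auto simp: add.commute)
  show "integrable lborel (\<lambda>x. f (x + a)) \<longleftrightarrow> integrable lborel f"
    using assms by (subst (2) lborel_distr_plus[of a, symmetric], subst integrable_distr_eq) (auto simp: add.commute)
qed

text \<open>Each section at fixed \<xi> is merely translated, so Tonelli and translation invariance
  suffice. With T \<xi> = \<epsilon> \<xi> the shear passes from one end of a bond to the other;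
  with T s = s v it slides points along a segment.\<close>

lemma distr_lborel_shear:
  fixes T :: "'b::euclidean_space \<Rightarrow> 'a::euclidean_space"
  assumes [measurable]: "T \<in> borel_measurable borel"
  shows "distr (lborel \<Otimes>\<^sub>M lborel) (lborel \<Otimes>\<^sub>M lborel) (\<lambda>(x, \<xi>). (x + T \<xi>, \<xi>)) = lborel \<Otimes>\<^sub>M lborel"
    (is "distr ?L ?L ?S = _")
proof (rule measure_eqI)
  fix A assume "A \<in> sets (distr ?L ?L ?S)"
  then have A[measurable]: "A \<in> sets (borel \<Otimes>\<^sub>M borel)" by (simp cong: sets_pair_measure_cong)
  have S: "?S \<in> measurable ?L ?L" by measurable
  have "emeasure (distr ?L ?L ?S) A = (\<integral>\<^sup>+p. indicator A p \<partial>distr ?L ?L ?S)"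
    by (subst nn_integral_indicator) (auto cong: sets_pair_measure_cong)
  also have "\<dots> = (\<integral>\<^sup>+p. indicator A (fst p + T (snd p), snd p) \<partial>?L)"
    by (subst nn_integral_distr[OF S]) (auto simp: split_def cong: measurable_cong_sets sets_pair_measure_cong)
  also have "\<dots> = (\<integral>\<^sup>+\<xi>. (\<integral>\<^sup>+x. indicator A (x + T \<xi>, \<xi>) \<partial>lborel) \<partial>lborel)"
    by (subst lborel_pair.nn_integral_snd[symmetric]) (auto simp: split_def)
  also have "\<dots> = (\<integral>\<^sup>+\<xi>. (\<integral>\<^sup>+x. indicator A (x, \<xi>) \<partial>lborel) \<partial>lborel)"
    by (intro nn_integral_cong nn_integral_lborel_translate[of "\<lambda>x. indicator A (x, _)"]) measurable
  also have "\<dots> = (\<integral>\<^sup>+p. indicator A p \<partial>?L)"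
    by (subst lborel_pair.nn_integral_snd[symmetric]) (auto simp: split_def)
  also have "\<dots> = emeasure ?L A" by (subst nn_integral_indicator) (auto cong: sets_pair_measure_cong)
  finally show "emeasure (distr ?L ?L ?S) A = emeasure ?L A" .
qed simp

lemma
  fixes T :: "'b::euclidean_space \<Rightarrow> 'a::euclidean_space" and F :: "'a \<Rightarrow> 'b \<Rightarrow> real"
  assumes [measurable]: "T \<in> borel_measurable borel" "case_prod F \<in> borel_measurable (lborel \<Otimes>\<^sub>M lborel)"
  shows integral_lborel_shear:
      "(\<integral>p. F (fst p + T (snd p)) (snd p) \<partial>(lborel \<Otimes>\<^sub>M lborel)) = (\<integral>p. F (fst p) (snd p) \<partial>(lborel \<Otimes>\<^sub>M lborel))"
    and integrable_lborel_shear: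
      "integrable (lborel \<Otimes>\<^sub>M lborel) (\<lambda>p. F (fst p + T (snd p)) (snd p)) \<longleftrightarrow>
       integrable (lborel \<Otimes>\<^sub>M lborel) (\<lambda>p. F (fst p) (snd p))"
proof -
  let ?L = "lborel \<Otimes>\<^sub>M lborel :: ('a \<times> 'b) measure"
  have S: "(\<lambda>(x, \<xi>). (x + T \<xi>, \<xi>)) \<in> measurable ?L ?L" by measurable
  have F: "(\<lambda>p. F (fst p) (snd p)) \<in> borel_measurable ?L" by measurable
  show "(\<integral>p. F (fst p + T (snd p)) (snd p) \<partial>?L) = (\<integral>p. F (fst p) (snd p) \<partial>?L)"
    using integral_distr[OF S F] unfolding distr_lborel_shear[OF assms(1)] by (simp add: split_def)
  show "integrable ?L (\<lambda>p. F (fst p + T (snd p)) (snd p)) \<longleftrightarrow> integrable ?L (\<lambda>p. F (fst p) (snd p))"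
    using integrable_distr_eq[OF S F] unfolding distr_lborel_shear[OF assms(1)] by (simp add: split_def)
qed

lemma
  fixes g :: "'a::euclidean_space \<Rightarrow> real" and \<kappa> :: "'b::euclidean_space \<Rightarrow> real"
  assumes g: "integrable lborel g" and \<kappa>: "integrable lborel \<kappa>"
  shows integrable_pair_mult: "integrable (lborel \<Otimes>\<^sub>M lborel) (\<lambda>p. \<kappa> (snd p) * g (fst p))"
    and integral_pair_mult: "(\<integral>p. \<kappa> (snd p) * g (fst p) \<partial>(lborel \<Otimes>\<^sub>M lborel)) = (LBINT \<xi>. \<kappa> \<xi>) * (LBINT x. g x)"
proof -
  have [measurable]: "g \<in> borel_measurable borel" "\<kappa> \<in> borel_measurable borel" using g \<kappa> by auto
  show i: "integrable (lborel \<Otimes>\<^sub>M lborel) (\<lambda>p. \<kappa> (snd p) * g (fst p))"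
  proof (rule integrableI_bounded)
    have "(\<integral>\<^sup>+p. ennreal (norm (\<kappa> (snd p) * g (fst p))) \<partial>(lborel \<Otimes>\<^sub>M lborel)) =
        (\<integral>\<^sup>+x. (\<integral>\<^sup>+\<xi>. ennreal \<bar>\<kappa> \<xi>\<bar> * ennreal \<bar>g x\<bar> \<partial>lborel) \<partial>lborel)"
      by (subst lborel.nn_integral_fst[symmetric]) (auto simp: abs_mult ennreal_mult)
    also have "\<dots> = (\<integral>\<^sup>+\<xi>. ennreal \<bar>\<kappa> \<xi>\<bar> \<partial>lborel) * (\<integral>\<^sup>+x. ennreal \<bar>g x\<bar> \<partial>lborel)"
      by (subst nn_integral_multc, measurable, subst nn_integral_cmult) auto
    also have "\<dots> < \<infinity>" using g \<kappa> by (auto simp: integrable_iff_bounded ennreal_mult_less_top)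
    finally show "(\<integral>\<^sup>+p. ennreal (norm (\<kappa> (snd p) * g (fst p))) \<partial>(lborel \<Otimes>\<^sub>M lborel)) < \<infinity>" .
  qed measurable
  show "(\<integral>p. \<kappa> (snd p) * g (fst p) \<partial>(lborel \<Otimes>\<^sub>M lborel)) = (LBINT \<xi>. \<kappa> \<xi>) * (LBINT x. g x)"
    using lborel_pair.integral_fst'[OF i] by simp
qed

section \<open>Averages along segments\<close>

lemma norm_integral_le_nn_integral:
  fixes f :: "'a \<Rightarrow> real"
  shows "ennreal \<bar>\<integral>x. f x \<partial>M\<bar> \<le> (\<integral>\<^sup>+x. ennreal \<bar>f x\<bar> \<partial>M)"
proof (cases "integrable M f")
  case True
  then show ?thesis using integral_norm_bound_ennreal[OF True] by simp
next
  \<comment> \<open>A nonintegrable function has Bochner integral 0, so segment averages can be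
    estimated without knowing at which base points they converge.\<close>
  case False
  then show ?thesis by (simp add: not_integrable_integral_eq)
qed

text \<open>Jensen's inequality, as Cauchy-Schwarz against the indicator of the unit interval,
  followed by Tonelli and translation invariance: averaging along segments is a contraction of
  L^2.\<close>

lemma nn_integral_segment_average_square_le:
  fixes H :: "plane \<Rightarrow> real" and v :: plane
  assumes [measurable]: "H \<in> borel_measurable borel"
  shows "(\<integral>\<^sup>+y. ennreal ((LBINT s. indicator {0..1} s * H (y + s *\<^sub>R v))\<^sup>2) \<partial>lborel) \<le> (\<integral>\<^sup>+y. ennreal ((H y)\<^sup>2) \<partial>lborel)"
proof -
  have "ennreal ((LBINT s. indicator {0..1} s * H (y + s *\<^sub>R v))\<^sup>2)
      \<le> (\<integral>\<^sup>+s. indicator {0..1} s * ennreal ((H (y + s *\<^sub>R v))\<^sup>2) \<partial>lborel)" for y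
  proof -
    let ?f = "\<lambda>s. indicator {0..1} s * H (y + s *\<^sub>R v)"
    have "ennreal ((LBINT s. ?f s)\<^sup>2) = (ennreal \<bar>\<integral>s. ?f s \<partial>lborel\<bar>)\<^sup>2"
      by (simp add: ennreal_power)
    also have "\<dots> \<le> (\<integral>\<^sup>+s. ennreal \<bar>?f s\<bar> \<partial>lborel)\<^sup>2"
      by (intro power_mono norm_integral_le_nn_integral) simp
    also have "\<dots> = (\<integral>\<^sup>+s. indicator {0..1} s * ennreal \<bar>?f s\<bar> \<partial>lborel)\<^sup>2"
      by (intro arg_cong[where f="\<lambda>x. x\<^sup>2"] nn_integral_cong) (auto simp: indicator_def)
    also have "\<dots> \<le> (\<integral>\<^sup>+s. (indicator {0..1::real} s)\<^sup>2 \<partial>lborel) * (\<integral>\<^sup>+s. (ennreal \<bar>?f s\<bar>)\<^sup>2 \<partial>lborel)"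
      by (rule Cauchy_Schwarz_nn_integral) auto
    also have "(\<integral>\<^sup>+s. (indicator {0..1::real} s)\<^sup>2 \<partial>lborel) = (\<integral>\<^sup>+s. indicator {0..1::real} s \<partial>lborel)"
      by (intro nn_integral_cong) (auto simp: indicator_def)
    also have "\<dots> = 1" by simp
    also have "(\<integral>\<^sup>+s. (ennreal \<bar>?f s\<bar>)\<^sup>2 \<partial>lborel) = (\<integral>\<^sup>+s. indicator {0..1} s * ennreal ((H (y + s *\<^sub>R v))\<^sup>2) \<partial>lborel)"
      by (intro nn_integral_cong) (auto simp: indicator_def ennreal_power)
    finally show ?thesis by simp
  qed
  then have "(\<integral>\<^sup>+y. ennreal ((LBINT s. indicator {0..1} s * H (y + s *\<^sub>R v))\<^sup>2) \<partial>lborel)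
      \<le> (\<integral>\<^sup>+y. (\<integral>\<^sup>+s. indicator {0..1} s * ennreal ((H (y + s *\<^sub>R v))\<^sup>2) \<partial>lborel) \<partial>lborel)"
    by (intro nn_integral_mono)
  also have "\<dots> = (\<integral>\<^sup>+s. (\<integral>\<^sup>+y. indicator {0..1} s * ennreal ((H (y + s *\<^sub>R v))\<^sup>2) \<partial>lborel) \<partial>lborel)"
    by (rule lborel_pair.Fubini') measurable
  also have "\<dots> = (\<integral>\<^sup>+s. indicator {0..1::real} s * (\<integral>\<^sup>+y. ennreal ((H y)\<^sup>2) \<partial>lborel) \<partial>lborel)"
    by (intro nn_integral_cong, subst nn_integral_cmult)
      (auto simp: nn_integral_lborel_translate[of "\<lambda>y. ennreal ((H y)\<^sup>2)"])
  also have "\<dots> = (\<integral>\<^sup>+y. ennreal ((H y)\<^sup>2) \<partial>lborel)" by (subst nn_integral_multc) auto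
  finally show ?thesis .
qed

text \<open>The shear (y, s) -> (y + s v, s) moves the average from \<open>H\<close> to \<psi> and
  reverses its direction: averaging forwards and averaging backwards are adjoint.\<close>

lemma
  fixes H \<psi> :: "plane \<Rightarrow> real" and v :: plane
  assumes H: "integrable lborel H" and [measurable]: "\<psi> \<in> borel_measurable borel" and \<psi>: "\<And>x. \<bar>\<psi> x\<bar> \<le> 1"
  defines "P \<equiv> \<lambda>y. \<integral>s. indicator {0..1} s * H (y + s *\<^sub>R v) \<partial>lborel"
  shows integral_mult_segment_average:
      "(LBINT y. \<psi> y * P y) = (LBINT y. (LBINT s. indicator {0..1} s * \<psi> (y - s *\<^sub>R v)) * H y)"
    and integrable_segment_average: "integrable lborel P"
proof -
  let ?L = "lborel \<Otimes>\<^sub>M lborel :: (plane \<times> real) measure" and ?I = "indicator {0..1} :: real \<Rightarrow> real"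
  let ?F = "\<lambda>y s. ?I s * (\<psi> (y - s *\<^sub>R v) * H y)" and ?F' = "\<lambda>y s. ?I s * (\<psi> y * H (y + s *\<^sub>R v))"
  have [measurable]: "H \<in> borel_measurable borel" using H by auto
  have T: "(\<lambda>s::real. s *\<^sub>R v) \<in> borel_measurable borel" by measurable
  have iH: "integrable ?L (\<lambda>p. ?I (snd p) * H (fst p))" by (rule integrable_pair_mult[OF H]) simp
  then have "integrable ?L (\<lambda>p. ?I (snd p) * H (fst p + snd p *\<^sub>R v))"
    using integrable_lborel_shear[OF T, of "\<lambda>y s. ?I s * H y"] by simp
  from lborel_pair.integrable_fst'[OF this] show "integrable lborel P" by (simp add: P_def)
  have iF: "integrable ?L (\<lambda>p. ?F (fst p) (snd p))" by (rule Bochner_Integration.integrable_bound[OF iH])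
      (use \<psi> in \<open>auto simp: abs_mult indicator_def intro!: mult_left_le_one_le\<close>)
  then have iF': "integrable ?L (\<lambda>p. ?F' (fst p) (snd p))" using integrable_lborel_shear[OF T, of ?F] by simp
  have "(LBINT y. \<psi> y * P y) = (LBINT y. (LBINT s. ?F' y s))" by (simp add: P_def mult.left_commute)
  also have "\<dots> = (\<integral>p. ?F' (fst p) (snd p) \<partial>?L)" using lborel_pair.integral_fst'[OF iF'] by simp
  also have "\<dots> = (\<integral>p. ?F (fst p) (snd p) \<partial>?L)" using integral_lborel_shear[OF T, of ?F] by simp
  also have "\<dots> = (LBINT y. (LBINT s. ?F y s))" using lborel_pair.integral_fst'[OF iF] by simp
  also have "\<dots> = (LBINT y. (LBINT s. indicator {0..1} s * \<psi> (y - s *\<^sub>R v)) * H y)" by (simp flip: mult.assoc)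
  finally show "(LBINT y. \<psi> y * P y) = (LBINT y. (LBINT s. indicator {0..1} s * \<psi> (y - s *\<^sub>R v)) * H y)" .
qed

lemma test_function_gradient_eq_0:
  assumes "test_function V \<phi> g" and "x \<notin> closure {x. \<phi> x \<noteq> 0}"
  shows "g x = 0"
proof -
  have "(\<phi> has_derivative (\<lambda>_. 0)) (at x)"
  proof (rule has_derivative_transform_within_open[OF has_derivative_const[of 0]])
    show "open (- closure {x. \<phi> x \<noteq> 0})" by (simp add: open_Compl)
    show "x \<in> - closure {x. \<phi> x \<noteq> 0}" using assms(2) by simp
    show "0 = \<phi> y" if "y \<in> - closure {x. \<phi> x \<noteq> 0}" for y
    proof (rule ccontr)
      assume "0 \<noteq> \<phi> y"
      then have "y \<in> closure {x. \<phi> x \<noteq> 0}" by (intro subsetD[OF closure_subset]) simp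
      then show False using that by simp
    qed
  qed
  moreover have "(\<phi> has_derivative (\<lambda>h. h \<bullet> g x)) (at x)"
    using assms(1) unfolding test_function_def gderiv_def by (elim conjE allE)
  ultimately have "(\<lambda>h. h \<bullet> g x) = (\<lambda>_. 0)" by (rule has_derivative_unique[rotated])
  then have "g x \<bullet> g x = 0" by metis
  then show ?thesis by simp
qed

lemma test_function_bounds:
  assumes "test_function V \<phi> g"
  obtains B where "\<And>x. norm (g x) \<le> B"
proof -
  let ?K = "closure {x. \<phi> x \<noteq> 0}"
  have "compact ?K" "continuous_on ?K g" using assms continuous_on_subset unfolding test_function_def by auto
  then have "bounded (g ` ?K)" by (intro compact_imp_bounded compact_continuous_image)
  then obtain B where B: "\<And>x. x \<in> ?K \<Longrightarrow> norm (g x) \<le> B" unfolding bounded_iff by auto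
  have "norm (g x) \<le> max B 0" for x using B[of x] test_function_gradient_eq_0[OF assms, of x] by (cases "x \<in> ?K") auto
  then show ?thesis by (rule that)
qed

text \<open>The complement consists of the differences of points of the closed set \<open>-W\<close>
  and of the compact segment [0, v]; such a set is closed.\<close>

lemma open_segment_inside:
  fixes W :: "plane set"
  assumes "open W"
  shows "open {x. \<forall>s\<in>{0..1}. x + s *\<^sub>R v \<in> W}"
proof -
  have "closed (\<Union>x\<in>-W. \<Union>y\<in>(\<lambda>s. s *\<^sub>R v) ` {0..1}. {x - y})"
    using assms by (intro closed_compact_differences compact_continuous_image continuous_intros) auto
  moreover have "- (\<Union>x\<in>-W. \<Union>y\<in>(\<lambda>s. s *\<^sub>R v) ` {0..1}. {x - y}) = {x. \<forall>s\<in>{0..1}. x + s *\<^sub>R v \<in> W}"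
    by (force simp: algebra_simps)
  ultimately show ?thesis by (simp add: closed_def)
qed

text \<open>Testing the integration by parts formula with segment averages of \<open>\<psi>\<close> says that the difference of \<open>w\<close>
  and the segment average of its gradient agree up to a measure of mass at most \<open>\<bar>v\<bar> m(W)\<close>.\<close>

lemma difference_minus_segment_average_bound:
  fixes w :: "plane \<Rightarrow> real" and G :: "plane \<Rightarrow> plane"
  assumes W: "open W" and w: "integrable lborel w" and G: "integrable lborel G"
    and m: "finite_measure m" "sets m = sets borel"
    and \<sigma>: "\<sigma> \<in> borel_measurable m" "AE x in m. norm (\<sigma> x) \<le> 1"
    and ibp: "\<And>\<phi> g. test_function W \<phi> g \<Longrightarrow>
       (LBINT x. w x *\<^sub>R g x) = - ((LBINT x. \<phi> x *\<^sub>R G x) + (\<integral>x. \<phi> x *\<^sub>R \<sigma> x \<partial>m))"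
  shows "(LBINT x. indicator {x. \<forall>s\<in>{0..1}. x + s *\<^sub>R v \<in> W} x *
       \<bar>w (x + v) - w x - (LBINT s. indicator {0..1} s * (v \<bullet> G (x + s *\<^sub>R v)))\<bar>) \<le> 2 * (norm v * measure m W)"
proof (rule set_integral_abs_le_of_test_functions[OF open_segment_inside[OF W]])
  have [measurable]: "w \<in> borel_measurable borel" "G \<in> borel_measurable borel" using w G by auto
  let ?P = "\<lambda>x. \<integral>s. indicator {0..1} s * (v \<bullet> G (x + s *\<^sub>R v)) \<partial>lborel"
  have vG: "integrable lborel (\<lambda>x. v \<bullet> G x)" using G by simp
  have wv: "integrable lborel (\<lambda>x. w (x + v))" using w by (simp add: integrable_lborel_translate)
  have P: "integrable lborel ?P" by (rule integrable_segment_average[OF vG, of "\<lambda>_. 0"]) auto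
  show "integrable lborel (\<lambda>x. w (x + v) - w x - ?P x)" by (intro Bochner_Integration.integrable_diff w wv P)
  fix \<psi> g assume \<psi>: "test_function {x. \<forall>s\<in>{0..1}. x + s *\<^sub>R v \<in> W} \<psi> g" and \<psi>01: "\<And>x. 0 \<le> \<psi> x \<and> \<psi> x \<le> 1"
  define \<Phi> where "\<Phi> y = integral {0..1} (\<lambda>s. \<psi> (y - s *\<^sub>R v))" for y
  define g\<Phi> where "g\<Phi> y = integral {0..1} (\<lambda>s. g (y - s *\<^sub>R v))" for y
  have tf: "test_function W \<Phi> g\<Phi>" and vg: "v \<bullet> g\<Phi> y = \<psi> y - \<psi> (y - v)" for y
    using test_function_segment_average[OF \<psi>] unfolding \<Phi>_def[abs_def] g\<Phi>_def[abs_def] by auto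
  have c\<psi>: "continuous_on UNIV \<psi>" by (rule test_function_continuous[OF \<psi>])
  have c\<Phi>: "continuous_on UNIV \<Phi>" by (rule test_function_continuous[OF tf])
  have cg: "continuous_on UNIV g\<Phi>" using tf unfolding test_function_def by blast
  have [measurable]: "\<psi> \<in> borel_measurable borel" "\<Phi> \<in> borel_measurable borel" "g\<Phi> \<in> borel_measurable borel"
    using c\<psi> c\<Phi> cg by (auto intro: borel_measurable_continuous_onI)
  have c: "continuous_on {0..1} (\<lambda>s. \<psi> (y - s *\<^sub>R v))" for y
    by (rule continuous_on_compose2[OF c\<psi>]) (auto intro!: continuous_intros)
  have \<Phi>leb: "\<Phi> y = (LBINT s. indicator {0..1} s * \<psi> (y - s *\<^sub>R v))" for y using borel_integrable_atLeastAtMost'[OF c]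
    unfolding \<Phi>_def by (simp add: set_borel_integral_eq_integral(2)[symmetric] set_lebesgue_integral_def)
  have \<Phi>01: "\<bar>\<Phi> y\<bar> \<le> 1" for y
  proof -
    note i = integrable_continuous_real[OF c]
    have "\<Phi> y \<le> integral {0..1::real} (\<lambda>s. 1)" unfolding \<Phi>_def using i \<psi>01 by (intro integral_le) auto
    moreover have "0 \<le> \<Phi> y" unfolding \<Phi>_def using i \<psi>01 by (intro integral_nonneg) auto
    ultimately show ?thesis by simp
  qed
  have \<Phi>W: "\<Phi> y = 0" if "y \<notin> W" for y
    using tf that closure_subset[of "{x. \<Phi> x \<noteq> 0}"] unfolding test_function_def by auto
  obtain B where B: "\<And>x. norm (g\<Phi> x) \<le> B" using test_function_bounds[OF tf] by blast
  have iw\<psi>: "integrable lborel (\<lambda>x. \<psi> x * f x)" if "integrable lborel f" for f :: "plane \<Rightarrow> real"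
    by (rule Bochner_Integration.integrable_bound[OF that])
      (use that \<psi>01 in \<open>auto simp: abs_mult intro!: mult_left_le_one_le\<close>)
  \<comment> \<open>A shift by \<open>v\<close> transfers the difference from \<open>w\<close> to
    \<psi>, where it is minus the derivative of the averaged test function \<Phi> along
    \<open>v\<close>.\<close>
  have 1: "(LBINT x. \<psi> x * (w (x + v) - w x)) = - (LBINT x. w x * (v \<bullet> g\<Phi> x))"
  proof -
    have sh: "(LBINT x. \<psi> x * w (x + v)) = (LBINT x. \<psi> (x - v) * w x)"
      using integral_lborel_translate[of "\<lambda>x. \<psi> (x - v) * w x" v] by simp
    have i2: "integrable lborel (\<lambda>x. \<psi> (x - v) * w x)"
      by (rule Bochner_Integration.integrable_bound[OF w]) (use \<psi>01 in \<open>auto simp: abs_mult intro!: mult_left_le_one_le\<close>)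
    have "(LBINT x. w x * (v \<bullet> g\<Phi> x)) = (LBINT x. \<psi> x * w x - \<psi> (x - v) * w x)"
      unfolding vg by (simp add: algebra_simps)
    also have "\<dots> = (LBINT x. \<psi> x * w x) - (LBINT x. \<psi> (x - v) * w x)"
      by (intro Bochner_Integration.integral_diff i2 iw\<psi> w)
    also have "\<dots> = - (LBINT x. \<psi> x * (w (x + v) - w x))"
      using iw\<psi>[OF w] iw\<psi>[OF wv] by (simp add: right_diff_distrib sh)
    finally show ?thesis by simp
  qed
  have 2: "(LBINT x. w x * (v \<bullet> g\<Phi> x)) = v \<bullet> (LBINT x. w x *\<^sub>R g\<Phi> x)"
  proof -
    have "integrable lborel (\<lambda>x. w x *\<^sub>R g\<Phi> x)"
      by (rule Bochner_Integration.integrable_bound[of _ "\<lambda>x. B * w x"])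
        (use w mult_left_mono[OF order_trans[OF B abs_ge_self] abs_ge_zero] in \<open>auto simp: abs_mult mult.commute[of "\<bar>B\<bar>"]\<close>)
    from integral_inner_right[OF this, of v] show ?thesis by simp
  qed
  have 3: "v \<bullet> (LBINT x. \<Phi> x *\<^sub>R G x) = (LBINT x. \<psi> x * ?P x)"
  proof -
    have "integrable lborel (\<lambda>x. \<Phi> x *\<^sub>R G x)"
      by (rule Bochner_Integration.integrable_bound[OF G]) (use \<Phi>01 in \<open>auto intro!: mult_left_le_one_le\<close>)
    from integral_inner_right[OF this, of v] have "v \<bullet> (LBINT x. \<Phi> x *\<^sub>R G x) = (LBINT x. \<Phi> x * (v \<bullet> G x))"
      by simp
    also have "\<dots> = (LBINT x. \<psi> x * ?P x)"
      unfolding \<Phi>leb using \<psi>01 by (intro integral_mult_segment_average[OF vG, symmetric]) auto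
    finally show ?thesis .
  qed
  interpret m: finite_measure m by fact
  have 4: "\<bar>v \<bullet> (\<integral>x. \<Phi> x *\<^sub>R \<sigma> x \<partial>m)\<bar> \<le> norm v * measure m W"
  proof -
    have "\<bar>v \<bullet> (\<integral>x. \<Phi> x *\<^sub>R \<sigma> x \<partial>m)\<bar> \<le> norm v * norm (\<integral>x. \<Phi> x *\<^sub>R \<sigma> x \<partial>m)"
      by (rule Cauchy_Schwarz_ineq2)
    moreover have "norm (\<integral>x. \<Phi> x *\<^sub>R \<sigma> x \<partial>m) \<le> (\<integral>x. indicator W x \<partial>m)"
    proof -
      have Wm: "W \<in> sets m" using W m(2) by simp
      have [measurable]: "\<Phi> \<in> borel_measurable m" using m(2) by (simp cong: measurable_cong_sets)
      have i: "integrable m (indicator W :: plane \<Rightarrow> real)"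
        using Wm by (intro integrable_real_indicator) (auto simp: m.emeasure_eq_measure)
      have ae: "AE x in m. norm (\<Phi> x *\<^sub>R \<sigma> x) \<le> indicator W x" using \<sigma>(2)
      proof eventually_elim
        case (elim x)
        then show ?case
          using \<Phi>01[of x] \<Phi>W[of x] mult_le_one[of "\<bar>\<Phi> x\<bar>" "norm (\<sigma> x)"] by (cases "x \<in> W") auto
      qed
      have "integrable m (\<lambda>x. \<Phi> x *\<^sub>R \<sigma> x)"
        by (rule Bochner_Integration.integrable_bound[OF i]) (use ae \<sigma>(1) in auto)
      then show ?thesis
        using integral_norm_bound[of m "\<lambda>x. \<Phi> x *\<^sub>R \<sigma> x"] integral_mono_AE[OF integrable_norm i ae]
        by (meson order_trans)
    qed
    moreover have "(\<integral>x. indicator W x \<partial>m) = measure m W" using W m(2) sets_eq_imp_space_eq[OF m(2)] by simp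
    ultimately show ?thesis using order_trans[OF _ mult_left_mono[OF _ norm_ge_zero[of v]]] by simp
  qed
  \<comment> \<open>The formula \<open>ibp\<close> for \<Phi> cancels the absolutely continuous part
    against the segment average of \<open>G\<close>. Only the pairing with the jump part survives,
    and it is at most |v| times the mass of \<open>W\<close> because |\<Phi>| <= 1 and \<Phi>
    vanishes off \<open>W\<close>.\<close>
  have "(LBINT x. \<psi> x * (w (x + v) - w x - ?P x)) =
      (LBINT x. \<psi> x * (w (x + v) - w x)) - (LBINT x. \<psi> x * ?P x)"
    using iw\<psi>[OF Bochner_Integration.integrable_diff[OF wv w]] iw\<psi>[OF P] by (simp add: right_diff_distrib)
  also have "\<dots> = v \<bullet> (\<integral>x. \<Phi> x *\<^sub>R \<sigma> x \<partial>m)"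
    unfolding 1 2 ibp[OF tf] 3[symmetric] by (simp add: inner_add_right inner_diff_right)
  finally show "\<bar>\<integral>x. \<psi> x * (w (x + v) - w x - ?P x) \<partial>lborel\<bar> \<le> norm v * measure m W" using 4 by simp
qed

text \<open>Cover the jump set by an open set \<open>V\<close> that few segments \<open>[x, x + v]\<close> meet, and remove from \<open>D\<close> a compact
  subset of \<open>V\<close> carrying nearly all of the jump part.\<close>

lemma truncated_difference_bound:
  fixes w :: "plane \<Rightarrow> real" and G :: "plane \<Rightarrow> plane"
  assumes D: "open D" "convex D" and w: "integrable lborel w" and G: "integrable lborel G"
    and G2: "integrable lborel (\<lambda>x. (norm (G x))\<^sup>2)"
    and m: "finite_measure m" "sets m = sets borel" "AE x in m. x \<in> D" "AE x in m. x \<in> S"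
    and S: "hausdorff1 S < \<infinity>"
    and \<sigma>: "\<sigma> \<in> borel_measurable m" "AE x in m. norm (\<sigma> x) \<le> 1"
    and ibp: "\<And>\<phi> g. test_function D \<phi> g \<Longrightarrow>
       (LBINT x. w x *\<^sub>R g x) = - ((LBINT x. \<phi> x *\<^sub>R G x) + (\<integral>x. \<phi> x *\<^sub>R \<sigma> x \<partial>m))"
    and "v \<noteq> 0"
  shows "(\<integral>\<^sup>+x. ennreal (indicator {x \<in> D. x + v \<in> D} x * min 1 ((w (x + v) - w x)\<^sup>2 / norm v)) \<partial>lborel)
     \<le> ennreal ((8 * pi * (enn2real (hausdorff1 S) + 1) + 2 * (LBINT x. (norm (G x))\<^sup>2) + 3) * norm v)"
proof -
  have [measurable]: "w \<in> borel_measurable borel" "G \<in> borel_measurable borel" using w G by auto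
  define h where "h = norm v"
  let ?i = "\<lambda>x. indicator {x \<in> D. x + v \<in> D} x * min 1 ((w (x + v) - w x)\<^sup>2 / h) :: real"
  let ?H = "enn2real (hausdorff1 S)" and ?G2 = "\<integral>x. (norm (G x))\<^sup>2 \<partial>lborel"
  have h: "h > 0" unfolding h_def using assms by simp
  interpret m: finite_measure m by fact
  obtain V where V: "open V" "S \<subseteq> V"
    "emeasure lborel {x. \<exists>s\<in>{0..1}. x + s *\<^sub>R v \<in> V} \<le> ennreal (8 * pi * h * (?H + 1))"
    using hausdorff1_segment_tube[OF S \<open>v \<noteq> 0\<close>] unfolding h_def by blast
  \<comment> \<open>The tolerance sqrt h balances the exponents: the L^1 error becomes 2 h sqrt h,
    and the weight sqrt (2/h) of \<open>?z\<close> turns it into 2 sqrt 2 h. The final constant 3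
    comes from 2 sqrt 2 <= 3.\<close>
  obtain K where K: "compact K" "K \<subseteq> V \<inter> D" "measure m (V \<inter> D - K) < sqrt h"
    using finite_measure_compact_inner[OF m(1,2), of "V \<inter> D" "sqrt h"] V D h by auto
  define W where "W = D - K"
  have W: "open W" unfolding W_def using D K by (auto intro: compact_imp_closed)
  have mW: "measure m W \<le> sqrt h"
  proof -
    have "AE x in m. x \<in> W \<longrightarrow> x \<in> V \<inter> D - K"
      using m(3,4) by eventually_elim (use V(2) in \<open>auto simp: W_def\<close>)
    then have "measure m W \<le> measure m (V \<inter> D - K)"
      using V(1) D(1) W m(2) borel_compact[OF K(1)] by (intro m.finite_measure_mono_AE) auto
    then show ?thesis using K(3) by simp
  qed
  let ?U = "{x. \<forall>s\<in>{0..1}. x + s *\<^sub>R v \<in> W}"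
  let ?T = "{x. \<exists>s\<in>{0..1}. x + s *\<^sub>R v \<in> V}"
  define P where "P x = (LBINT s. indicator {0..1} s * (v \<bullet> G (x + s *\<^sub>R v)))" for x
  define Z where "Z x = w (x + v) - w x - P x" for x
  have Pi: "integrable lborel P" unfolding P_def[abs_def] using G by (intro integrable_segment_average[of _ "\<lambda>_. 0"]) auto
  then have [measurable]: "P \<in> borel_measurable borel" by auto
  have Zi: "integrable lborel Z" unfolding Z_def[abs_def] using Pi w by (simp add: integrable_lborel_translate)
  have [measurable]: "Z \<in> borel_measurable borel" using Zi by auto
  have [measurable]: "?U \<in> sets borel" "?T \<in> sets borel"
    using open_segment_inside[OF W, of v] open_segment_tube[OF V(1), of v] by auto
  have ZU: "(LBINT x. indicator ?U x * \<bar>Z x\<bar>) \<le> 2 * (h * sqrt h)"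
  proof -
    have "(LBINT x. indicator ?U x * \<bar>Z x\<bar>) \<le> 2 * (norm v * measure m W)" unfolding Z_def P_def
      by (rule difference_minus_segment_average_bound[OF W w G m(1,2) \<sigma>])
        (rule ibp[OF test_function_mono], auto simp: W_def)
    also have "\<dots> \<le> 2 * (h * sqrt h)" unfolding h_def[symmetric] using mW h by simp
    finally show ?thesis .
  qed
  let ?z = "\<lambda>x. sqrt (2 / h) * (indicator ?U x * \<bar>Z x\<bar>)"
  have pt: "?i x
      \<le> indicator ?T x + (2 / h * (P x)\<^sup>2 + ?z x)" for x
  proof (cases "x \<in> D \<and> x + v \<in> D")
    case False
    then show ?thesis using h by (auto intro!: add_nonneg_nonneg)
  next
    case xD: True
    have seg: "x + s *\<^sub>R v \<in> D" if "s \<in> {0..1}" for s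
      using convexD[OF D(2), of x "x + v" "1 - s" s] xD that by (simp add: algebra_simps)
    show ?thesis
    proof (cases "x \<in> ?U")
      \<comment> \<open>By convexity the segment stays in \<open>D\<close>, so it leaves
        \<open>W\<close> only through \<open>K\<close>, which lies in \<open>V\<close>. The base
        point therefore belongs to the small set \<open>?T\<close>, where the truncated term is
        bounded by 1.\<close>
      case False
      then obtain s where "s \<in> {0..1}" "x + s *\<^sub>R v \<in> K" using seg unfolding W_def by auto
      then have "x \<in> ?T" using K by auto
      then show ?thesis using h xD by (auto intro!: add_increasing2)
    next
      case True
      have a: "(w (x + v) - w x)\<^sup>2 \<le> 2 * (P x)\<^sup>2 + 2 * (Z x)\<^sup>2"
      proof -
        have "w (x + v) - w x = P x + Z x" by (simp add: Z_def)
        then show ?thesis using zero_le_power2[of "P x - Z x"] by (simp add: power2_sum power2_diff)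
      qed
      \<comment> \<open>The place where the L^1 control of \<open>Z\<close> becomes sufficient:
        under the truncation its square is replaced by its first power.\<close>
      have b: "min 1 (2 * (Z x)\<^sup>2 / h) \<le> sqrt (2 / h) * \<bar>Z x\<bar>"
      proof -
        define t where "t = sqrt (2 / h) * \<bar>Z x\<bar>"
        have "t\<^sup>2 = 2 * (Z x)\<^sup>2 / h" "t \<ge> 0" unfolding t_def using h by (auto simp: power_mult_distrib)
        moreover have "min 1 (t\<^sup>2) \<le> t"
        proof (cases "t \<le> 1")
          case True
          then have "t\<^sup>2 \<le> t * 1" unfolding power2_eq_square using \<open>t \<ge> 0\<close> by (intro mult_left_mono)
          then show ?thesis by simp
        qed auto
        ultimately show ?thesis unfolding t_def by simp
      qed
      have "(w (x + v) - w x)\<^sup>2 / h \<le> 2 / h * (P x)\<^sup>2 + 2 * (Z x)\<^sup>2 / h"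
        using divide_right_mono[OF a, of h] h by (simp add: add_divide_distrib)
      then have "min 1 ((w (x + v) - w x)\<^sup>2 / h) \<le> 2 / h * (P x)\<^sup>2 + min 1 (2 * (Z x)\<^sup>2 / h)"
      proof -
        have "min 1 a \<le> p + min 1 z" if "a \<le> p + z" "0 \<le> p" for a p z :: real using that by (auto simp: min_def)
        from this[OF \<open>_ \<le> 2 / h * (P x)\<^sup>2 + 2 * (Z x)\<^sup>2 / h\<close>] show ?thesis using h by simp
      qed
      also have "\<dots> \<le> 2 / h * (P x)\<^sup>2 + sqrt (2 / h) * \<bar>Z x\<bar>" using b by simp
      finally have "min 1 ((w (x + v) - w x)\<^sup>2 / h) \<le> 2 / h * (P x)\<^sup>2 + sqrt (2 / h) * \<bar>Z x\<bar>" .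
      moreover have "indicator ?U x = (1 :: real)" "indicator {x \<in> D. x + v \<in> D} x = (1 :: real)" using True xD by auto
      moreover have "0 \<le> (indicator ?T x :: real)" by simp
      ultimately show ?thesis by (simp only: mult_1_left)
    qed
  qed
  have "(\<integral>\<^sup>+x. ennreal (?i x) \<partial>lborel)
      \<le> (\<integral>\<^sup>+x. indicator ?T x + (ennreal (2 / h) * ennreal ((P x)\<^sup>2) + ennreal (?z x)) \<partial>lborel)"
  proof (rule nn_integral_mono)
    fix x
    have "ennreal (?i x)
      \<le> ennreal (indicator ?T x + (2 / h * (P x)\<^sup>2 + ?z x))"
      by (rule ennreal_leI[OF pt])
    also have "\<dots> = indicator ?T x + (ennreal (2 / h) * ennreal ((P x)\<^sup>2) + ennreal (?z x))"
    proof -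
      have "ennreal (2 / h * (P x)\<^sup>2) = ennreal (2 / h) * ennreal ((P x)\<^sup>2)" using h by (intro ennreal_mult) auto
      then show ?thesis using h by (subst ennreal_plus, simp, simp, subst ennreal_plus, simp_all add: ennreal_indicator)
    qed
    finally show "ennreal (?i x) \<le> \<dots>" .
  qed
  also have "\<dots> = emeasure lborel ?T + (ennreal (2 / h) * (\<integral>\<^sup>+x. ennreal ((P x)\<^sup>2) \<partial>lborel)
      + (\<integral>\<^sup>+x. ennreal (?z x) \<partial>lborel))"
    by (subst nn_integral_add, simp, simp, subst nn_integral_add) (simp_all add: nn_integral_cmult)
  also have "\<dots> \<le> ennreal (8 * pi * h * (?H + 1)) +
      (ennreal (2 * h * ?G2) + ennreal (3 * h))"
  proof (intro add_mono V(3))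
    have "(\<integral>\<^sup>+x. ennreal ((P x)\<^sup>2) \<partial>lborel) \<le> (\<integral>\<^sup>+x. ennreal ((v \<bullet> G x)\<^sup>2) \<partial>lborel)"
      unfolding P_def by (rule nn_integral_segment_average_square_le) measurable
    also have "\<dots> \<le> (\<integral>\<^sup>+x. ennreal (h\<^sup>2 * (norm (G x))\<^sup>2) \<partial>lborel)"
    proof (intro nn_integral_mono ennreal_leI)
      fix x
      have "\<bar>v \<bullet> G x\<bar> \<le> h * norm (G x)" unfolding h_def by (rule Cauchy_Schwarz_ineq2)
      then show "(v \<bullet> G x)\<^sup>2 \<le> h\<^sup>2 * (norm (G x))\<^sup>2"
        using h by (metis abs_le_square_iff abs_mult abs_norm_cancel abs_of_pos power_mult_distrib)
    qed
    also have "\<dots> = ennreal (h\<^sup>2 * ?G2)" using G2 by (subst nn_integral_eq_integral) auto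
    finally have "ennreal (2 / h) * (\<integral>\<^sup>+x. ennreal ((P x)\<^sup>2) \<partial>lborel) \<le> ennreal (2 / h) * ennreal (h\<^sup>2 * ?G2)"
      by (rule mult_left_mono) simp
    also have "\<dots> = ennreal (2 * h * ?G2)" using h by (subst ennreal_mult[symmetric]) (auto simp: power2_eq_square integral_nonneg_AE)
    finally show "ennreal (2 / h) * (\<integral>\<^sup>+x. ennreal ((P x)\<^sup>2) \<partial>lborel) \<le> ennreal (2 * h * ?G2)" .
    have UZ: "integrable lborel (\<lambda>x. indicator ?U x * \<bar>Z x\<bar>)"
    proof (rule Bochner_Integration.integrable_bound[OF Zi])
      show "(\<lambda>x. indicator ?U x * \<bar>Z x\<bar>) \<in> borel_measurable lborel" by measurable
    qed (auto simp: indicator_def)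
    have "(\<integral>\<^sup>+x. ennreal (?z x) \<partial>lborel) = ennreal (sqrt (2 / h) * (LBINT x. indicator ?U x * \<bar>Z x\<bar>))"
      using UZ h by (subst nn_integral_eq_integral) auto
    also have "\<dots> \<le> ennreal (3 * h)"
    proof (rule ennreal_leI)
      have "sqrt (2 / h) * (LBINT x. indicator ?U x * \<bar>Z x\<bar>) \<le> sqrt (2 / h) * (2 * (h * sqrt h))"
        using ZU h by (intro mult_left_mono) auto
      also have "\<dots> = 2 * sqrt 2 * h" using h by (simp add: real_sqrt_divide)
      also have "\<dots> \<le> 3 * h"
        using h real_le_lsqrt[of "3/2" 2] real_sqrt_le_iff[of 2 "(3/2)\<^sup>2"] by (simp add: power2_eq_square real_sqrt_mult)
      finally show "sqrt (2 / h) * (LBINT x. indicator ?U x * \<bar>Z x\<bar>) \<le> 3 * h" .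
    qed
    finally show "(\<integral>\<^sup>+x. ennreal (?z x) \<partial>lborel) \<le> ennreal (3 * h)" .
  qed
  also have "\<dots> = ennreal (8 * pi * h * (?H + 1) + (2 * h * ?G2 + 3 * h))" using h by (simp add: integral_nonneg_AE flip: ennreal_plus)
  also have "8 * pi * h * (?H + 1) + (2 * h * ?G2 + 3 * h) =
      (8 * pi * (?H + 1) + 2 * ?G2 + 3) * h"
    by (simp add: algebra_simps)
  finally show ?thesis unfolding h_def .
qed

section \<open>The bond energy\<close>

text \<open>A dyadic majorant: on the annulus 2^-(m+1) < |\<xi>| <= 2^-m the function is at most 2 *
  2^m, while the disk of radius 2^-m has area pi 4^-m. The terms of the series thus integrate to the
  geometric sequence 2 pi 2^-n.\<close>

lemma integrable_inverse_norm_plane: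
  "integrable lborel (\<lambda>\<xi>::plane. indicator (cball 0 1) \<xi> / norm \<xi>)"
proof (rule integrableI_bounded)
  have [measurable]: "cball (0::plane) r \<in> sets borel" for r by (rule borel_closed) simp
  show "(\<lambda>\<xi>::plane. indicator (cball 0 1) \<xi> / norm \<xi>) \<in> borel_measurable lborel"
    by (intro borel_measurable_divide borel_measurable_indicator borel_measurable_norm) auto
  let ?g = "\<lambda>n \<xi>::plane. ennreal (2 * 2 ^ n) * indicator (cball 0 ((1/2) ^ n)) \<xi>"
  have "ennreal (norm (indicator (cball 0 1) \<xi> / norm \<xi>)) \<le> (\<Sum>n. ?g n \<xi>)" for \<xi> :: plane
  proof (cases "\<xi> \<noteq> 0 \<and> norm \<xi> \<le> 1")
    case True
    then have "\<exists>n. (1/2) ^ n < norm \<xi>" by (intro real_arch_pow_inv) auto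
    define N where "N = (LEAST n. (1/2) ^ n < norm \<xi>)"
    have N: "(1/2) ^ N < norm \<xi>" unfolding N_def by (rule LeastI_ex) fact
    have "N \<noteq> 0" using N True by (cases N) auto
    then obtain m where m: "N = Suc m" by (cases N) auto
    have "norm \<xi> \<le> (1/2) ^ m" using not_less_Least[of m "\<lambda>n. (1/2) ^ n < norm \<xi>"] m unfolding N_def by auto
    moreover have "1 / norm \<xi> \<le> 2 * 2 ^ m" using N True unfolding m by (simp add: field_simps)
    ultimately have "ennreal (norm (indicator (cball 0 1) \<xi> / norm \<xi>)) \<le> ?g m \<xi>" using True by (auto intro!: ennreal_leI)
    also have "\<dots> \<le> (\<Sum>n. ?g n \<xi>)"
    proof -
      have "(\<Sum>n\<in>{m}. ?g n \<xi>) \<le> (\<Sum>n. ?g n \<xi>)" by (rule sum_le_suminf) (auto intro: summableI)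
      then show ?thesis by (simp only: sum.insert sum.empty finite.emptyI empty_iff not_False_eq_True add_0_right)
    qed
    finally show ?thesis .
  qed auto
  then have "(\<integral>\<^sup>+\<xi>. ennreal (norm (indicator (cball 0 1) \<xi> / norm \<xi>)) \<partial>(lborel :: plane measure)) \<le> (\<integral>\<^sup>+\<xi>. (\<Sum>n. ?g n \<xi>) \<partial>lborel)"
    by (rule nn_integral_mono)
  also have "\<dots> = (\<Sum>n. \<integral>\<^sup>+\<xi>. ?g n \<xi> \<partial>lborel)" by (rule nn_integral_suminf) measurable
  also have "\<dots> = (\<Sum>n. ennreal (2 * pi * (1/2) ^ n))"
  proof (rule suminf_cong)
    fix n
    have "(\<integral>\<^sup>+\<xi>. ?g n \<xi> \<partial>lborel) = ennreal (2 * 2 ^ n) * emeasure lborel (cball (0::plane) ((1/2) ^ n))"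
      by (rule nn_integral_cmult_indicator) simp
    also have "emeasure lborel (cball (0::plane) ((1/2) ^ n)) = ennreal (pi * ((1/2) ^ n)\<^sup>2)"
      using emeasure_cball[of "(1/2) ^ n" "0::plane"] by (simp add: unit_ball_vol_2)
    also have "ennreal (2 * 2 ^ n) * ennreal (pi * ((1/2) ^ n)\<^sup>2) = ennreal (2 * 2 ^ n * (pi * ((1/2) ^ n)\<^sup>2))"
      by (rule ennreal_mult[symmetric]) auto
    also have "2 * 2 ^ n * (pi * ((1/2) ^ n)\<^sup>2) = 2 * pi * (1/2) ^ n" by (simp add: power2_eq_square field_simps)
    finally show "(\<integral>\<^sup>+\<xi>. ?g n \<xi> \<partial>lborel) = ennreal (2 * pi * (1/2) ^ n)" .
  qed
  also have "\<dots> = ennreal (2 * pi * 2)"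
  proof (rule suminf_ennreal_eq)
    show "(\<lambda>n. 2 * pi * (1/2) ^ n) sums (2 * pi * 2)" using sums_mult[OF geometric_sums[of "1/2::real"], of "2 * pi"] by simp
  qed auto
  finally show "(\<integral>\<^sup>+\<xi>. ennreal (norm (indicator (cball 0 1) \<xi> / norm \<xi>)) \<partial>(lborel :: plane measure)) < \<infinity>"
    by (rule order_le_less_trans) simp
qed

section \<open>The bond energy, its gradient and its one-sided expansion\<close>

abbreviation lborel\<^sub>2 :: "(plane \<times> plane) measure" where
  "lborel\<^sub>2 \<equiv> lborel \<Otimes>\<^sub>M lborel"

lemmas integral_plane_shear = integral_lborel_shear[where T = "\<lambda>\<xi>::plane. e *\<^sub>R \<xi>" for e]
lemmas integrable_plane_shear = integrable_lborel_shear[where T = "\<lambda>\<xi>::plane. e *\<^sub>R \<xi>" for e]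

text \<open>Everywhere defined Borel stand-ins for the data: \<open>f\<close> and \<open>df\<close>
  extend the potential and its derivative to negative arguments, \<open>k\<close> is a version of
  J(|\<xi>|) on the unit disk, and \<open>c0\<close> is f'(0). Concavity is recorded as the tangent
  inequality.\<close>

locale bond_energy =
  fixes f df :: "real \<Rightarrow> real" and k :: "plane \<Rightarrow> real" and c0 f_inf M \<epsilon> :: real and D :: "plane set"
  assumes f_measurable[measurable]: "f \<in> borel_measurable borel"
    and df_measurable[measurable]: "df \<in> borel_measurable borel"
    and f_0: "f 0 = 0"
    and f_bounds: "\<And>s. 0 \<le> s \<Longrightarrow> 0 \<le> f s \<and> f s \<le> f_inf"
    and f_tangent: "\<And>s t. 0 \<le> s \<Longrightarrow> 0 \<le> t \<Longrightarrow> f t - f s \<le> df s * (t - s)"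
    and df_bounds: "\<And>s. 0 \<le> s \<Longrightarrow> 0 \<le> df s \<and> df s \<le> c0"
    and k_measurable[measurable]: "k \<in> borel_measurable borel"
    and k_bounds: "\<And>\<xi>. 0 \<le> k \<xi> \<and> k \<xi> \<le> M"
    and k_support: "\<And>\<xi>. norm \<xi> > 1 \<Longrightarrow> k \<xi> = 0"
    and \<epsilon>_pos: "0 < \<epsilon>"
    and D_borel[measurable]: "D \<in> sets borel"
    and D_finite: "emeasure lborel D < \<infinity>"
begin

text \<open>This is \<open>pd_W\<close> without the factor J/\<epsilon>^3. At \<xi> = 0 division by
  zero makes the argument 0, and the bond vanishes together with \<open>f 0\<close>.\<close>

definition bond :: "real \<Rightarrow> plane \<Rightarrow> real" where
  "bond \<eta> \<xi> = f (\<eta>\<^sup>2 / (\<epsilon> * norm \<xi>))"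

definition dbond :: "real \<Rightarrow> plane \<Rightarrow> real" where
  "dbond \<eta> \<xi> = df (\<eta>\<^sup>2 / (\<epsilon> * norm \<xi>)) * (2 * \<eta> / (\<epsilon> * norm \<xi>))"

definition displacement :: "(plane \<Rightarrow> real) \<Rightarrow> bool" where
  "displacement w \<longleftrightarrow> w \<in> borel_measurable borel \<and> (\<forall>x. x \<notin> D \<longrightarrow> w x = 0)"

text \<open>The energy is taken over the whole plane: \<open>PD\<close> counts a bond that leaves \<open>D\<close> once, but \<open>grad_PD\<close> is the
  gradient of the functional counting it from both ends, which dominates \<open>PD\<close>.\<close>

definition energy :: "(plane \<Rightarrow> real) \<Rightarrow> real" where
  "energy w = (\<integral>p. k (snd p) * bond (w (fst p + \<epsilon> *\<^sub>R snd p) - w (fst p)) (snd p) \<partial>lborel\<^sub>2) / \<epsilon>"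

text \<open>The prefactor 1/\<epsilon> collects the \<epsilon>^3 of \<open>grad_PD\<close>, the
  \<epsilon>^-3 of \<open>pd_W\<close>, and the step \<epsilon> |\<xi>| of the difference quotient,
  whose |\<xi>| cancels the weight.\<close>

definition grad :: "(plane \<Rightarrow> real) \<Rightarrow> plane \<Rightarrow> real" where
  "grad w x = (LBINT \<xi>. k \<xi> * (dbond (w x - w (x - \<epsilon> *\<^sub>R \<xi>)) \<xi> - dbond (w (x + \<epsilon> *\<^sub>R \<xi>) - w x) \<xi>)) / \<epsilon>"

text \<open>An integrable kernel that dominates \<open>k\<close> times |\<open>dbond\<close>|
  uniformly in \<eta> as well as the coefficient of the quadratic remainder of the energy.\<close>

definition \<kappa> :: "plane \<Rightarrow> real" where
  "\<kappa> \<xi> = k \<xi> * (c0 / (\<epsilon> * norm \<xi>) + f_inf)"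

lemma norm_measurable_plane[measurable]: "(norm :: plane \<Rightarrow> real) \<in> borel_measurable borel"
  by (rule borel_measurable_continuous_onI) (intro continuous_intros)

lemma bond_measurable[measurable]: "case_prod bond \<in> borel_measurable (borel \<Otimes>\<^sub>M borel)"
  unfolding bond_def split_def by measurable

lemma dbond_measurable[measurable]: "case_prod dbond \<in> borel_measurable (borel \<Otimes>\<^sub>M borel)"
  unfolding dbond_def split_def by measurable

lemma f_inf_nonneg: "0 \<le> f_inf" and c0_nonneg: "0 \<le> c0"
  using f_bounds[of 0] df_bounds[of 0] by auto

lemma k_abs: "\<bar>k \<xi>\<bar> = k \<xi>"
  using k_bounds[of \<xi>] by simp

lemma k_integrable: "integrable lborel k"
proof (rule Bochner_Integration.integrable_bound)
  show "integrable lborel (\<lambda>\<xi>::plane. M * indicator (cball 0 1) \<xi> :: real)"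
    by (intro integrable_mult_right integrable_real_indicator) (use emeasure_bounded_finite[OF bounded_cball[of "0::plane" 1]] in auto)
  show "AE \<xi> in lborel. norm (k \<xi>) \<le> norm (M * indicator (cball 0 1) \<xi> :: real)"
  proof (rule AE_I2)
    fix \<xi> :: plane
    show "norm (k \<xi>) \<le> norm (M * indicator (cball 0 1) \<xi> :: real)"
      using k_bounds[of \<xi>] k_support[of \<xi>] by (cases "norm \<xi> \<le> 1") auto
  qed
qed measurable

lemma \<kappa>_nonneg: "0 \<le> \<kappa> \<xi>"
  unfolding \<kappa>_def using k_bounds[of \<xi>] c0_nonneg f_inf_nonneg \<epsilon>_pos by simp

lemma \<kappa>_integrable: "integrable lborel \<kappa>"
proof -
  have "integrable lborel (\<lambda>\<xi>. c0 / \<epsilon> * M * (indicator (cball 0 1) \<xi> / norm \<xi>) + f_inf * k \<xi>)"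
    by (intro Bochner_Integration.integrable_add integrable_mult_right k_integrable integrable_inverse_norm_plane)
  then show ?thesis
  proof (rule Bochner_Integration.integrable_bound)
    show "\<kappa> \<in> borel_measurable lborel" unfolding \<kappa>_def[abs_def] by measurable
    show "AE \<xi> in lborel. norm (\<kappa> \<xi>) \<le> norm (c0 / \<epsilon> * M * (indicator (cball 0 1) \<xi> / norm \<xi>) + f_inf * k \<xi>)"
    proof (rule AE_I2)
      fix \<xi> :: plane
      have "k \<xi> * (c0 / (\<epsilon> * norm \<xi>)) \<le> c0 / \<epsilon> * M * (indicator (cball 0 1) \<xi> / norm \<xi>)"
      proof (cases "norm \<xi> \<le> 1")
        case True
        have "k \<xi> * (c0 / (\<epsilon> * norm \<xi>)) \<le> M * (c0 / (\<epsilon> * norm \<xi>))"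
          using k_bounds[of \<xi>] c0_nonneg \<epsilon>_pos by (intro mult_right_mono) auto
        then show ?thesis using True by (simp add: mult_ac)
      qed (use k_support in simp)
      then have "\<kappa> \<xi> \<le> c0 / \<epsilon> * M * (indicator (cball 0 1) \<xi> / norm \<xi>) + f_inf * k \<xi>"
        unfolding \<kappa>_def by (simp add: algebra_simps)
      then show "norm (\<kappa> \<xi>) \<le> norm (c0 / \<epsilon> * M * (indicator (cball 0 1) \<xi> / norm \<xi>) + f_inf * k \<xi>)"
        using \<kappa>_nonneg[of \<xi>] by simp
    qed
  qed
qed

lemma bond_arg_nonneg: "0 \<le> \<eta>\<^sup>2 / (\<epsilon> * norm \<xi>)"
  using \<epsilon>_pos by simp

text \<open>Concavity and f(0) = 0 give s f'(s) <= f(s) <= f_inf, so the derivative of a bond does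
  not grow with \<eta>. In 2 |\<eta>| <= 1 + \<eta>^2 the square is paid for by this bound and the
  constant by f'(s) <= c0.\<close>

lemma abs_dbond_le: "\<bar>dbond \<eta> \<xi>\<bar> \<le> c0 / (\<epsilon> * norm \<xi>) + f_inf"
proof -
  define r where "r = \<epsilon> * norm \<xi>"
  define s where "s = \<eta>\<^sup>2 / r"
  have r: "0 \<le> r" and s: "0 \<le> s" unfolding s_def r_def using \<epsilon>_pos by auto
  have "df s * s \<le> f s" using f_tangent[of s 0] s f_0 by simp
  also have "\<dots> \<le> f_inf" using f_bounds[OF s] by simp
  finally have 1: "df s * s \<le> f_inf" .
  have 2: "df s / r \<le> c0 / r" using df_bounds[OF s] r by (simp add: divide_right_mono)
  have "2 * \<bar>\<eta>\<bar> \<le> 1 + \<eta>\<^sup>2" using zero_le_power2[of "\<bar>\<eta>\<bar> - 1"] by (simp add: power2_diff)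
  then have "df s / r * (2 * \<bar>\<eta>\<bar>) \<le> df s / r * (1 + \<eta>\<^sup>2)"
    using df_bounds[OF s] r by (intro mult_left_mono) auto
  also have "\<dots> = df s / r + df s * s" unfolding s_def by (simp add: distrib_left)
  also have "\<dots> \<le> c0 / r + f_inf" using 1 2 by simp
  finally have "df s / r * (2 * \<bar>\<eta>\<bar>) \<le> c0 / r + f_inf" .
  moreover have "\<bar>dbond \<eta> \<xi>\<bar> = df s / r * (2 * \<bar>\<eta>\<bar>)"
    unfolding dbond_def r_def[symmetric] s_def[symmetric] using df_bounds[OF s] r by (simp add: abs_mult)
  ultimately show ?thesis by (simp add: r_def)
qed

lemma k_dbond_le: "k \<xi> * \<bar>dbond \<eta> \<xi>\<bar> \<le> \<kappa> \<xi>"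
  unfolding \<kappa>_def using k_bounds[of \<xi>] abs_dbond_le by (intro mult_left_mono) auto

text \<open>The tangent inequality in the variable \<eta>^2/(\<epsilon> |\<xi>|), combined with q^2
  - p^2 = 2 p (q - p) + (q - p)^2: the first term yields the derivative of the bond, the second is
  the whole remainder.\<close>

lemma bond_diff_le: "bond q \<xi> - bond p \<xi> \<le> dbond p \<xi> * (q - p) + c0 / (\<epsilon> * norm \<xi>) * (q - p)\<^sup>2"
proof -
  define r where "r = \<epsilon> * norm \<xi>"
  have r: "0 \<le> r" unfolding r_def using \<epsilon>_pos by auto
  have s: "0 \<le> p\<^sup>2 / r" "0 \<le> q\<^sup>2 / r" using r by auto
  have "bond q \<xi> - bond p \<xi> \<le> df (p\<^sup>2 / r) * (q\<^sup>2 / r - p\<^sup>2 / r)"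
    unfolding bond_def r_def[symmetric] by (rule f_tangent[OF s])
  also have "q\<^sup>2 / r - p\<^sup>2 / r = 2 * p / r * (q - p) + (q - p)\<^sup>2 / r"
    by (simp add: power2_eq_square algebra_simps flip: add_divide_distrib diff_divide_distrib)
  also have "df (p\<^sup>2 / r) * (2 * p / r * (q - p) + (q - p)\<^sup>2 / r) =
      dbond p \<xi> * (q - p) + df (p\<^sup>2 / r) * ((q - p)\<^sup>2 / r)"
    unfolding dbond_def r_def[symmetric] by (simp add: algebra_simps)
  also have "\<dots> \<le> dbond p \<xi> * (q - p) + c0 * ((q - p)\<^sup>2 / r)"
    using df_bounds[OF s(1)] r by (intro add_left_mono mult_right_mono) auto
  finally show ?thesis unfolding r_def by simp
qed

text \<open>A bond with both ends off \<open>D\<close> is unstretched and contributes 0. All others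
  have an end in \<open>D\<close>, a set of finite measure, and contribute at most f_inf k.\<close>

lemma energy_integrable:
  assumes "displacement w"
  shows "integrable lborel\<^sub>2 (\<lambda>p. k (snd p) * bond (w (fst p + \<epsilon> *\<^sub>R snd p) - w (fst p)) (snd p))"
proof -
  have [measurable]: "w \<in> borel_measurable borel" using assms unfolding displacement_def by simp
  let ?e = "\<lambda>p. k (snd p) * bond (w (fst p + \<epsilon> *\<^sub>R snd p) - w (fst p)) (snd p)"
  let ?d = "\<lambda>p. f_inf * k (snd p) * indicator D (fst p) + f_inf * k (snd p) * indicator D (fst p + \<epsilon> *\<^sub>R snd p) :: real"
  have D: "integrable lborel (indicator D :: plane \<Rightarrow> real)" using D_finite by (intro integrable_real_indicator) auto
  have "integrable lborel\<^sub>2 (\<lambda>p. f_inf * k (snd p) * indicator D (fst p) :: real)"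
    by (rule integrable_pair_mult[OF D]) (simp add: k_integrable)
  moreover from this have "integrable lborel\<^sub>2 (\<lambda>p. f_inf * k (snd p) * indicator D (fst p + \<epsilon> *\<^sub>R snd p) :: real)"
    by (subst integrable_plane_shear[of \<epsilon> "\<lambda>x \<xi>. f_inf * k \<xi> * indicator D x"]) auto
  ultimately have "integrable lborel\<^sub>2 ?d" by (rule Bochner_Integration.integrable_add)
  then show ?thesis
  proof (rule Bochner_Integration.integrable_bound)
    show "AE p in lborel\<^sub>2. norm (?e p)
        \<le> norm (?d p)"
    proof (rule AE_I2)
      fix p :: "plane \<times> plane"
      obtain x \<xi> where p: "p = (x, \<xi>)" by (cases p)
      have b: "0 \<le> bond \<eta> \<xi> \<and> bond \<eta> \<xi> \<le> f_inf" for \<eta>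
        unfolding bond_def using f_bounds[OF bond_arg_nonneg] by blast
      have k: "0 \<le> k \<xi>" using k_bounds by blast
      have "k \<xi> * bond (w (x + \<epsilon> *\<^sub>R \<xi>) - w x) \<xi> \<le> f_inf * k \<xi> * indicator D x + f_inf * k \<xi> * indicator D (x + \<epsilon> *\<^sub>R \<xi>)"
      proof (cases "x \<in> D \<or> x + \<epsilon> *\<^sub>R \<xi> \<in> D")
        case True
        have "k \<xi> * bond (w (x + \<epsilon> *\<^sub>R \<xi>) - w x) \<xi> \<le> k \<xi> * f_inf" using b k by (intro mult_left_mono) auto
        moreover have "0 \<le> k \<xi> * f_inf" using k f_inf_nonneg by simp
        ultimately show ?thesis using True by (auto simp: indicator_def mult.commute)
      next
        case False
        then have "w x = 0" "w (x + \<epsilon> *\<^sub>R \<xi>) = 0" using assms unfolding displacement_def by auto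
        then show ?thesis using False by (simp add: bond_def f_0)
      qed
      then show "norm (?e p)
        \<le> norm (?d p)"
        using b k unfolding p by simp
    qed
  qed measurable
qed

lemma energy_nonneg: "0 \<le> energy w"
  unfolding energy_def bond_def
  using \<epsilon>_pos k_bounds f_bounds[OF bond_arg_nonneg] by (intro divide_nonneg_pos integral_nonneg_AE AE_I2 mult_nonneg_nonneg) auto

lemma grad_bound: "\<bar>grad w x\<bar> \<le> 2 * (LBINT \<xi>. \<kappa> \<xi>) / \<epsilon>"
proof -
  have "\<bar>\<integral>\<xi>. k \<xi> * (dbond (w x - w (x - \<epsilon> *\<^sub>R \<xi>)) \<xi> - dbond (w (x + \<epsilon> *\<^sub>R \<xi>) - w x) \<xi>) \<partial>lborel\<bar> \<le> (LBINT \<xi>. 2 * \<kappa> \<xi>)"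
    (is "\<bar>integral\<^sup>L lborel ?g\<bar> \<le> _")
  proof (cases "integrable lborel ?g")
    case True
    have "norm (integral\<^sup>L lborel ?g) \<le> (LBINT \<xi>. 2 * \<kappa> \<xi>)"
    proof (rule Bochner_Integration.integral_norm_bound_integral[OF True])
      show "integrable lborel (\<lambda>\<xi>. 2 * \<kappa> \<xi>)" using \<kappa>_integrable by simp
      fix \<xi> :: plane
      have "norm (?g \<xi>) \<le> k \<xi> * (\<bar>dbond (w x - w (x - \<epsilon> *\<^sub>R \<xi>)) \<xi>\<bar> + \<bar>dbond (w (x + \<epsilon> *\<^sub>R \<xi>) - w x) \<xi>\<bar>)"
        using k_bounds[of \<xi>] by (auto simp: abs_mult intro!: mult_left_mono abs_triangle_ineq4)
      also have "\<dots> \<le> 2 * \<kappa> \<xi>"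
        using k_dbond_le[of \<xi> "w x - w (x - \<epsilon> *\<^sub>R \<xi>)"] k_dbond_le[of \<xi> "w (x + \<epsilon> *\<^sub>R \<xi>) - w x"]
        by (simp add: distrib_left)
      finally show "norm (?g \<xi>) \<le> 2 * \<kappa> \<xi>" .
    qed
    then show ?thesis by simp
  next
    case False
    then show ?thesis using \<kappa>_nonneg by (simp add: not_integrable_integral_eq integral_nonneg_AE)
  qed
  then show ?thesis unfolding grad_def using \<epsilon>_pos by (simp add: divide_right_mono)
qed

lemma grad_measurable:
  assumes [measurable]: "w \<in> borel_measurable borel"
  shows "grad w \<in> borel_measurable borel"
  unfolding grad_def[abs_def] by measurable

text \<open>The bonds are concave functions of \<open>\<eta>\<^sup>2\<close>, so the energy lies below its first order expansion up to a
  quadratic term; no second derivative of \<open>f\<close> enters. Each bond contributes to the gradient at both of its ends.\<close>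

lemma energy_diff_le:
  assumes w: "displacement w" and z: "displacement z"
    and h2: "integrable lborel (\<lambda>x. (z x - w x)\<^sup>2)"
  shows "energy z - energy w \<le> (LBINT x. grad w x * (z x - w x)) + 4 * (LBINT \<xi>. \<kappa> \<xi>) / \<epsilon> * (LBINT x. (z x - w x)\<^sup>2)"
proof -
  have [measurable]: "w \<in> borel_measurable borel" "z \<in> borel_measurable borel" using w z unfolding displacement_def by auto
  define h where "h x = z x - w x" for x
  have [measurable]: "h \<in> borel_measurable borel" unfolding h_def[abs_def] by measurable
  have h2': "integrable lborel (\<lambda>x. (h x)\<^sup>2)" using h2 unfolding h_def .
  \<comment> \<open>The increment vanishes off \<open>D\<close>, which has finite measure, so |h| <=
    1 + h^2 turns square integrability into integrability and makes the pairing with \<kappa>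
    finite.\<close>
  have h: "integrable lborel h"
  proof (rule Bochner_Integration.integrable_bound)
    show "integrable lborel (\<lambda>x. indicator D x + (h x)\<^sup>2)"
      using h2' D_finite by (intro Bochner_Integration.integrable_add integrable_real_indicator) auto
    show "AE x in lborel. norm (h x) \<le> norm (indicator D x + (h x)\<^sup>2)"
    proof (rule AE_I2)
      fix x
      have "\<bar>h x\<bar> \<le> 1 + (h x)\<^sup>2" using zero_le_power2[of "\<bar>h x\<bar> - 1"] by (simp add: power2_diff)
      then show "norm (h x) \<le> norm (indicator D x + (h x)\<^sup>2)"
        using w z unfolding displacement_def by (cases "x \<in> D") (auto simp: h_def)
    qed
  qed measurable
  let ?\<delta> = "\<lambda>u p. u (fst p + \<epsilon> *\<^sub>R snd p) - u (fst p) :: real"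
  let ?d = "\<lambda>p. k (snd p) * dbond (?\<delta> w p) (snd p)"
  have dle: "\<bar>?d p\<bar> \<le> \<kappa> (snd p)" for p :: "plane \<times> plane"
    using k_dbond_le[of "snd p" "?\<delta> w p"] by (simp add: abs_mult k_abs)
  have i0: "integrable lborel\<^sub>2 (\<lambda>p. \<kappa> (snd p) * h (fst p))" by (rule integrable_pair_mult[OF h \<kappa>_integrable])
  have i0': "integrable lborel\<^sub>2 (\<lambda>p. \<kappa> (snd p) * h (fst p + \<epsilon> *\<^sub>R snd p))"
    using i0 \<kappa>_integrable by (subst integrable_plane_shear[of \<epsilon> "\<lambda>x \<xi>. \<kappa> \<xi> * h x"]) auto
  have i1: "integrable lborel\<^sub>2 (\<lambda>p. ?d p * h (fst p))" by (rule Bochner_Integration.integrable_bound[OF i0])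
      (use dle \<kappa>_nonneg in \<open>auto simp: abs_mult k_abs intro!: mult_right_mono\<close>)
  have i2: "integrable lborel\<^sub>2 (\<lambda>p. ?d p * h (fst p + \<epsilon> *\<^sub>R snd p))"
    by (rule Bochner_Integration.integrable_bound[OF i0'])
      (use dle \<kappa>_nonneg in \<open>auto simp: abs_mult k_abs intro!: mult_right_mono\<close>)
  \<comment> \<open>The contribution of the far end of a bond, rewritten by the shear along
    \<epsilon> \<xi> with that end as base point.\<close>
  let ?e = "\<lambda>p. k (snd p) * dbond (w (fst p) - w (fst p - \<epsilon> *\<^sub>R snd p)) (snd p) * h (fst p)"
  have i3: "integrable lborel\<^sub>2 ?e"
    using i2 by (subst integrable_plane_shear[of \<epsilon> "\<lambda>x \<xi>. k \<xi> * dbond (w x - w (x - \<epsilon> *\<^sub>R \<xi>)) \<xi> * h x", symmetric]) auto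
  have e3: "(\<integral>p. ?d p * h (fst p + \<epsilon> *\<^sub>R snd p) \<partial>lborel\<^sub>2) = (\<integral>p. ?e p \<partial>lborel\<^sub>2)"
    by (subst integral_plane_shear[of \<epsilon> "\<lambda>x \<xi>. k \<xi> * dbond (w x - w (x - \<epsilon> *\<^sub>R \<xi>)) \<xi> * h x", symmetric]) auto
  have i4: "integrable lborel\<^sub>2 (\<lambda>p. ?e p - ?d p * h (fst p))" using i3 i1 by (rule Bochner_Integration.integrable_diff)
  have lin: "(\<integral>p. ?d p * ?\<delta> h p \<partial>lborel\<^sub>2) = \<epsilon> * (LBINT x. grad w x * h x)"
  proof -
    have "(\<integral>p. ?d p * ?\<delta> h p \<partial>lborel\<^sub>2) = (\<integral>p. ?d p * h (fst p + \<epsilon> *\<^sub>R snd p) - ?d p * h (fst p) \<partial>lborel\<^sub>2)"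
      by (simp add: right_diff_distrib)
    also have "\<dots> = (\<integral>p. ?e p - ?d p * h (fst p) \<partial>lborel\<^sub>2)" using i1 i2 i3 e3 by simp
    also have "\<dots> = (LBINT x. (LBINT \<xi>. k \<xi> * (dbond (w x - w (x - \<epsilon> *\<^sub>R \<xi>)) \<xi> - dbond (w (x + \<epsilon> *\<^sub>R \<xi>) - w x) \<xi>) * h x))"
      using lborel_pair.integral_fst'[OF i4] by (simp add: algebra_simps)
    also have "\<dots> = (LBINT x. \<epsilon> * (grad w x * h x))" unfolding grad_def using \<epsilon>_pos by simp
    finally show ?thesis by simp
  qed
  have i5: "integrable lborel\<^sub>2 (\<lambda>p. \<kappa> (snd p) * (h (fst p))\<^sup>2)" by (rule integrable_pair_mult[OF h2' \<kappa>_integrable])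
  have i5': "integrable lborel\<^sub>2 (\<lambda>p. \<kappa> (snd p) * (h (fst p + \<epsilon> *\<^sub>R snd p))\<^sup>2)"
    using i5 \<kappa>_integrable by (subst integrable_plane_shear[of \<epsilon> "\<lambda>x \<xi>. \<kappa> \<xi> * (h x)\<^sup>2"]) auto
  have e5: "(\<integral>p. \<kappa> (snd p) * (h (fst p))\<^sup>2 \<partial>lborel\<^sub>2) = (LBINT \<xi>. \<kappa> \<xi>) * (LBINT x. (h x)\<^sup>2)"
    by (rule integral_pair_mult[OF h2' \<kappa>_integrable])
  have e5': "(\<integral>p. \<kappa> (snd p) * (h (fst p + \<epsilon> *\<^sub>R snd p))\<^sup>2 \<partial>lborel\<^sub>2) = (LBINT \<xi>. \<kappa> \<xi>) * (LBINT x. (h x)\<^sup>2)"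
    using \<kappa>_integrable e5 by (subst integral_plane_shear[of \<epsilon> "\<lambda>x \<xi>. \<kappa> \<xi> * (h x)\<^sup>2"]) auto
  have i6: "integrable lborel\<^sub>2 (\<lambda>p. ?d p * ?\<delta> h p)"
    using Bochner_Integration.integrable_diff[OF i2 i1] by (simp add: right_diff_distrib)
  have "\<epsilon> * (energy z - energy w) = (\<integral>p. k (snd p) * bond (?\<delta> z p) (snd p) - k (snd p) * bond (?\<delta> w p) (snd p) \<partial>lborel\<^sub>2)"
    unfolding energy_def using energy_integrable[OF z] energy_integrable[OF w] \<epsilon>_pos by (simp add: field_simps)
  also have "\<dots> \<le> (\<integral>p. ?d p * ?\<delta> h p + (2 * (\<kappa> (snd p) * (h (fst p + \<epsilon> *\<^sub>R snd p))\<^sup>2) + 2 * (\<kappa> (snd p) * (h (fst p))\<^sup>2)) \<partial>lborel\<^sub>2)"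
  proof (rule integral_mono)
    show "integrable lborel\<^sub>2 (\<lambda>p. k (snd p) * bond (?\<delta> z p) (snd p) - k (snd p) * bond (?\<delta> w p) (snd p))"
      using energy_integrable[OF z] energy_integrable[OF w] by simp
    show "integrable lborel\<^sub>2 (\<lambda>p. ?d p * ?\<delta> h p + (2 * (\<kappa> (snd p) * (h (fst p + \<epsilon> *\<^sub>R snd p))\<^sup>2) + 2 * (\<kappa> (snd p) * (h (fst p))\<^sup>2)))"
      by (intro Bochner_Integration.integrable_add i6 integrable_mult_right i5 i5')
    fix p :: "plane \<times> plane"
    obtain x \<xi> where p: "p = (x, \<xi>)" by (cases p)
    have \<delta>: "?\<delta> z p - ?\<delta> w p = ?\<delta> h p" by (simp add: h_def)
    have kb: "0 \<le> k \<xi>" using k_bounds by blast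
    \<comment> \<open>Each end of the bond contributes 2 to the factor 4 of the quadratic
      term.\<close>
    have sq: "(?\<delta> h p)\<^sup>2 \<le> 2 * (h (fst p + \<epsilon> *\<^sub>R snd p))\<^sup>2 + 2 * (h (fst p))\<^sup>2"
      using zero_le_power2[of "h (fst p + \<epsilon> *\<^sub>R snd p) + h (fst p)"] by (simp add: power2_sum power2_diff)
    have "k \<xi> * (bond (?\<delta> z p) \<xi> - bond (?\<delta> w p) \<xi>) \<le> k \<xi> * (dbond (?\<delta> w p) \<xi> * ?\<delta> h p + c0 / (\<epsilon> * norm \<xi>) * (?\<delta> h p)\<^sup>2)"
      using bond_diff_le[of "?\<delta> z p" \<xi> "?\<delta> w p"] kb unfolding \<delta> by (rule mult_left_mono)
    also have "\<dots> = k \<xi> * dbond (?\<delta> w p) \<xi> * ?\<delta> h p + k \<xi> * (c0 / (\<epsilon> * norm \<xi>)) * (?\<delta> h p)\<^sup>2"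
      by (simp add: algebra_simps)
    also have "k \<xi> * (c0 / (\<epsilon> * norm \<xi>)) * (?\<delta> h p)\<^sup>2 \<le> \<kappa> \<xi> * (?\<delta> h p)\<^sup>2"
      unfolding \<kappa>_def using kb f_inf_nonneg by (intro mult_right_mono mult_left_mono) auto
    also have "\<dots> \<le> \<kappa> \<xi> * (2 * (h (fst p + \<epsilon> *\<^sub>R snd p))\<^sup>2 + 2 * (h (fst p))\<^sup>2)"
      by (rule mult_left_mono[OF sq \<kappa>_nonneg])
    finally show "k (snd p) * bond (?\<delta> z p) (snd p) - k (snd p) * bond (?\<delta> w p) (snd p) \<le>
        ?d p * ?\<delta> h p + (2 * (\<kappa> (snd p) * (h (fst p + \<epsilon> *\<^sub>R snd p))\<^sup>2) + 2 * (\<kappa> (snd p) * (h (fst p))\<^sup>2))"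
      unfolding p by (simp add: algebra_simps)
  qed
  also have "\<dots> = (\<integral>p. ?d p * ?\<delta> h p \<partial>lborel\<^sub>2) + (2 * (\<integral>p. \<kappa> (snd p) * (h (fst p + \<epsilon> *\<^sub>R snd p))\<^sup>2 \<partial>lborel\<^sub>2) + 2 * (\<integral>p. \<kappa> (snd p) * (h (fst p))\<^sup>2 \<partial>lborel\<^sub>2))"
    by (subst Bochner_Integration.integral_add[OF i6 Bochner_Integration.integrable_add[OF integrable_mult_right[OF i5'] integrable_mult_right[OF i5]]])
      (subst Bochner_Integration.integral_add[OF integrable_mult_right[OF i5'] integrable_mult_right[OF i5]], simp)
  also have "\<dots> = \<epsilon> * ((LBINT x. grad w x * h x) + 4 * (LBINT \<xi>. \<kappa> \<xi>) / \<epsilon> * (LBINT x. (h x)\<^sup>2))"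
    unfolding lin e5 e5' using \<epsilon>_pos by (simp add: field_simps)
  finally show ?thesis unfolding h_def using \<epsilon>_pos by simp
qed

end

section \<open>From difference bounds to an energy bound uniform in the horizon\<close>

context bond_energy
begin

text \<open>Bonds inside \<open>D\<close> are estimated by \<open>inner\<close>. A bond with exactly
  one end in \<open>D\<close> has that end in the boundary layer for v or for -v, whence 2 CB; the
  remaining bonds vanish. Everything is O(|v|) with |v| = \<epsilon> |\<xi>|, and this \<epsilon>
  cancels the prefactor of \<open>energy\<close>.\<close>

lemma energy_le_of_difference_bound:
  assumes w: "displacement w" and "open D" and CI: "0 \<le> CI" and CB: "0 \<le> CB"
    and inner: "\<And>v. v \<noteq> 0 \<Longrightarrow> (\<integral>\<^sup>+x. ennreal (indicator {x \<in> D. x + v \<in> D} x * min 1 ((w (x + v) - w x)\<^sup>2 / norm v)) \<partial>lborel) \<le> ennreal (CI * norm v)"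
    and layer: "\<And>v. measure lborel {x \<in> D. x + v \<notin> D} \<le> CB * norm v"
  shows "energy w \<le> (c0 + f_inf) * (CI + 2 * CB) * (LBINT \<xi>. k \<xi>)"
proof -
  have [measurable]: "w \<in> borel_measurable borel" using w unfolding displacement_def by simp
  let ?A = "\<lambda>v. {x \<in> D. x + v \<notin> D}" and ?B = "\<lambda>v. {x. x \<notin> D \<and> x + v \<in> D}"
  let ?m = "\<lambda>v x. min 1 ((w (x + v) - w x)\<^sup>2 / norm v)" and ?I = "\<lambda>v. indicator {x \<in> D. x + v \<in> D} :: plane \<Rightarrow> real"
  have AB[measurable]: "?A v \<in> sets borel" "?B v \<in> sets borel" "{x \<in> D. x + v \<in> D} \<in> sets borel" for v
  proof -
    have [measurable]: "(\<lambda>x. x + v) -` D \<in> sets borel" using measurable_sets[of "\<lambda>x. x + v" borel borel D] by simp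
    have "?A v = D - (\<lambda>x. x + v) -` D" "?B v = (\<lambda>x. x + v) -` D - D" "{x \<in> D. x + v \<in> D} = D \<inter> (\<lambda>x. x + v) -` D" by auto
    then show "?A v \<in> sets borel" "?B v \<in> sets borel" "{x \<in> D. x + v \<in> D} \<in> sets borel" by simp_all
  qed
  have A: "emeasure lborel (?A v) \<le> ennreal (CB * norm v)" for v
  proof -
    have "emeasure lborel (?A v) \<le> emeasure lborel D" by (intro emeasure_mono) auto
    then have "emeasure lborel (?A v) = ennreal (measure lborel (?A v))"
      using D_finite by (intro emeasure_eq_ennreal_measure) (auto simp: top_unique)
    then show ?thesis using layer[of v] by (simp add: ennreal_leI)
  qed
  have B: "emeasure lborel (?B v) \<le> ennreal (CB * norm v)" for v
  proof -
    have "emeasure lborel (?B v) = (\<integral>\<^sup>+x. indicator (?B v) x \<partial>lborel)"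
      using AB(2)[of v] by (intro nn_integral_indicator[symmetric]) simp
    also have "\<dots> = (\<integral>\<^sup>+x. indicator (?A (- v)) (x + v) \<partial>lborel)"
      by (intro nn_integral_cong) (auto simp: indicator_def)
    also have "\<dots> = emeasure lborel (?A (- v))" using AB(1)[of "- v"] by (subst nn_integral_lborel_translate) auto
    finally show ?thesis using A[of "- v"] by simp
  qed
  have trunc: "(\<integral>\<^sup>+x. ennreal (?m v x) \<partial>lborel) \<le> ennreal ((CI + 2 * CB) * norm v)"
    if "v \<noteq> 0" for v
  proof -
    have "(\<integral>\<^sup>+x. ennreal (?m v x) \<partial>lborel) \<le>
        (\<integral>\<^sup>+x. ennreal (?I v x * ?m v x) + (indicator (?A v) x + indicator (?B v) x) \<partial>lborel)"
    proof (rule nn_integral_mono)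
      fix x
      show "ennreal (?m v x) \<le>
        ennreal (?I v x * ?m v x) + (indicator (?A v) x + indicator (?B v) x)"
      proof -
        consider "x \<in> D" "x + v \<in> D" | "x \<in> D" "x + v \<notin> D" | "x \<notin> D" "x + v \<in> D" | "x \<notin> D" "x + v \<notin> D" by blast
        then show ?thesis
        proof cases
          case 4
          then have "w x = 0" "w (x + v) = 0" using w unfolding displacement_def by auto
          then show ?thesis by simp
        qed (auto intro: order_trans[OF ennreal_leI[OF min.cobounded1]])
      qed
    qed
    also have "\<dots> = (\<integral>\<^sup>+x. ennreal (?I v x * ?m v x) \<partial>lborel)
        + (emeasure lborel (?A v) + emeasure lborel (?B v))"
      using AB[of v] by (subst nn_integral_add, simp, simp, subst nn_integral_add) auto
    also have "\<dots> \<le> ennreal (CI * norm v) + (ennreal (CB * norm v) + ennreal (CB * norm v))" by (intro add_mono inner that A B)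
    also have "\<dots> = ennreal ((CI + 2 * CB) * norm v)" using CI CB by (simp add: algebra_simps flip: ennreal_plus)
    finally show ?thesis .
  qed
  \<comment> \<open>The tangent at 0 bounds the potential by c0 s and boundedness by f_inf; the sum
    of the two constants serves both regimes.\<close>
  have fmin: "f s \<le> (c0 + f_inf) * min 1 s" if "0 \<le> s" for s
  proof -
    have "f s \<le> c0 * s" using f_tangent[of 0 s] f_0 df_bounds[of 0] that mult_right_mono[of "df 0" c0 s] by simp
    moreover have "f s \<le> f_inf" using f_bounds[OF that] by simp
    moreover have "0 \<le> f_inf * s" "0 \<le> c0" using f_inf_nonneg c0_nonneg that by simp_all
    ultimately show ?thesis by (cases "1 \<le> s") (auto simp: algebra_simps)
  qed
  have c: "0 \<le> c0 + f_inf" using f_inf_nonneg c0_nonneg by simp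
  have inner_le: "(\<integral>\<^sup>+x. ennreal (k \<xi> * bond (w (x + \<epsilon> *\<^sub>R \<xi>) - w x) \<xi>) \<partial>lborel) \<le> ennreal (\<epsilon> * ((c0 + f_inf) * (CI + 2 * CB)) * k \<xi>)" for \<xi>
  proof (cases "\<xi> = 0 \<or> norm \<xi> > 1")
    case True
    then show ?thesis using k_support by (auto simp: bond_def f_0)
  next
    case False
    define v where "v = \<epsilon> *\<^sub>R \<xi>"
    have v: "v \<noteq> 0" "norm v = \<epsilon> * norm \<xi>" unfolding v_def using False \<epsilon>_pos by auto
    have k: "0 \<le> k \<xi>" using k_bounds by blast
    have "(\<integral>\<^sup>+x. ennreal (k \<xi> * bond (w (x + v) - w x) \<xi>) \<partial>lborel) \<le>
        (\<integral>\<^sup>+x. ennreal (k \<xi> * (c0 + f_inf)) * ennreal (?m v x) \<partial>lborel)"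
    proof (rule nn_integral_mono)
      fix x
      have "k \<xi> * bond (w (x + v) - w x) \<xi> \<le> k \<xi> * ((c0 + f_inf) * ?m v x)"
        unfolding bond_def v(2) by (intro mult_left_mono fmin bond_arg_nonneg k)
      then show "ennreal (k \<xi> * bond (w (x + v) - w x) \<xi>) \<le> ennreal (k \<xi> * (c0 + f_inf)) * ennreal (?m v x)"
        using k c by (subst ennreal_mult[symmetric]) (auto simp: mult.assoc intro!: ennreal_leI)
    qed
    also have "\<dots> = ennreal (k \<xi> * (c0 + f_inf)) * (\<integral>\<^sup>+x. ennreal (?m v x) \<partial>lborel)"
      by (rule nn_integral_cmult) measurable
    also have "\<dots> \<le> ennreal (k \<xi> * (c0 + f_inf)) * ennreal ((CI + 2 * CB) * norm v)" by (intro mult_left_mono trunc v) simp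
    also have "\<dots> = ennreal (k \<xi> * (c0 + f_inf) * ((CI + 2 * CB) * norm v))"
      using k c CI CB by (intro ennreal_mult[symmetric]) auto
    also have "\<dots> \<le> ennreal (\<epsilon> * ((c0 + f_inf) * (CI + 2 * CB)) * k \<xi>)"
    proof (rule ennreal_leI)
      have "norm \<xi> * (\<epsilon> * ((c0 + f_inf) * (CI + 2 * CB)) * k \<xi>) \<le> 1 * (\<epsilon> * ((c0 + f_inf) * (CI + 2 * CB)) * k \<xi>)"
        using False c CI CB k \<epsilon>_pos by (intro mult_right_mono mult_nonneg_nonneg) auto
      then show "k \<xi> * (c0 + f_inf) * ((CI + 2 * CB) * norm v) \<le> \<epsilon> * ((c0 + f_inf) * (CI + 2 * CB)) * k \<xi>"
        unfolding v(2) by (simp add: mult_ac)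
    qed
    finally show ?thesis unfolding v_def .
  qed
  have nn: "0 \<le> k (snd p) * bond (w (fst p + \<epsilon> *\<^sub>R snd p) - w (fst p)) (snd p)" for p
    unfolding bond_def using k_bounds f_bounds[OF bond_arg_nonneg] by (intro mult_nonneg_nonneg) auto
  have "ennreal (\<epsilon> * energy w) = (\<integral>\<^sup>+p. ennreal (k (snd p) * bond (w (fst p + \<epsilon> *\<^sub>R snd p) - w (fst p)) (snd p)) \<partial>lborel\<^sub>2)"
    unfolding energy_def using energy_integrable[OF w] nn \<epsilon>_pos by (subst nn_integral_eq_integral) auto
  also have "\<dots> = (\<integral>\<^sup>+\<xi>. (\<integral>\<^sup>+x. ennreal (k \<xi> * bond (w (x + \<epsilon> *\<^sub>R \<xi>) - w x) \<xi>) \<partial>lborel) \<partial>lborel)"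
    by (subst lborel_pair.nn_integral_snd[symmetric]) (auto simp: split_def)
  also have "\<dots> \<le> (\<integral>\<^sup>+\<xi>. ennreal (\<epsilon> * ((c0 + f_inf) * (CI + 2 * CB)) * k \<xi>) \<partial>lborel)"
    by (intro nn_integral_mono inner_le)
  also have "\<dots> = ennreal (\<epsilon> * ((c0 + f_inf) * (CI + 2 * CB)) * (LBINT \<xi>. k \<xi>))"
    using k_integrable k_bounds c CI CB \<epsilon>_pos by (subst nn_integral_eq_integral) auto
  finally have "\<epsilon> * energy w \<le> \<epsilon> * ((c0 + f_inf) * (CI + 2 * CB)) * (LBINT \<xi>. k \<xi>)"
    using c CI CB \<epsilon>_pos k_bounds by (subst (asm) ennreal_le_iff) (auto intro!: mult_nonneg_nonneg integral_nonneg_AE)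
  then show ?thesis using \<epsilon>_pos by (simp add: mult.assoc)
qed

end

section \<open>The energy estimate in \<open>L\<^sup>2\<close>\<close>

text \<open>Stated over an arbitrary measure; for \<open>lebesgue_on D\<close> this predicate and
  \<open>norm2\<close> are \<open>L2_on D\<close> and \<open>L2_norm D\<close>.\<close>

definition square_integrable :: "'a measure \<Rightarrow> ('a \<Rightarrow> real) \<Rightarrow> bool" where
  "square_integrable M f \<longleftrightarrow> f \<in> borel_measurable M \<and> integrable M (\<lambda>x. (f x)\<^sup>2)"

definition norm2 :: "'a measure \<Rightarrow> ('a \<Rightarrow> real) \<Rightarrow> real" where
  "norm2 M f = sqrt (\<integral>x. (f x)\<^sup>2 \<partial>M)"

lemma norm2_nonneg: "0 \<le> norm2 M f"
  unfolding norm2_def by (simp add: integral_nonneg_AE)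

lemma norm2_square: "(norm2 M f)\<^sup>2 = (\<integral>x. (f x)\<^sup>2 \<partial>M)"
  unfolding norm2_def by (simp add: integral_nonneg_AE)

lemma
  assumes f: "square_integrable M f" and g: "square_integrable M g"
  shows square_integrable_mult: "integrable M (\<lambda>x. f x * g x)"
    and norm2_Cauchy_Schwarz: "\<bar>\<integral>x. f x * g x \<partial>M\<bar> \<le> norm2 M f * norm2 M g"
proof -
  have [measurable]: "f \<in> borel_measurable M" "g \<in> borel_measurable M"
    and i: "integrable M (\<lambda>x. (f x)\<^sup>2)" "integrable M (\<lambda>x. (g x)\<^sup>2)"
    using f g unfolding square_integrable_def by auto
  show fg: "integrable M (\<lambda>x. f x * g x)"
  proof (rule Bochner_Integration.integrable_bound[OF Bochner_Integration.integrable_add[OF i]])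
    show "AE x in M. norm (f x * g x) \<le> norm ((f x)\<^sup>2 + (g x)\<^sup>2)"
    proof (rule AE_I2)
      fix x
      have "2 * (\<bar>f x\<bar> * \<bar>g x\<bar>) \<le> (f x)\<^sup>2 + (g x)\<^sup>2"
        using zero_le_power2[of "\<bar>f x\<bar> - \<bar>g x\<bar>"] by (simp add: power2_diff)
      moreover have "0 \<le> \<bar>f x\<bar> * \<bar>g x\<bar>" by simp
      ultimately have "\<bar>f x\<bar> * \<bar>g x\<bar> \<le> (f x)\<^sup>2 + (g x)\<^sup>2" by linarith
      then show "norm (f x * g x) \<le> norm ((f x)\<^sup>2 + (g x)\<^sup>2)" by (simp add: abs_mult)
    qed
  qed measurable
  have "ennreal ((\<integral>x. \<bar>f x * g x\<bar> \<partial>M)\<^sup>2) = (\<integral>\<^sup>+x. ennreal \<bar>f x\<bar> * ennreal \<bar>g x\<bar> \<partial>M)\<^sup>2"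
    using fg by (subst ennreal_mult[symmetric]) (auto simp: ennreal_power[symmetric] nn_integral_eq_integral integrable_abs abs_mult[symmetric] integral_nonneg_AE)
  also have "\<dots> \<le> (\<integral>\<^sup>+x. (ennreal \<bar>f x\<bar>)\<^sup>2 \<partial>M) * (\<integral>\<^sup>+x. (ennreal \<bar>g x\<bar>)\<^sup>2 \<partial>M)"
    by (rule Cauchy_Schwarz_nn_integral) measurable
  also have "\<dots> = ennreal (\<integral>x. (f x)\<^sup>2 \<partial>M) * ennreal (\<integral>x. (g x)\<^sup>2 \<partial>M)"
    using i by (simp add: ennreal_power nn_integral_eq_integral)
  also have "\<dots> = ennreal ((norm2 M f * norm2 M g)\<^sup>2)"
    by (simp add: power_mult_distrib norm2_square ennreal_mult integral_nonneg_AE)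
  finally have "(\<integral>x. \<bar>f x * g x\<bar> \<partial>M)\<^sup>2 \<le> (norm2 M f * norm2 M g)\<^sup>2"
    by (subst (asm) ennreal_le_iff) auto
  then have "(\<integral>x. \<bar>f x * g x\<bar> \<partial>M) \<le> norm2 M f * norm2 M g"
    by (rule power2_le_imp_le) (simp add: norm2_nonneg)
  then show "\<bar>\<integral>x. f x * g x \<partial>M\<bar> \<le> norm2 M f * norm2 M g"
    using integral_abs_bound[of M "\<lambda>x. f x * g x"] by linarith
qed

lemma square_integrable_add:
  assumes f: "square_integrable M f" and g: "square_integrable M g"
  shows "square_integrable M (\<lambda>x. f x + g x)"
proof -
  have "integrable M (\<lambda>x. (f x)\<^sup>2 + (g x)\<^sup>2 + 2 * (f x * g x))"
    using square_integrable_mult[OF f g] f g unfolding square_integrable_def by auto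
  then show ?thesis using f g unfolding square_integrable_def by (auto simp: power2_sum mult.assoc)
qed

lemma square_integrable_cmult: "square_integrable M f \<Longrightarrow> square_integrable M (\<lambda>x. c * f x)"
  unfolding square_integrable_def by (auto simp: power_mult_distrib)

lemma norm2_cmult: "norm2 M (\<lambda>x. c * f x) = \<bar>c\<bar> * norm2 M f"
  unfolding norm2_def by (simp add: power_mult_distrib real_sqrt_mult)

lemma square_integrable_diff:
  assumes "square_integrable M f" and "square_integrable M g"
  shows "square_integrable M (\<lambda>x. f x - g x)"
  using square_integrable_add[OF assms(1) square_integrable_cmult[OF assms(2), of "-1"]] by simp

lemma norm2_triangle:
  assumes f: "square_integrable M f" and g: "square_integrable M g"
  shows "norm2 M (\<lambda>x. f x + g x) \<le> norm2 M f + norm2 M g"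
proof (rule power2_le_imp_le)
  have "(norm2 M (\<lambda>x. f x + g x))\<^sup>2 = (\<integral>x. (f x)\<^sup>2 + (g x)\<^sup>2 + 2 * (f x * g x) \<partial>M)"
    by (simp add: norm2_square power2_sum mult.assoc)
  also have "\<dots> = (norm2 M f)\<^sup>2 + (norm2 M g)\<^sup>2 + 2 * (\<integral>x. f x * g x \<partial>M)"
    using square_integrable_mult[OF f g] f g unfolding square_integrable_def norm2_square by simp
  also have "\<dots> \<le> (norm2 M f + norm2 M g)\<^sup>2" using norm2_Cauchy_Schwarz[OF f g] by (simp add: power2_sum)
  finally show "(norm2 M (\<lambda>x. f x + g x))\<^sup>2 \<le> (norm2 M f + norm2 M g)\<^sup>2" .
qed (simp add: norm2_nonneg)

lemma norm2_diff_triangle: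
  assumes f: "square_integrable M f" and g: "square_integrable M g"
  shows "\<bar>norm2 M f - norm2 M g\<bar> \<le> norm2 M (\<lambda>x. f x - g x)"
  using norm2_triangle[OF square_integrable_diff[OF f g] g]
    norm2_triangle[OF square_integrable_diff[OF g f] f] norm2_cmult[of M "-1" "\<lambda>x. f x - g x"]
  by simp

section \<open>Limits and continuity in L^2\<close>

lemma inner2_tendsto:
  assumes f: "\<forall>\<^sub>F s in F. square_integrable M (f s)" and g: "\<forall>\<^sub>F s in F. square_integrable M (g s)"
    and f0: "square_integrable M f0" and g0: "square_integrable M g0"
    and fl: "((\<lambda>s. norm2 M (\<lambda>x. f s x - f0 x)) \<longlongrightarrow> 0) F" and gl: "((\<lambda>s. norm2 M (\<lambda>x. g s x - g0 x)) \<longlongrightarrow> 0) F"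
  shows "((\<lambda>s. \<integral>x. f s x * g s x \<partial>M) \<longlongrightarrow> (\<integral>x. f0 x * g0 x \<partial>M)) F"
proof (rule Lim_null[THEN iffD2], rule Lim_null_comparison)
  let ?a = "\<lambda>s. norm2 M (\<lambda>x. f s x - f0 x)" and ?b = "\<lambda>s. norm2 M (\<lambda>x. g s x - g0 x)"
  show "\<forall>\<^sub>F s in F. norm ((\<integral>x. f s x * g s x \<partial>M) - (\<integral>x. f0 x * g0 x \<partial>M)) \<le> ?a s * ?b s + ?a s * norm2 M g0 + norm2 M f0 * ?b s"
    using f g
  proof eventually_elim
    case (elim s)
    note df = square_integrable_diff[OF elim(1) f0] and dg = square_integrable_diff[OF elim(2) g0]
    have "(\<integral>x. f s x * g s x \<partial>M) - (\<integral>x. f0 x * g0 x \<partial>M) = (\<integral>x. f s x * g s x - f0 x * g0 x \<partial>M)"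
      using square_integrable_mult[OF elim] square_integrable_mult[OF f0 g0] by simp
    also have "\<dots> = (\<integral>x. (f s x - f0 x) * (g s x - g0 x) + (f s x - f0 x) * g0 x + f0 x * (g s x - g0 x) \<partial>M)"
      by (intro Bochner_Integration.integral_cong) (simp_all add: algebra_simps)
    also have "\<dots> = (\<integral>x. (f s x - f0 x) * (g s x - g0 x) \<partial>M) + (\<integral>x. (f s x - f0 x) * g0 x \<partial>M) + (\<integral>x. f0 x * (g s x - g0 x) \<partial>M)"
      using square_integrable_mult[OF df dg] square_integrable_mult[OF df g0] square_integrable_mult[OF f0 dg] by simp
    finally show ?case using norm2_Cauchy_Schwarz[OF df dg] norm2_Cauchy_Schwarz[OF df g0] norm2_Cauchy_Schwarz[OF f0 dg] by simp
  qed
  have "((\<lambda>s. ?a s * ?b s + ?a s * norm2 M g0 + norm2 M f0 * ?b s) \<longlongrightarrow> 0 * 0 + 0 * norm2 M g0 + norm2 M f0 * 0) F"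
    by (intro tendsto_intros fl gl)
  then show "((\<lambda>s. ?a s * ?b s + ?a s * norm2 M g0 + norm2 M f0 * ?b s) \<longlongrightarrow> 0) F" by simp
qed

lemma norm2_tendsto:
  fixes u :: "real \<Rightarrow> 'a \<Rightarrow> real"
  assumes u: "\<And>s. s \<in> S \<Longrightarrow> square_integrable M (u s)" and t: "t \<in> S"
    and lim: "((\<lambda>s. norm2 M (\<lambda>x. u s x - u t x)) \<longlongrightarrow> 0) (at t within S)"
  shows "((\<lambda>s. norm2 M (u s)) \<longlongrightarrow> norm2 M (u t)) (at t within S)"
proof (rule Lim_null[THEN iffD2], rule Lim_null_comparison[OF _ lim])
  have "\<forall>\<^sub>F s in at t within S. s \<in> S" by (auto simp: eventually_at_filter)
  then show "\<forall>\<^sub>F s in at t within S. norm (norm2 M (u s) - norm2 M (u t)) \<le> norm2 M (\<lambda>x. u s x - u t x)"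
    by eventually_elim (use u t in \<open>auto intro!: norm2_diff_triangle\<close>)
qed

lemma norm2_tendsto_of_diff_quotient:
  fixes u :: "real \<Rightarrow> 'a \<Rightarrow> real"
  assumes u: "\<And>s. s \<in> S \<Longrightarrow> square_integrable M (u s)" and du: "square_integrable M du" and t: "t \<in> S"
    and lim: "((\<lambda>s. norm2 M (\<lambda>x. (u s x - u t x) / (s - t) - du x)) \<longlongrightarrow> 0) (at t within S)"
  shows "((\<lambda>s. norm2 M (\<lambda>x. u s x - u t x)) \<longlongrightarrow> 0) (at t within S)"
proof (rule Lim_null_comparison)
  let ?q = "\<lambda>s. norm2 M (\<lambda>x. (u s x - u t x) / (s - t) - du x)"
  have "\<forall>\<^sub>F s in at t within S. s \<in> S \<and> s \<noteq> t" by (auto simp: eventually_at_filter)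
  then show "\<forall>\<^sub>F s in at t within S. norm (norm2 M (\<lambda>x. u s x - u t x)) \<le> \<bar>s - t\<bar> * (?q s + norm2 M du)"
  proof eventually_elim
    case (elim s)
    have q: "square_integrable M (\<lambda>x. (u s x - u t x) / (s - t))"
      using square_integrable_cmult[OF square_integrable_diff[OF u u], of s t "1 / (s - t)"] elim t by simp
    have "norm2 M (\<lambda>x. u s x - u t x) = norm2 M (\<lambda>x. (s - t) * ((u s x - u t x) / (s - t)))" using elim by simp
    also have "\<dots> = \<bar>s - t\<bar> * norm2 M (\<lambda>x. (u s x - u t x) / (s - t))" by (rule norm2_cmult)
    also have "\<dots> \<le> \<bar>s - t\<bar> * (?q s + norm2 M du)" using norm2_diff_triangle[OF q du] by (intro mult_left_mono) auto
    finally show ?case by (simp add: norm2_nonneg)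
  qed
  have "((\<lambda>s. \<bar>s - t\<bar> * (?q s + norm2 M du)) \<longlongrightarrow> \<bar>t - t\<bar> * (0 + norm2 M du)) (at t within S)"
    by (intro tendsto_intros lim)
  then show "((\<lambda>s. \<bar>s - t\<bar> * (?q s + norm2 M du)) \<longlongrightarrow> 0) (at t within S)" by simp
qed

text \<open>\<open>(g a + \<eta>) exp (2 (s - a))\<close> is a strict barrier; \<open>g\<close> has no two-sided derivative to integrate.\<close>

lemma gronwall_dini:
  fixes g :: "real \<Rightarrow> real"
  assumes cont: "continuous_on {0..T} g" and nonneg: "\<And>t. t \<in> {0..T} \<Longrightarrow> 0 \<le> g t"
    and dini: "\<And>t e. t \<in> {0<..<T} \<Longrightarrow> 0 < e \<Longrightarrow> \<forall>\<^sub>F s in at_right t. g s \<le> g t + (g t + e) * (s - t)"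
    and t: "t \<in> {0..T}"
  shows "g t \<le> g 0 * exp (2 * T)"
proof -
  \<comment> \<open>The comparison starts at a > 0 because the Dini bound is assumed at interior
    times only; continuity of \<open>g\<close> supplies the limit a -> 0 afterwards.\<close>
  have step: "g b \<le> (g a + \<eta>) * exp (2 * (b - a))" if ab: "0 < a" "a \<le> b" "b \<le> T" and \<eta>: "0 < \<eta>" for a b \<eta>
  proof (rule ccontr)
    define Y where "Y s = (g a + \<eta>) * exp (2 * (s - a))" for s
    assume "\<not> g b \<le> (g a + \<eta>) * exp (2 * (b - a))"
    then have b: "Y b < g b" unfolding Y_def by simp
    have Ypos: "0 < Y s" for s unfolding Y_def using nonneg[of a] ab \<eta> by (intro mult_pos_pos) auto
    define S where "S = {s \<in> {a..b}. g s - Y s \<le> 0}"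
    have "continuous_on {a..b} (\<lambda>s. g s - Y s)"
      unfolding Y_def using ab by (intro continuous_intros continuous_on_subset[OF cont]) auto
    then have "closedin (top_of_set {a..b}) S"
      unfolding S_def using continuous_closedin_preimage[of "{a..b}" "\<lambda>s. g s - Y s" "{..0}"] by (simp add: vimage_def Int_def)
    then have "compact S" by (rule closedin_compact[OF compact_Icc])
    moreover have "a \<in> S" unfolding S_def Y_def using ab \<eta> by simp
    \<comment> \<open>The last time at which \<open>g\<close> does not exceed the barrier. The Dini
      bound with slack \<open>e = Y t\<close> then allows growth at rate at most 2 Y t, which the
      exponent 2 of the barrier absorbs, so \<open>g\<close> stays below for a little
      longer.\<close>
    ultimately obtain t where t: "t \<in> S" "\<And>s. s \<in> S \<Longrightarrow> s \<le> t"
      using compact_attains_sup[of S] by blast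
    have tb: "a \<le> t" "t < b" "g t \<le> Y t" using t(1) b unfolding S_def by (auto simp: order_less_le)
    have "\<forall>\<^sub>F s in at_right t. g s \<le> g t + (g t + Y t) * (s - t)" using tb ab Ypos by (intro dini) auto
    moreover have "\<forall>\<^sub>F s in at_right t. t < s \<and> s < b" using tb by (auto simp: eventually_at_right intro: exI[of _ b])
    ultimately have "\<forall>\<^sub>F s in at_right t. False"
    proof eventually_elim
      case (elim s)
      have "g s \<le> Y t + (Y t + Y t) * (s - t)"
      proof -
        have "(g t + Y t) * (s - t) \<le> (Y t + Y t) * (s - t)" using elim tb(3) by (intro mult_right_mono) auto
        then show ?thesis using elim(1) tb(3) by linarith
      qed
      also have "\<dots> = Y t * (1 + 2 * (s - t))" by (simp add: algebra_simps)
      also have "\<dots> \<le> Y t * exp (2 * (s - t))" using Ypos[of t] by (intro mult_left_mono exp_ge_add_one_self) auto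
      also have "\<dots> = Y s" unfolding Y_def by (simp add: exp_add[symmetric] algebra_simps)
      finally have "s \<in> S" unfolding S_def using elim tb by simp
      then show False using t(2)[of s] elim by simp
    qed
    then show False by simp
  qed
  show ?thesis
  proof (cases "t = 0")
    case True
    have "g 0 * 1 \<le> g 0 * exp (2 * T)" using t nonneg[of 0] by (intro mult_left_mono) auto
    then show ?thesis using True by simp
  next
    case False
    then have t0: "0 < t" "t \<le> T" using t by auto
    have 1: "g t \<le> g a * exp (2 * (t - a))" if "0 < a" "a \<le> t" for a
    proof (rule tendsto_lowerbound)
      show "((\<lambda>\<eta>. (g a + \<eta>) * exp (2 * (t - a))) \<longlongrightarrow> g a * exp (2 * (t - a))) (at_right 0)"
        by (auto intro!: tendsto_eq_intros)
      show "\<forall>\<^sub>F \<eta> in at_right 0. g t \<le> (g a + \<eta>) * exp (2 * (t - a))"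
        by (rule eventually_mono[OF eventually_at_right_less[of 0]]) (rule step[OF that t0(2)])
    qed simp
    have "g t \<le> g 0 * exp (2 * (t - 0))"
    proof (rule tendsto_lowerbound)
      have "(g \<longlongrightarrow> g 0) (at 0 within {0..T})" using cont t0 unfolding continuous_on_def by auto
      then have "(g \<longlongrightarrow> g 0) (at_right 0)" using at_within_Icc_at_right[of 0 T] t0 by simp
      then show "((\<lambda>a. g a * exp (2 * (t - a))) \<longlongrightarrow> g 0 * exp (2 * (t - 0))) (at_right 0)"
        by (auto intro!: tendsto_eq_intros)
      show "\<forall>\<^sub>F a in at_right 0. g t \<le> g a * exp (2 * (t - a))"
        using 1 t0 by (auto simp: eventually_at_right intro!: exI[of _ t])
    qed simp
    also have "\<dots> \<le> g 0 * exp (2 * T)" using t0 nonneg[of 0] by (intro mult_left_mono) auto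
    finally show ?thesis .
  qed
qed

text \<open>Differences of \<open>E\<close> are only bounded from above, so all that is available for the total energy is its
  upper right Dini derivative, which is at most \<open>\<langle>b, u\<^sub>t\<rangle>\<close>.\<close>

lemma energy_estimate:
  fixes E :: "real \<Rightarrow> real" and u ut utt b \<Gamma> :: "real \<Rightarrow> 'a \<Rightarrow> real"
  assumes "0 < \<rho>" and A: "0 \<le> A"
    and E0: "\<And>t. t \<in> {0..T} \<Longrightarrow> 0 \<le> E t"
    and Ediff: "\<And>s t. s \<in> {0..T} \<Longrightarrow> t \<in> {0..T} \<Longrightarrow>
      E s - E t \<le> (\<integral>x. \<Gamma> t x * (u s x - u t x) \<partial>M) + A * (\<integral>x. (u s x - u t x)\<^sup>2 \<partial>M)"
    and \<Gamma>: "\<And>t. t \<in> {0..T} \<Longrightarrow> square_integrable M (\<Gamma> t) \<and> norm2 M (\<Gamma> t) \<le> K"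
    and sq: "\<And>t. t \<in> {0..T} \<Longrightarrow> square_integrable M (u t) \<and> square_integrable M (ut t) \<and> square_integrable M (utt t) \<and> square_integrable M (b t)"
    and u': "\<And>t. t \<in> {0..T} \<Longrightarrow> ((\<lambda>s. norm2 M (\<lambda>x. (u s x - u t x) / (s - t) - ut t x)) \<longlongrightarrow> 0) (at t within {0..T})"
    and ut': "\<And>t. t \<in> {0..T} \<Longrightarrow> ((\<lambda>s. norm2 M (\<lambda>x. (ut s x - ut t x) / (s - t) - utt t x)) \<longlongrightarrow> 0) (at t within {0..T})"
    and utc: "\<And>t. t \<in> {0..T} \<Longrightarrow> ((\<lambda>s. norm2 M (\<lambda>x. ut s x - ut t x)) \<longlongrightarrow> 0) (at t within {0..T})"
    and eq: "\<And>t. t \<in> {0<..T} \<Longrightarrow> AE x in M. \<rho> * utt t x = - \<Gamma> t x + b t x"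
    and b: "\<And>t. t \<in> {0..T} \<Longrightarrow> norm2 M (b t) \<le> \<beta>"
    and t: "t \<in> {0..T}"
  shows "E t + \<rho> / 2 * (norm2 M (ut t))\<^sup>2 \<le> (\<beta>\<^sup>2 / (2 * \<rho>) + (E 0 + \<rho> / 2 * (norm2 M (ut 0))\<^sup>2)) * exp (2 * T)"
proof -
  define G where "G t = E t + \<rho> / 2 * (norm2 M (ut t))\<^sup>2" for t
  \<comment> \<open>Adding this constant to the total energy absorbs the load by Young's inequality:
    <b, ut> <= \<beta>^2/(2 \<rho>) + (\<rho>/2) |ut|^2.\<close>
  define c where "c = \<beta>\<^sup>2 / (2 * \<rho>)"
  have c: "0 \<le> c" unfolding c_def using \<open>0 < \<rho>\<close> by simp
  have G0: "0 \<le> G t" if "t \<in> {0..T}" for t unfolding G_def using E0[OF that] \<open>0 < \<rho>\<close> by simp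
  have quot: "square_integrable M (\<lambda>x. (w s x - w t x) / (s - t))"
    if "square_integrable M (w s)" "square_integrable M (w t)" for w :: "real \<Rightarrow> 'a \<Rightarrow> real" and s t
    using square_integrable_cmult[OF square_integrable_diff[OF that], of "1 / (s - t)"] by simp
  have ev: "\<forall>\<^sub>F s in at t within {0..T}. s \<in> {0..T} \<and> s \<noteq> t" for t by (auto simp: eventually_at_filter)
  have du: "((\<lambda>s. norm2 M (\<lambda>x. u s x - u t x)) \<longlongrightarrow> 0) (at t within {0..T})" if "t \<in> {0..T}" for t
    by (rule norm2_tendsto_of_diff_quotient[OF _ _ that u'[OF that]]) (use sq that in auto)
  have Econt: "(E \<longlongrightarrow> E t) (at t within {0..T})" if t: "t \<in> {0..T}" for t
  proof (rule Lim_null[THEN iffD2], rule Lim_null_comparison)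
    let ?n = "\<lambda>s. norm2 M (\<lambda>x. u s x - u t x)"
    \<comment> \<open>Exchanging the two times in this one-sided bound makes it two-sided, and
      continuity of \<open>E\<close> follows from that of \<open>u\<close>; of \<open>K\<close> and
      \<open>A\<close> it matters here only that they do not depend on the times.\<close>
    have half: "E s - E r \<le> K * norm2 M (\<lambda>x. u s x - u r x) + A * (norm2 M (\<lambda>x. u s x - u r x))\<^sup>2"
      if "s \<in> {0..T}" "r \<in> {0..T}" for s r
    proof -
      have d: "square_integrable M (\<lambda>x. u s x - u r x)" using sq that by (intro square_integrable_diff) auto
      have "(\<integral>x. \<Gamma> r x * (u s x - u r x) \<partial>M) \<le> norm2 M (\<Gamma> r) * norm2 M (\<lambda>x. u s x - u r x)"
        using norm2_Cauchy_Schwarz[OF _ d, of "\<Gamma> r"] \<Gamma>[OF that(2)] by auto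
      also have "\<dots> \<le> K * norm2 M (\<lambda>x. u s x - u r x)"
        using \<Gamma>[OF that(2)] by (intro mult_right_mono) (auto simp: norm2_nonneg)
      finally show ?thesis using Ediff[OF that] by (simp add: norm2_square)
    qed
    have sym: "norm2 M (\<lambda>x. u t x - u s x) = norm2 M (\<lambda>x. u s x - u t x)" for s
      unfolding norm2_def by (simp add: power2_commute)
    show "\<forall>\<^sub>F s in at t within {0..T}. norm (E s - E t) \<le> K * ?n s + A * (?n s)\<^sup>2" using ev[of t]
    proof eventually_elim
      case (elim s)
      then show ?case using half[of s t] half[of t s] t sym[of s] by (simp add: abs_le_iff)
    qed
    have "((\<lambda>s. K * ?n s + A * (?n s)\<^sup>2) \<longlongrightarrow> K * 0 + A * 0\<^sup>2) (at t within {0..T})"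
      by (intro tendsto_intros du t)
    then show "((\<lambda>s. K * ?n s + A * (?n s)\<^sup>2) \<longlongrightarrow> 0) (at t within {0..T})" by simp
  qed
  have nut: "((\<lambda>s. norm2 M (ut s)) \<longlongrightarrow> norm2 M (ut t)) (at t within {0..T})" if "t \<in> {0..T}" for t
    by (rule norm2_tendsto[OF _ that utc[OF that]]) (use sq in auto)
  have cont: "continuous_on {0..T} (\<lambda>t. c + G t)" unfolding continuous_on_def G_def by (intro ballI tendsto_intros Econt nut)
  have dini: "\<forall>\<^sub>F s in at_right t. c + G s \<le> (c + G t) + ((c + G t) + e) * (s - t)"
    if t: "t \<in> {0<..<T}" and e: "0 < e" for t e
  proof -
    have t': "t \<in> {0..T}" "t \<in> {0<..T}" using t by auto
    have le: "at_right t \<le> at t within {0..T}" using at_le[of "{t..T}" "{0..T}" t] at_within_Icc_at_right[of t T] t by auto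
    let ?q = "\<lambda>s x. (u s x - u t x) / (s - t)" and ?p = "\<lambda>s x. (ut s x - ut t x) / (s - t)"
    \<comment> \<open>An upper bound for the difference quotient of the total energy, the kinetic
      part being factored as a^2 - b^2 = (a - b)(a + b). The quadratic remainder keeps a factor s -
      t, so \<open>A\<close> leaves no trace in the limit \<open>?L\<close>.\<close>
    let ?R = "\<lambda>s. (\<integral>x. \<Gamma> t x * ?q s x \<partial>M) + A * (s - t) * (\<integral>x. ?q s x * ?q s x \<partial>M)
      + \<rho> / 2 * (\<integral>x. ?p s x * (ut s x + ut t x) \<partial>M)"
    let ?L = "(\<integral>x. \<Gamma> t x * ut t x \<partial>M) + \<rho> * (\<integral>x. utt t x * ut t x \<partial>M)"
    have evr: "\<forall>\<^sub>F s in at_right t. s \<in> {0..T} \<and> s > t"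
      using t by (auto simp: eventually_at_right intro!: exI[of _ T])
    note sqt = sq[OF t'(1)]
    have q: "\<forall>\<^sub>F s in at_right t. square_integrable M (?q s)" using evr by eventually_elim (use quot[of u] sq t' in blast)
    have p: "\<forall>\<^sub>F s in at_right t. square_integrable M (?p s)" using evr by eventually_elim (use quot[of ut] sq t' in blast)
    have utt: "\<forall>\<^sub>F s in at_right t. square_integrable M (\<lambda>x. ut s x + ut t x)"
      using evr by eventually_elim (use sq t' in \<open>auto intro!: square_integrable_add\<close>)
    have "(?R \<longlongrightarrow> (\<integral>x. \<Gamma> t x * ut t x \<partial>M) + A * (t - t) * (\<integral>x. ut t x * ut t x \<partial>M)
      + \<rho> / 2 * (\<integral>x. utt t x * (ut t x + ut t x) \<partial>M)) (at_right t)"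
    proof (intro tendsto_add tendsto_mult tendsto_const tendsto_diff tendsto_ident_at)
      have q': "((\<lambda>s. norm2 M (\<lambda>x. ?q s x - ut t x)) \<longlongrightarrow> 0) (at_right t)"
        by (rule tendsto_mono[OF le u'[OF t'(1)]])
      show "((\<lambda>s. \<integral>x. \<Gamma> t x * ?q s x \<partial>M) \<longlongrightarrow> (\<integral>x. \<Gamma> t x * ut t x \<partial>M)) (at_right t)"
        using \<Gamma>[OF t'(1)] sqt by (intro inner2_tendsto q q') (auto simp: norm2_def)
      show "((\<lambda>s. \<integral>x. ?q s x * ?q s x \<partial>M) \<longlongrightarrow> (\<integral>x. ut t x * ut t x \<partial>M)) (at_right t)"
        using sqt by (intro inner2_tendsto q q') auto
      have "((\<lambda>s. norm2 M (\<lambda>x. ut s x + ut t x - (ut t x + ut t x))) \<longlongrightarrow> 0) (at_right t)"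
        using tendsto_mono[OF le utc[OF t'(1)]] by simp
      then show "((\<lambda>s. \<integral>x. ?p s x * (ut s x + ut t x) \<partial>M) \<longlongrightarrow> (\<integral>x. utt t x * (ut t x + ut t x) \<partial>M)) (at_right t)"
        using sqt by (intro inner2_tendsto p utt tendsto_mono[OF le ut'[OF t'(1)]] square_integrable_add) auto
    qed
    moreover have "(\<integral>x. utt t x * (ut t x + ut t x) \<partial>M) = 2 * (\<integral>x. utt t x * ut t x \<partial>M)"
      by (simp flip: mult_2 add: mult.left_commute)
    ultimately have R: "(?R \<longlongrightarrow> ?L) (at_right t)" by simp
    have L: "?L \<le> c + G t"
    proof -
      have iu: "integrable M (\<lambda>x. \<Gamma> t x * ut t x)" "integrable M (\<lambda>x. utt t x * ut t x)"
        using \<Gamma>[OF t'(1)] sqt by (auto intro: square_integrable_mult)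
      have "?L = (\<integral>x. \<Gamma> t x * ut t x + \<rho> * (utt t x * ut t x) \<partial>M)" using iu by simp
      \<comment> \<open>The equation of motion tested with the velocity: elastic and inertial power
        add up to the power of the load.\<close>
      also have "\<dots> = (\<integral>x. b t x * ut t x \<partial>M)"
      proof (rule integral_cong_AE)
        have [measurable]: "\<Gamma> t \<in> borel_measurable M" "ut t \<in> borel_measurable M" "utt t \<in> borel_measurable M" "b t \<in> borel_measurable M"
          using \<Gamma>[OF t'(1)] sqt unfolding square_integrable_def by auto
        show "(\<lambda>x. \<Gamma> t x * ut t x + \<rho> * (utt t x * ut t x)) \<in> borel_measurable M" by measurable
        show "(\<lambda>x. b t x * ut t x) \<in> borel_measurable M" by measurable
        show "AE x in M. \<Gamma> t x * ut t x + \<rho> * (utt t x * ut t x) = b t x * ut t x" using eq[OF t'(2)]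
        proof eventually_elim
          case (elim x)
          have "\<Gamma> t x * ut t x + \<rho> * (utt t x * ut t x) = (\<Gamma> t x + \<rho> * utt t x) * ut t x"
            by (simp add: algebra_simps)
          then show ?case using elim by simp
        qed
      qed
      also have "\<dots> \<le> norm2 M (b t) * norm2 M (ut t)" using norm2_Cauchy_Schwarz[of M "b t" "ut t"] sqt by auto
      also have "\<dots> \<le> \<beta> * norm2 M (ut t)" using b[OF t'(1)] by (intro mult_right_mono) (auto simp: norm2_nonneg)
      also have "\<dots> \<le> c + \<rho> / 2 * (norm2 M (ut t))\<^sup>2"
      proof -
        have "0 \<le> (\<beta> - \<rho> * norm2 M (ut t))\<^sup>2 / (2 * \<rho>)" using \<open>0 < \<rho>\<close> by simp
        also have "\<dots> = c + \<rho> / 2 * (norm2 M (ut t))\<^sup>2 - \<beta> * norm2 M (ut t)"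
          unfolding c_def using \<open>0 < \<rho>\<close> by (simp add: field_simps power2_eq_square)
        finally show ?thesis by simp
      qed
      also have "\<dots> \<le> c + G t" unfolding G_def using E0[OF t'(1)] by simp
      finally show ?thesis .
    qed
    have "\<forall>\<^sub>F s in at_right t. ?R s < (c + G t) + e" using order_tendstoD(2)[OF R, of "c + G t + e"] L e by simp
    with evr show ?thesis
    proof eventually_elim
      case (elim s)
      have st: "s - t > 0" "s - t \<noteq> 0" "s \<in> {0..T}" using elim by auto
      note sqs = sq[OF st(3)]
      have 1: "E s - E t \<le> (s - t) * ((\<integral>x. \<Gamma> t x * ?q s x \<partial>M) + A * (s - t) * (\<integral>x. ?q s x * ?q s x \<partial>M))"
      proof -
        have "E s - E t \<le> (\<integral>x. \<Gamma> t x * (u s x - u t x) \<partial>M) + A * (\<integral>x. (u s x - u t x)\<^sup>2 \<partial>M)"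
          by (rule Ediff[OF st(3) t'(1)])
        also have "(\<integral>x. \<Gamma> t x * (u s x - u t x) \<partial>M) = (s - t) * (\<integral>x. \<Gamma> t x * ?q s x \<partial>M)"
          using st by simp
        also have "(\<integral>x. (u s x - u t x)\<^sup>2 \<partial>M) = (s - t) * (s - t) * (\<integral>x. ?q s x * ?q s x \<partial>M)"
          using st by (simp add: power2_eq_square)
        finally show ?thesis by (simp add: algebra_simps)
      qed
      have 2: "(norm2 M (ut s))\<^sup>2 - (norm2 M (ut t))\<^sup>2 = (s - t) * (\<integral>x. ?p s x * (ut s x + ut t x) \<partial>M)"
      proof -
        have "(norm2 M (ut s))\<^sup>2 - (norm2 M (ut t))\<^sup>2 = (\<integral>x. (ut s x)\<^sup>2 - (ut t x)\<^sup>2 \<partial>M)"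
          unfolding norm2_square using sqs sqt unfolding square_integrable_def by simp
        also have "\<dots> = (\<integral>x. (s - t) * (?p s x * (ut s x + ut t x)) \<partial>M)"
          using st by (intro Bochner_Integration.integral_cong)
            (simp_all add: power2_eq_square square_diff_square_factored mult.commute)
        finally show ?thesis by simp
      qed
      have "G s - G t = (E s - E t) + \<rho> / 2 * ((norm2 M (ut s))\<^sup>2 - (norm2 M (ut t))\<^sup>2)"
        unfolding G_def by (simp add: algebra_simps)
      also have "\<dots> \<le> (s - t) * ?R s"
      proof -
        have "d + \<rho> / 2 * (h * r) \<le> h * (p + A * h * q + \<rho> / 2 * r)" if "d \<le> h * (p + A * h * q)" for d h p q r
          using that by (simp add: algebra_simps)
        from this[OF 1] show ?thesis unfolding 2 .
      qed
      also have "\<dots> \<le> (s - t) * ((c + G t) + e)" using elim st by (intro mult_left_mono) auto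
      finally show ?case by (simp add: algebra_simps)
    qed
  qed
  have "c + G t \<le> (c + G 0) * exp (2 * T)" by (rule gronwall_dini[OF cont _ dini t]) (use c G0 in auto)
  then show ?thesis using c unfolding G_def c_def by simp
qed

section \<open>Borel representatives\<close>

lemma AE_lebesgue_on_iff_lborel:
  "S \<in> sets lebesgue \<Longrightarrow> (AE x in lebesgue_on S. P x) \<longleftrightarrow> (AE x in lborel. x \<in> S \<longrightarrow> P x)"
  by (subst AE_restrict_space_iff) (auto simp: AE_completion_iff)

lemma measurable_lebesgue_on_of_lborel:
  fixes f g :: "'a::euclidean_space \<Rightarrow> 'b::euclidean_space"
  assumes S: "S \<in> sets borel" and g: "g \<in> borel_measurable borel" and fg: "AE x in lborel. x \<in> S \<longrightarrow> f x = g x"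
  shows "f \<in> borel_measurable (lebesgue_on S)"
proof -
  have "(\<lambda>x. indicator S x *\<^sub>R g x) \<in> borel_measurable lebesgue" using S g by (intro measurable_completion) auto
  moreover have "AE x in lebesgue. indicator S x *\<^sub>R g x = indicator S x *\<^sub>R f x"
    unfolding AE_completion_iff using fg by eventually_elim (auto simp: indicator_def)
  ultimately have "(\<lambda>x. indicator S x *\<^sub>R f x) \<in> borel_measurable lebesgue" by (rule borel_measurable_AE)
  then show ?thesis using S by (subst borel_measurable_restrict_space_iff) (auto intro: sets_completionI_sets)
qed

lemma
  fixes f g :: "'a::euclidean_space \<Rightarrow> 'b::euclidean_space"
  assumes S: "S \<in> sets borel" and g0: "\<And>x. x \<notin> S \<Longrightarrow> g x = 0"
    and g: "g \<in> borel_measurable borel" and fg: "AE x in lborel. x \<in> S \<longrightarrow> f x = g x"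
  shows integral_lebesgue_on_eq_lborel: "(\<integral>x. f x \<partial>lebesgue_on S) = (LBINT x. g x)"
    and integrable_lebesgue_on_iff_lborel: "integrable (lebesgue_on S) f \<longleftrightarrow> integrable lborel g"
proof -
  let ?f = "\<lambda>x. indicator S x *\<^sub>R f x"
  have S': "S \<inter> space lebesgue \<in> sets lebesgue" using S by (auto intro: sets_completionI_sets)
  have fl: "?f \<in> borel_measurable lebesgue"
    using measurable_lebesgue_on_of_lborel[OF S g fg] S' by (subst (asm) borel_measurable_restrict_space_iff) auto
  have gl: "g \<in> borel_measurable lebesgue" using g by (simp add: measurable_completion)
  have ae: "AE x in lebesgue. ?f x = g x" unfolding AE_completion_iff using fg by eventually_elim (auto simp: indicator_def g0)
  show "(\<integral>x. f x \<partial>lebesgue_on S) = (LBINT x. g x)"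
    using integral_cong_AE[OF fl gl ae] integral_completion[of g lborel] g integral_restrict_space[OF S', of f] by simp
  show "integrable (lebesgue_on S) f \<longleftrightarrow> integrable lborel g"
    using integrable_cong_AE[OF fl gl ae] integrable_completion[of g lborel] g integrable_restrict_space[OF S', of f] by simp
qed

text \<open>Given functions are Lebesgue measurable on their domain, whereas Fubini and the shears
  are applied to Borel functions on the whole space. The components are corrected on null sets and
  the result is set to 0 outside \<open>S\<close>.\<close>

lemma borel_representative:
  fixes u :: "'a::euclidean_space \<Rightarrow> 'b::euclidean_space"
  assumes S: "S \<in> sets borel" and u: "u \<in> borel_measurable (lebesgue_on S)"
  obtains w where "w \<in> borel_measurable borel" "\<And>x. x \<notin> S \<Longrightarrow> w x = 0" "AE x in lborel. x \<in> S \<longrightarrow> u x = w x"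
proof -
  have S': "S \<inter> space lebesgue \<in> sets lebesgue" using S by (auto intro: sets_completionI_sets)
  have ul: "(\<lambda>x. indicator S x *\<^sub>R u x) \<in> borel_measurable lebesgue"
    using u S' by (subst (asm) borel_measurable_restrict_space_iff) auto
  have "\<exists>g\<in>borel_measurable borel. AE x in lborel. (indicator S x *\<^sub>R u x) \<bullet> i = g x" for i :: 'b
  proof -
    have "(\<lambda>x. (indicator S x *\<^sub>R u x) \<bullet> i) \<in> borel_measurable lebesgue"
      using ul by (intro borel_measurable_inner) auto
    from completion_ex_borel_measurable_real[OF this] show ?thesis by simp
  qed
  then obtain g where g: "\<And>i. g i \<in> borel_measurable borel" "\<And>i. AE x in lborel. (indicator S x *\<^sub>R u x) \<bullet> i = g i x"
    by metis
  define w where "w x = indicator S x *\<^sub>R (\<Sum>i\<in>Basis. g i x *\<^sub>R i)" for x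
  show ?thesis
  proof
    show "w \<in> borel_measurable borel" unfolding w_def[abs_def] using S g(1) by auto
    have "AE x in lborel. \<forall>i\<in>Basis. (indicator S x *\<^sub>R u x) \<bullet> i = g i x"
      by (rule AE_ball_countable[THEN iffD2]) (use g(2) in \<open>auto intro: countable_finite\<close>)
    then show "AE x in lborel. x \<in> S \<longrightarrow> u x = w x"
    proof eventually_elim
      case (elim x)
      show ?case
      proof
        assume "x \<in> S"
        then have "(\<Sum>i\<in>Basis. g i x *\<^sub>R i) = (\<Sum>i\<in>Basis. (u x \<bullet> i) *\<^sub>R i)"
          using elim by (intro sum.cong) auto
        then show "u x = w x" unfolding w_def using \<open>x \<in> S\<close> by (simp add: euclidean_representation)
      qed
    qed
  qed (simp add: w_def)
qed

text \<open>Nondegenerate affine maps preserve null sets. For a fixed x this permits replacing a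
  displacement by its representative at x + \<epsilon> \<xi> for almost every \<xi>.\<close>

lemma AE_lborel_affine:
  fixes x :: "'a::euclidean_space"
  assumes "AE y in lborel. P y" and "c \<noteq> 0"
  shows "AE \<xi> in lborel. P (x + c *\<^sub>R \<xi>)"
proof -
  have "AE y in density (distr lborel borel (\<lambda>\<xi>. x + c *\<^sub>R \<xi>)) (\<lambda>_. ennreal (\<bar>c\<bar> ^ DIM('a))). P y"
    using assms(1) by (subst lborel_affine[OF assms(2), of x, symmetric])
  then have "AE y in distr lborel borel (\<lambda>\<xi>. x + c *\<^sub>R \<xi>). P y" using assms(2) by (subst (asm) AE_density) auto
  then show ?thesis by (rule AE_distrD[rotated]) measurable
qed

text \<open>Polar coordinates: the set is contained in the image of a null set of pairs (radius,
  angle) under a differentiable map between planes, and such images are null. Consequently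
  \<open>J (norm \<xi>)\<close> tolerates changes of \<open>J\<close> on a null set of
  radii.\<close>

lemma negligible_norm_vimage:
  assumes "negligible N"
  shows "negligible {\<xi> :: plane. norm \<xi> \<in> N}"
proof -
  let ?P = "\<lambda>p :: real \<times> real. (\<chi> i. if i = 1 then fst p * cos (snd p) else fst p * sin (snd p)) :: plane"
  have N: "N \<times> (UNIV :: real set) \<in> null_sets lebesgue"
  proof -
    obtain N' where N': "N' \<in> null_sets lborel" "N \<subseteq> N'"
      using assms unfolding negligible_iff_null_sets null_sets_completion_iff2 by auto
    have "emeasure (lborel \<Otimes>\<^sub>M lborel) (N' \<times> (UNIV :: real set)) = emeasure lborel N' * emeasure lborel (UNIV :: real set)"
      using N'(1) by (intro lborel.emeasure_pair_measure_Times) auto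
    then have "N' \<times> (UNIV :: real set) \<in> null_sets (lborel \<Otimes>\<^sub>M lborel)" using N'(1) by (auto simp: null_sets_def)
    then have "N' \<times> (UNIV :: real set) \<in> null_sets lborel" by (simp add: lborel_prod)
    then show ?thesis using N'(2) by (intro null_sets_completion_iff2[THEN iffD2]) (auto intro!: bexI[of _ "N' \<times> UNIV"])
  qed
  have "negligible (?P ` (N \<times> UNIV))"
  proof (rule negligible_differentiable_image_negligible)
    show "?P differentiable_on (N \<times> UNIV)"
    proof (rule differentiable_at_imp_differentiable_on)
      fix p :: "real \<times> real"
      have "((\<lambda>p. ?P p) has_derivative (\<lambda>h. \<chi> i. if i = 1 then fst h * cos (snd p) - fst p * (snd h * sin (snd p))
          else fst h * sin (snd p) + fst p * (snd h * cos (snd p)))) (at p)"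
      proof (subst has_derivative_componentwise_within, intro ballI)
        fix i :: plane assume "i \<in> Basis"
        then obtain j where "i = axis j 1" by (auto simp: Basis_vec_def)
        then show "((\<lambda>p. ?P p \<bullet> i) has_derivative (\<lambda>h. (\<chi> i. if i = 1 then fst h * cos (snd p) - fst p * (snd h * sin (snd p))
          else fst h * sin (snd p) + fst p * (snd h * cos (snd p))) \<bullet> i)) (at p)"
          by (cases "j = 1") (auto simp: inner_axis intro!: derivative_eq_intros)
      qed
      then show "?P differentiable (at p)" by (rule differentiableI)
    qed
  qed (use N in \<open>auto simp: negligible_iff_null_sets\<close>)
  moreover have "{\<xi> :: plane. norm \<xi> \<in> N} \<subseteq> ?P ` (N \<times> UNIV)"
  proof
    fix \<xi> :: plane assume "\<xi> \<in> {\<xi>. norm \<xi> \<in> N}"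
    then have n: "norm \<xi> \<in> N" by simp
    have "\<exists>t. \<xi> $ 1 = norm \<xi> * cos t \<and> \<xi> $ 2 = norm \<xi> * sin t"
    proof (cases "\<xi> = 0")
      case False
      have "(norm \<xi>)\<^sup>2 = (\<xi> $ 1)\<^sup>2 + (\<xi> $ 2)\<^sup>2" by (simp add: norm_vec_def L2_set_def sum_2)
      note n = this
      have "(\<xi> $ 1 / norm \<xi>)\<^sup>2 + (\<xi> $ 2 / norm \<xi>)\<^sup>2 = 1"
      proof -
        have "(\<xi> $ 1 / norm \<xi>)\<^sup>2 + (\<xi> $ 2 / norm \<xi>)\<^sup>2 = ((\<xi> $ 1)\<^sup>2 + (\<xi> $ 2)\<^sup>2) / (norm \<xi>)\<^sup>2"
          by (simp add: power_divide add_divide_distrib)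
        then show ?thesis unfolding n[symmetric] using False by simp
      qed
      then obtain t where "\<xi> $ 1 / norm \<xi> = cos t" "\<xi> $ 2 / norm \<xi> = sin t"
        using sincos_total_2pi by metis
      then show ?thesis using False by (auto simp: field_simps)
    qed auto
    then obtain t where "\<xi> $ 1 = norm \<xi> * cos t" "\<xi> $ 2 = norm \<xi> * sin t" by blast
    then have "\<xi> = ?P (norm \<xi>, t)" by (simp add: vec_eq_iff forall_2)
    then show "\<xi> \<in> ?P ` (N \<times> UNIV)" using n by blast
  qed
  ultimately show ?thesis by (rule negligible_subset)
qed

text \<open>If \<open>J\<close> vanishes almost everywhere, then \<open>\<mu> = G\<^sub>c = 0\<close> and the initial data are unrestricted,
  hence the alternative in the last clause.\<close>

lemma radial_kernel:
  fixes J :: "real \<Rightarrow> real"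
  assumes J: "J \<in> borel_measurable (lebesgue_on {0..})" and b: "\<And>r. 0 \<le> r \<Longrightarrow> r \<le> 1 \<Longrightarrow> 0 \<le> J r \<and> J r < M"
  obtains k :: "plane \<Rightarrow> real" where "k \<in> borel_measurable borel" "\<And>\<xi>. 0 \<le> k \<xi> \<and> k \<xi> \<le> M" "\<And>\<xi>. norm \<xi> > 1 \<Longrightarrow> k \<xi> = 0"
    "AE \<xi> in lborel. norm \<xi> \<le> 1 \<longrightarrow> k \<xi> = J (norm \<xi>)"
    "0 < (\<integral>r. r\<^sup>2 * J r \<partial>lebesgue_on {0..1}) \<or> k = (\<lambda>_. 0)"
proof -
  have B: "{0 :: real..} \<in> sets borel" by simp
  obtain J' where J': "J' \<in> borel_measurable borel" "AE r in lborel. r \<in> {0..} \<longrightarrow> J r = J' r"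
    using borel_representative[OF B J] by blast
  have M: "0 \<le> M" using b[of 0] by simp
  have neg: "AE \<xi> in lborel. P (norm (\<xi> :: plane))" if "AE r in lborel. r \<in> {0..} \<longrightarrow> P r" for P :: "real \<Rightarrow> bool"
  proof -
    have "AE r in lebesgue. r \<in> {0..} \<longrightarrow> P r" using that by (simp only: AE_completion_iff)
    then have "{r. \<not> (r \<in> {0..} \<longrightarrow> P r)} \<in> null_sets lebesgue"
      by (simp only: completion.AE_iff_null_sets space_completion space_lborel space_borel UNIV_I simp_thms)
    then have "{\<xi> :: plane. norm \<xi> \<in> {r. \<not> (r \<in> {0..} \<longrightarrow> P r)}} \<in> null_sets lebesgue"
      using negligible_norm_vimage unfolding negligible_iff_null_sets by blast
    then have "AE \<xi> in lebesgue. P (norm (\<xi> :: plane))" by (simp add: completion.AE_iff_null_sets)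
    then show ?thesis by (simp only: AE_completion_iff)
  qed
  show ?thesis
  proof (cases "0 < (\<integral>r. r\<^sup>2 * J r \<partial>lebesgue_on {0..1})")
    case True
    \<comment> \<open>A Borel version of \<open>J\<close> may leave [0, M] on a null set; clipping
      makes the bounds hold everywhere.\<close>
    define k :: "plane \<Rightarrow> real" where "k \<xi> = indicator {..1} (norm \<xi>) * max 0 (min M (J' (norm \<xi>)))" for \<xi>
    have [measurable]: "(norm :: plane \<Rightarrow> real) \<in> borel_measurable borel"
      by (rule borel_measurable_continuous_onI) (intro continuous_intros)
    show ?thesis
    proof
      show "k \<in> borel_measurable borel" unfolding k_def[abs_def] using J'(1) by measurable
      show "AE \<xi> in lborel. norm \<xi> \<le> 1 \<longrightarrow> k \<xi> = J (norm \<xi>)" using neg[OF J'(2)]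
      proof eventually_elim
        case (elim \<xi>)
        then show ?case using b[of "norm \<xi>"] unfolding k_def by auto
      qed
    qed (use M True in \<open>auto simp: k_def indicator_def\<close>)
  next
    case False
    have fg: "AE r in lborel. r \<in> {0..1} \<longrightarrow> r\<^sup>2 * J r = r\<^sup>2 * J' r" using J'(2) by eventually_elim auto
    have m: "(\<lambda>r. r\<^sup>2 * J' r) \<in> borel_measurable borel" using J'(1) by measurable
    have i: "integrable (lebesgue_on {0..1}) (\<lambda>r. r\<^sup>2 * J r)"
    proof (rule Bochner_Integration.integrable_bound[of _ "\<lambda>_. M"])
      show "integrable (lebesgue_on {0..1}) (\<lambda>_::real. M)" by (simp add: integrable_restrict_space)
      show "(\<lambda>r. r\<^sup>2 * J r) \<in> borel_measurable (lebesgue_on {0..1})"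
        by (rule measurable_lebesgue_on_of_lborel[OF _ m fg]) simp
      show "AE r in lebesgue_on {0..1}. norm (r\<^sup>2 * J r) \<le> norm M"
      proof (rule AE_I2)
        fix r :: real assume "r \<in> space (lebesgue_on {0..1})"
        then have r: "0 \<le> r" "r \<le> 1" by auto
        have "r\<^sup>2 * J r \<le> 1 * J r" using b[OF r] r by (intro mult_right_mono) (auto simp: power_le_one)
        then show "norm (r\<^sup>2 * J r) \<le> norm M" using b[OF r] by simp
      qed
    qed
    \<comment> \<open>Since J >= 0 on [0, 1], a vanishing second moment forces J = 0 almost
      everywhere there, and the zero kernel is a version of J(|\<xi>|).\<close>
    have "0 \<le> (\<integral>r. r\<^sup>2 * J r \<partial>lebesgue_on {0..1})" using b by (intro integral_nonneg_AE AE_I2) auto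
    then have "(\<integral>r. r\<^sup>2 * J r \<partial>lebesgue_on {0..1}) = 0" using False by simp
    moreover have "AE r in lebesgue_on {0..1}. 0 \<le> r\<^sup>2 * J r" using b by (intro AE_I2) auto
    ultimately have "AE r in lebesgue_on {0..1}. r\<^sup>2 * J r = 0" using integral_nonneg_eq_0_iff_AE[OF i] by blast
    then have "AE r in lborel. r \<in> {0..1} \<longrightarrow> r\<^sup>2 * J r = 0" by (subst (asm) AE_lebesgue_on_iff_lborel) auto
    moreover have "AE r in lborel. r \<noteq> (0::real)" by (rule AE_lborel_singleton)
    ultimately have "AE r in lborel. r \<in> {0..} \<longrightarrow> r \<le> 1 \<longrightarrow> J r = 0" by eventually_elim auto
    from neg[OF this] show ?thesis using M by (intro that[of "\<lambda>_. 0"]) (auto elim!: eventually_mono)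
  qed
qed

section \<open>\<open>PD\<close> and \<open>grad_PD\<close> expressed through Borel
  representatives\<close>

context bond_energy
begin

context
  fixes J f\<^sub>0 f\<^sub>1 :: "real \<Rightarrow> real" and \<alpha> :: real and u w :: "plane \<Rightarrow> real"
  assumes f_eq: "\<And>s. 0 \<le> s \<Longrightarrow> f s = f\<^sub>0 s" and df_eq: "\<And>s. 0 \<le> s \<Longrightarrow> df s = f\<^sub>1 s"
    and f\<^sub>0_deriv: "\<And>s. 0 \<le> s \<Longrightarrow> (f\<^sub>0 has_real_derivative f\<^sub>1 s) (at s within {0..})"
    and k_J: "AE \<xi> in lborel. norm \<xi> \<le> 1 \<longrightarrow> k \<xi> = J (norm \<xi>)"
    and \<epsilon>_less: "\<epsilon> < \<alpha>"
    and w: "displacement w" and u_w: "AE x in lborel. x \<in> enlargement D \<alpha> \<longrightarrow> u x = w x"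
begin

lemma w_measurable[measurable]: "w \<in> borel_measurable borel"
  using w unfolding displacement_def by simp

lemma pd_W_eq: "pd_W J f\<^sub>0 \<epsilon> \<eta> \<xi> = J (norm \<xi>) / \<epsilon>^3 * bond \<eta> \<xi>"
  unfolding pd_W_def bond_def f_eq[OF bond_arg_nonneg] by simp

text \<open>At \<eta> = 0 only a one-sided derivative of the potential is at hand. It suffices
  because the inner function \<eta>^2/(\<epsilon> |\<xi>|) never leaves the half-line: the chain
  rule is applied within its range.\<close>

lemma deriv_pd_W: "deriv (\<lambda>\<eta>. pd_W J f\<^sub>0 \<epsilon> \<eta> \<xi>) \<eta> = J (norm \<xi>) / \<epsilon>^3 * dbond \<eta> \<xi>"
proof (rule DERIV_imp_deriv)
  let ?g = "\<lambda>\<eta>::real. \<eta>\<^sup>2 / (\<epsilon> * norm \<xi>)"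
  have g: "(?g has_real_derivative 2 * \<eta> / (\<epsilon> * norm \<xi>)) (at \<eta>)"
    by (intro DERIV_cdivide) (auto intro!: derivative_eq_intros)
  have "(f\<^sub>0 has_real_derivative f\<^sub>1 (?g \<eta>)) (at (?g \<eta>) within range ?g)"
    by (rule has_field_derivative_subset[OF f\<^sub>0_deriv[OF bond_arg_nonneg]]) (use bond_arg_nonneg in auto)
  from DERIV_image_chain[OF this g]
  have "((\<lambda>\<eta>. f\<^sub>0 (?g \<eta>)) has_real_derivative dbond \<eta> \<xi>) (at \<eta>)"
    unfolding dbond_def df_eq[OF bond_arg_nonneg] by (simp add: o_def)
  then have "((\<lambda>\<eta>. J (norm \<xi>) / \<epsilon>^3 * f\<^sub>0 (?g \<eta>)) has_real_derivative J (norm \<xi>) / \<epsilon>^3 * dbond \<eta> \<xi>) (at \<eta>)"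
    by (rule DERIV_cmult)
  then show "((\<lambda>\<eta>. pd_W J f\<^sub>0 \<epsilon> \<eta> \<xi>) has_real_derivative J (norm \<xi>) / \<epsilon>^3 * dbond \<eta> \<xi>) (at \<eta>)"
    unfolding pd_W_def by simp
qed

text \<open>Both points lie within distance \<epsilon> < \<alpha> of \<open>D\<close>, in the region
  where \<open>u\<close> and \<open>w\<close> agree up to a null set.\<close>

lemma AE_neighbours:
  assumes "x \<in> D"
  shows "AE \<xi> in lborel. norm \<xi> \<le> 1 \<longrightarrow> u (x + \<epsilon> *\<^sub>R \<xi>) = w (x + \<epsilon> *\<^sub>R \<xi>) \<and> u (x - \<epsilon> *\<^sub>R \<xi>) = w (x - \<epsilon> *\<^sub>R \<xi>)"
proof -
  have in_enl: "x + c *\<^sub>R \<xi> \<in> enlargement D \<alpha>" if "norm \<xi> \<le> 1" "\<bar>c\<bar> = \<epsilon>" for c \<xi>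
  proof -
    have "infdist (x + c *\<^sub>R \<xi>) D \<le> dist (x + c *\<^sub>R \<xi>) x" by (rule infdist_le[OF assms])
    also have "\<dots> \<le> \<epsilon>" using that \<epsilon>_pos by (simp add: dist_norm mult_left_le)
    finally show ?thesis unfolding enlargement_def using \<epsilon>_less by simp
  qed
  have "AE \<xi> in lborel. x + c *\<^sub>R \<xi> \<in> enlargement D \<alpha> \<longrightarrow> u (x + c *\<^sub>R \<xi>) = w (x + c *\<^sub>R \<xi>)" if "c \<noteq> 0" for c
    by (rule AE_lborel_affine[OF u_w that])
  from this[of \<epsilon>] this[of "- \<epsilon>"] show ?thesis
    using \<epsilon>_pos by (auto elim!: eventually_elim2 simp: in_enl[of _ \<epsilon>] in_enl[of _ "- \<epsilon>", simplified])
qed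

lemma D_subset_enlargement: "x \<in> D \<Longrightarrow> x \<in> enlargement D \<alpha>"
  unfolding enlargement_def using \<epsilon>_pos \<epsilon>_less by simp

lemma integral_cball_kernel:
  assumes [measurable]: "g \<in> borel_measurable borel"
    and h: "AE \<xi> in lborel. norm \<xi> \<le> 1 \<longrightarrow> h \<xi> = c * (k \<xi> * g \<xi>)"
  shows "(\<integral>\<xi>. h \<xi> \<partial>lebesgue_on (cball 0 1)) = c * (LBINT \<xi>. k \<xi> * g \<xi>)"
proof -
  have "cball (0::plane) 1 \<in> sets borel" by (rule borel_closed) simp
  then have "(\<integral>\<xi>. h \<xi> \<partial>lebesgue_on (cball 0 1)) = (LBINT \<xi>. c * (k \<xi> * g \<xi>))"
    by (rule integral_lebesgue_on_eq_lborel) (use h k_support in auto)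
  then show ?thesis by simp
qed

text \<open>Restricting the base point to \<open>D\<close> discards nonnegative contributions only,
  and the powers \<epsilon>^2, \<epsilon>^-3 and the \<epsilon> from \<open>BE\<close> multiply to
  1.\<close>

lemma PD_le_energy: "PD D J f\<^sub>0 \<epsilon> u \<le> energy w"
proof -
  let ?W = "\<lambda>x. \<integral>\<xi>. pd_W J f\<^sub>0 \<epsilon> (u (x + \<epsilon> *\<^sub>R \<xi>) - u x) \<xi> \<partial>lebesgue_on (cball 0 1)"
  define B where "B x = (LBINT \<xi>. k \<xi> * bond (w (x + \<epsilon> *\<^sub>R \<xi>) - w x) \<xi>)" for x
  have [measurable]: "B \<in> borel_measurable borel" unfolding B_def[abs_def] by measurable
  have Bi: "integrable lborel B" using lborel_pair.integrable_fst'[OF energy_integrable[OF w]] unfolding B_def[abs_def] by simp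
  have BE: "(LBINT x. B x) = \<epsilon> * energy w"
    using lborel_pair.integral_fst'[OF energy_integrable[OF w]] \<epsilon>_pos unfolding B_def energy_def by simp
  have B0: "0 \<le> B x" for x unfolding B_def bond_def using k_bounds f_bounds[OF bond_arg_nonneg]
    by (intro integral_nonneg_AE AE_I2 mult_nonneg_nonneg) auto
  have inner: "?W x = 1 / \<epsilon>^3 * B x"
    if x: "x \<in> D" "u x = w x" for x
    unfolding B_def
  proof (rule integral_cball_kernel)
    show "AE \<xi> in lborel. norm \<xi> \<le> 1 \<longrightarrow> pd_W J f\<^sub>0 \<epsilon> (u (x + \<epsilon> *\<^sub>R \<xi>) - u x) \<xi> = 1 / \<epsilon>^3 * (k \<xi> * bond (w (x + \<epsilon> *\<^sub>R \<xi>) - w x) \<xi>)"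
      using AE_neighbours[OF x(1)] k_J by eventually_elim (simp add: pd_W_eq x(2))
  qed measurable
  have "(\<integral>x. ?W x \<partial>lebesgue_on D)
      = (LBINT x. indicator D x *\<^sub>R (1 / \<epsilon>^3 * B x))"
  proof (rule integral_lebesgue_on_eq_lborel[OF D_borel])
    show "AE x in lborel. x \<in> D \<longrightarrow> ?W x = indicator D x *\<^sub>R (1 / \<epsilon>^3 * B x)"
      using u_w by eventually_elim (use D_subset_enlargement inner in auto)
  qed (simp, measurable)
  also have "\<dots> \<le> (LBINT x. 1 / \<epsilon>^3 * B x)"
  proof (rule integral_mono)
    show "integrable lborel (\<lambda>x. indicator D x *\<^sub>R (1 / \<epsilon>^3 * B x))"
      by (rule Bochner_Integration.integrable_bound[OF integrable_mult_right[OF Bi, of "1 / \<epsilon>^3"]]) (auto simp: indicator_def)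
    show "indicator D x *\<^sub>R (1 / \<epsilon>^3 * B x) \<le> 1 / \<epsilon>^3 * B x" for x
      using B0[of x] \<epsilon>_pos by (auto simp: indicator_def)
  qed (use Bi in auto)
  also have "\<dots> = 1 / \<epsilon>^3 * (\<epsilon> * energy w)" using BE by simp
  finally have "\<epsilon>\<^sup>2 * (\<integral>x. ?W x \<partial>lebesgue_on D)
      \<le> \<epsilon>\<^sup>2 * (1 / \<epsilon>^3 * (\<epsilon> * energy w))"
    by (rule mult_left_mono) simp
  also have "\<dots> = energy w" using \<epsilon>_pos by (simp add: power2_eq_square power3_eq_cube)
  finally show ?thesis unfolding PD_def .
qed

lemma grad_PD_eq: "AE x in lborel. x \<in> D \<longrightarrow> grad_PD J f\<^sub>0 \<epsilon> u x = grad w x"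
  using u_w
proof eventually_elim
  case (elim x)
  show ?case
  proof
    assume x: "x \<in> D"
    then have ux: "u x = w x" using elim D_subset_enlargement by simp
    let ?h = "\<lambda>\<xi>. back_quot \<epsilon> \<xi> (\<lambda>y. deriv (\<lambda>\<eta>. pd_W J f\<^sub>0 \<epsilon> \<eta> \<xi>) (u (y + \<epsilon> *\<^sub>R \<xi>) - u y)) x * norm \<xi>"
    let ?g = "\<lambda>\<xi>. dbond (w x - w (x - \<epsilon> *\<^sub>R \<xi>)) \<xi> - dbond (w (x + \<epsilon> *\<^sub>R \<xi>) - w x) \<xi>"
    have "(\<integral>\<xi>. ?h \<xi> \<partial>lebesgue_on (cball 0 1)) = 1 / \<epsilon>^4 * (LBINT \<xi>. k \<xi> * ?g \<xi>)"
    proof (rule integral_cball_kernel)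
      \<comment> \<open>Off the origin the weight |\<xi>| cancels the |\<xi>| in the denominator of
        the difference quotient.\<close>
      have "AE \<xi> in lborel. \<xi> \<noteq> (0 :: plane)" by (rule AE_lborel_singleton)
      then show "AE \<xi> in lborel. norm \<xi> \<le> 1 \<longrightarrow> ?h \<xi> = 1 / \<epsilon>^4 * (k \<xi> * ?g \<xi>)"
        using AE_neighbours[OF x] k_J
      proof eventually_elim
        case (elim \<xi>)
        show ?case
        proof
          assume n: "norm \<xi> \<le> 1"
          have "?h \<xi> = (J (norm \<xi>) / \<epsilon>^3 * dbond (w x - w (x - \<epsilon> *\<^sub>R \<xi>)) \<xi> - J (norm \<xi>) / \<epsilon>^3 * dbond (w (x + \<epsilon> *\<^sub>R \<xi>) - w x) \<xi>) / \<epsilon>"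
            unfolding back_quot_def deriv_pd_W using elim n ux by simp
          also have "\<dots> = 1 / \<epsilon>^4 * (J (norm \<xi>) * ?g \<xi>)"
            using \<epsilon>_pos by (simp add: field_simps power_def numeral_eq_Suc)
          finally show "?h \<xi> = 1 / \<epsilon>^4 * (k \<xi> * ?g \<xi>)" using elim n by simp
        qed
      qed
    qed measurable
    then show "grad_PD J f\<^sub>0 \<epsilon> u x = grad w x"
      unfolding grad_PD_def grad_def using \<epsilon>_pos by (simp add: field_simps power_def numeral_eq_Suc)
  qed
qed

end

end

text \<open>A concave function that stays nonnegative on the half-line has no negative slope, so it
  increases to its limit and is bounded by it. The chord from 0 separates the slopes: s f'(s) <=
  f(s) <= f'(0) s.\<close>

lemma concave_potential:
  fixes f f' :: "real \<Rightarrow> real"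
  assumes pos: "\<And>r. r > 0 \<Longrightarrow> f r > 0" and conc: "concave_on {0..} f"
    and deriv: "\<And>s. 0 \<le> s \<Longrightarrow> (f has_real_derivative f' s) (at s within {0..})"
    and quot: "((\<lambda>r. f r / r) \<longlongrightarrow> l) (at_right 0)" and lim: "(f \<longlongrightarrow> f_inf) at_top"
  shows "f 0 = 0" and "\<And>s. 0 \<le> s \<Longrightarrow> 0 \<le> f s \<and> f s \<le> f_inf"
    and "\<And>s t. 0 \<le> s \<Longrightarrow> 0 \<le> t \<Longrightarrow> f t - f s \<le> f' s * (t - s)"
    and "\<And>s. 0 \<le> s \<Longrightarrow> 0 \<le> f' s \<and> f' s \<le> f' 0"
proof -
  have cont: "continuous_on {0..} f" using deriv by (auto simp: continuous_on_eq_continuous_within intro!: DERIV_continuous)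
  have Ici: "at (0::real) within {0..} = at_right 0" by (simp add: at_within_Ici_at_right)
  show f0: "f 0 = 0"
  proof (rule tendsto_unique[of "at_right 0" f])
    show "(f \<longlongrightarrow> f 0) (at_right 0)" using cont unfolding continuous_on_def Ici[symmetric] by auto
    have "((\<lambda>r. f r / r * r) \<longlongrightarrow> l * 0) (at_right 0)" by (intro tendsto_mult quot tendsto_ident_at)
    moreover have "\<forall>\<^sub>F r in at_right 0. f r / r * r = f r" by (rule eventually_mono[OF eventually_at_right_less[of 0]]) simp
    ultimately show "(f \<longlongrightarrow> 0) (at_right 0)" by (auto dest: filterlim_cong[THEN iffD1, rotated -1])
  qed simp
  have nonneg: "0 \<le> f s" if "0 \<le> s" for s using pos[of s] f0 that by (cases "s = 0") auto
  show tangent: "f t - f s \<le> f' s * (t - s)" if st: "0 \<le> s" "0 \<le> t" for s t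
  proof -
    let ?p = "\<lambda>h. s + h * (t - s)"
    have p: "?p h = (1 - h) * s + h * t" for h by (simp add: algebra_simps)
    have "(?p has_real_derivative (t - s)) (at 0 within {0..1})" by (auto intro!: derivative_eq_intros)
    moreover have "(f has_real_derivative f' s) (at (?p 0) within ?p ` {0..1})"
      by (simp, rule has_field_derivative_subset[OF deriv[OF st(1)]]) (use st in \<open>auto simp: p\<close>)
    ultimately have "((f \<circ> ?p) has_real_derivative f' s * (t - s)) (at 0 within {0..1})" by (intro DERIV_image_chain)
    then have "((\<lambda>h. (f (?p h) - f s) / h) \<longlongrightarrow> f' s * (t - s)) (at_right 0)"
      by (simp add: has_field_derivative_iff at_within_Icc_at_right)
    then show ?thesis
    proof (rule tendsto_lowerbound)
      have "\<forall>\<^sub>F h in at_right 0. h < (1::real)" by (rule eventually_at_right_real[of 0 1, THEN eventually_mono]) auto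
      with eventually_at_right_less[of 0] show "\<forall>\<^sub>F h in at_right 0. f t - f s \<le> (f (?p h) - f s) / h"
      proof eventually_elim
        case (elim h)
        have "(1 - h) * f s + h * f t \<le> f ((1 - h) * s + h * t)" using concave_onD[OF conc, of h s t] st elim by simp
        then have "h * (f t - f s) \<le> f (?p h) - f s" unfolding p by (simp add: algebra_simps)
        then show ?case using elim by (simp add: field_simps)
      qed
    qed simp
  qed
  have f'0: "0 \<le> f' s" if "0 \<le> s" for s
  proof (rule ccontr)
    assume "\<not> 0 \<le> f' s"
    then have n: "f' s < 0" by simp
    \<comment> \<open>At this point the tangent at \<open>s\<close> takes the value -1.\<close>
    define t where "t = s + (f s + 1) / (- f' s)"
    have t: "s < t" unfolding t_def using n nonneg[OF that] by (simp add: divide_pos_neg)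
    have "f t - f s \<le> f' s * (t - s)" using tangent[of s t] that t by simp
    also have "\<dots> = - (f s + 1)" unfolding t_def using n by simp
    finally show False using nonneg[of t] t that by simp
  qed
  have mono: "f s \<le> f t" if "0 \<le> s" "s \<le> t" for s t
  proof -
    have "f s - f t \<le> f' t * (s - t)" using tangent[of t s] that by simp
    also have "\<dots> \<le> 0" using f'0[of t] that by (intro mult_nonneg_nonpos) auto
    finally show ?thesis by simp
  qed
  show "0 \<le> f s \<and> f s \<le> f_inf" if "0 \<le> s" for s
  proof
    show "f s \<le> f_inf"
      by (rule tendsto_lowerbound[OF lim]) (use mono[OF that] in \<open>auto intro: eventually_mono[OF eventually_ge_at_top[of s]]\<close>)
  qed (rule nonneg[OF that])
  show "0 \<le> f' s \<and> f' s \<le> f' 0" if "0 \<le> s" for s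
  proof (cases "s = 0")
    case False
    then have "s > 0" using that by simp
    have "f' s * s \<le> f s" using tangent[of s 0] that f0 by simp
    also have "\<dots> \<le> f' 0 * s" using tangent[of 0 s] that f0 by simp
    finally show ?thesis using f'0[OF that] \<open>s > 0\<close> by simp
  qed (use f'0 in auto)
qed

text \<open>The SBV data live on \<open>D\<close> and its restricted sigma-algebra, while the
  duality argument concerns Borel objects on the plane. The function and its approximate gradient
  are therefore replaced by representatives, and the jump measure is pushed forward under the
  inclusion, its direction being extended by 0.\<close>

lemma SBV_difference_bound:
  assumes D: "open D" "bounded D" "convex D" and sbv: "SBV D u"
    and w: "w \<in> borel_measurable borel" "\<And>x. x \<notin> D \<Longrightarrow> w x = 0" "AE x in lborel. x \<in> D \<longrightarrow> u x = w x"
    and grad: "(\<integral>\<^sup>+x. ennreal ((norm (approx_grad u x))\<^sup>2) \<partial>lebesgue_on D) < \<infinity>"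
    and jump: "hausdorff1 (jump_set D u) < \<infinity>"
  obtains C where "0 \<le> C" "\<And>v. v \<noteq> 0 \<Longrightarrow>
    (\<integral>\<^sup>+x. ennreal (indicator {x \<in> D. x + v \<in> D} x * min 1 ((w (x + v) - w x)\<^sup>2 / norm v)) \<partial>lborel) \<le> ennreal (C * norm v)"
proof -
  have Db: "D \<in> sets borel" using D by simp
  have u: "integrable (lebesgue_on D) u" and ag: "integrable (lebesgue_on D) (approx_grad u)" using sbv unfolding SBV_def by auto
  obtain m \<sigma> where m: "finite_measure m" "sets m = sets (restrict_space borel D)"
      "\<sigma> \<in> borel_measurable m" "AE x in m. norm (\<sigma> x) = 1" "AE x in m. x \<in> jump_set D u"
    and ibp: "\<And>\<phi> g. test_function D \<phi> g \<Longrightarrow>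
      (\<integral>x. u x *\<^sub>R g x \<partial>lebesgue_on D) = - ((\<integral>x. \<phi> x *\<^sub>R approx_grad u x \<partial>lebesgue_on D) + (\<integral>x. \<phi> x *\<^sub>R \<sigma> x \<partial>m))"
    using sbv unfolding SBV_def by blast
  interpret m: finite_measure m by fact
  obtain G where G: "G \<in> borel_measurable borel" "\<And>x. x \<notin> D \<Longrightarrow> G x = 0" "AE x in lborel. x \<in> D \<longrightarrow> approx_grad u x = G x"
    using borel_representative[OF Db borel_measurable_integrable[OF ag]] by blast
  have wi: "integrable lborel w" by (rule iffD1[OF integrable_lebesgue_on_iff_lborel[OF Db w(2,1,3)] u])
  have Gi: "integrable lborel G" by (rule iffD1[OF integrable_lebesgue_on_iff_lborel[OF Db G(2,1,3)] ag])
  have G2: "integrable lborel (\<lambda>x. (norm (G x))\<^sup>2)"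
  proof -
    have ae: "AE x in lborel. x \<in> D \<longrightarrow> (norm (approx_grad u x))\<^sup>2 = (norm (G x))\<^sup>2"
      using G(3) by eventually_elim auto
    have mb: "(\<lambda>x. (norm (G x))\<^sup>2) \<in> borel_measurable borel" using G(1) by measurable
    have "integrable (lebesgue_on D) (\<lambda>x. (norm (approx_grad u x))\<^sup>2)"
      using grad measurable_lebesgue_on_of_lborel[OF Db mb ae] by (simp add: integrable_iff_bounded)
    then show ?thesis using integrable_lebesgue_on_iff_lborel[OF Db _ mb ae] G(2) by simp
  qed
  have sp: "space m = D" using sets_eq_imp_space_eq[OF m(2)] by (simp add: space_restrict_space)
  define m' where "m' = distr m borel (\<lambda>x. x)"
  define \<sigma>' where "\<sigma>' x = (if x \<in> D then \<sigma> x else 0)" for x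
  have idm: "(\<lambda>x. x) \<in> measurable m borel"
    using measurable_restrict_space1[OF measurable_ident, of borel D] m(2) by (simp add: id_def cong: measurable_cong_sets)
  have fm': "finite_measure m'" unfolding m'_def by (rule m.finite_measure_distr[OF idm])
  have sm': "sets m' = sets borel" unfolding m'_def by simp
  have \<sigma>m: "\<sigma>' \<in> borel_measurable borel"
  proof -
    have "\<sigma> \<in> borel_measurable (restrict_space borel D)" using m(3) m(2) by (simp cong: measurable_cong_sets)
    then have "(\<lambda>x. indicator D x *\<^sub>R \<sigma> x) \<in> borel_measurable borel"
      using Db by (subst (asm) borel_measurable_restrict_space_iff) auto
    moreover have "(\<lambda>x. indicator D x *\<^sub>R \<sigma> x) = \<sigma>'" by (auto simp: \<sigma>'_def)
    ultimately show ?thesis by simp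
  qed
  have AEm': "AE x in m'. Q x" if Q: "AE x in m. Q x" for Q
  proof -
    obtain N where N: "N \<in> null_sets m" "{x \<in> space m. \<not> Q x} \<subseteq> N" using Q unfolding eventually_ae_filter by blast
    have ND: "N \<subseteq> D" using sets.sets_into_space[of N m] N(1) sp by auto
    have Nb: "N \<in> sets borel" using N(1) m(2) Db by (auto simp: null_sets_def sets_restrict_space)
    have "(\<lambda>x. x) -` (N \<union> (UNIV - D)) \<inter> space m = N" using ND sp by auto
    then have "emeasure m' (N \<union> (UNIV - D)) = emeasure m N" unfolding m'_def using Nb Db idm by (subst emeasure_distr) auto
    then have "N \<union> (UNIV - D) \<in> null_sets m'" using N(1) Nb Db sm' by (auto simp: null_sets_def)
    moreover have "{x \<in> space m'. \<not> Q x} \<subseteq> N \<union> (UNIV - D)" using N(2) sp by auto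
    ultimately show ?thesis unfolding eventually_ae_filter by blast
  qed
  have ibp': "(LBINT x. w x *\<^sub>R g x) = - ((LBINT x. \<phi> x *\<^sub>R G x) + (\<integral>x. \<phi> x *\<^sub>R \<sigma>' x \<partial>m'))"
    if tf: "test_function D \<phi> g" for \<phi> g
  proof -
    have \<phi>m: "\<phi> \<in> borel_measurable borel" using test_function_continuous[OF tf] by (rule borel_measurable_continuous_onI)
    have gm: "g \<in> borel_measurable borel" using tf unfolding test_function_def by (auto intro: borel_measurable_continuous_onI)
    have 1: "(\<integral>x. u x *\<^sub>R g x \<partial>lebesgue_on D) = (LBINT x. w x *\<^sub>R g x)"
      by (rule integral_lebesgue_on_eq_lborel[OF Db])
        (use w(1,2) gm in simp, use w(1) gm in measurable, use w(3) in eventually_elim, simp)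
    have 2: "(\<integral>x. \<phi> x *\<^sub>R approx_grad u x \<partial>lebesgue_on D) = (LBINT x. \<phi> x *\<^sub>R G x)"
      by (rule integral_lebesgue_on_eq_lborel[OF Db])
        (use G(2) in simp, use G(1) \<phi>m in measurable, use G(3) in eventually_elim, simp)
    have "(\<integral>x. \<phi> x *\<^sub>R \<sigma>' x \<partial>m') = (\<integral>x. \<phi> x *\<^sub>R \<sigma>' x \<partial>m)"
      unfolding m'_def using idm \<phi>m \<sigma>m by (subst integral_distr) auto
    also have "\<dots> = (\<integral>x. \<phi> x *\<^sub>R \<sigma> x \<partial>m)"
      using sp by (intro Bochner_Integration.integral_cong) (auto simp: \<sigma>'_def)
    finally show ?thesis using ibp[OF tf] 1 2 by simp
  qed
  have a1: "AE x in m'. x \<in> D" by (rule AEm') (use sp in auto)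
  have a2: "AE x in m'. x \<in> jump_set D u" by (rule AEm'[OF m(5)])
  have a3: "AE x in m'. norm (\<sigma>' x) \<le> 1" by (rule AEm') (use m(4) in eventually_elim, auto simp: \<sigma>'_def)
  have \<sigma>m': "\<sigma>' \<in> borel_measurable m'" using \<sigma>m sm' by (simp cong: measurable_cong_sets)
  show ?thesis
  proof
    show "0 \<le> 8 * pi * (enn2real (hausdorff1 (jump_set D u)) + 1) + 2 * (LBINT x. (norm (G x))\<^sup>2) + 3"
      by (intro add_nonneg_nonneg mult_nonneg_nonneg) (auto simp: integral_nonneg_AE)
  qed (rule truncated_difference_bound[OF D(1,3) wi Gi G2 fm' sm' a1 a2 jump \<sigma>m' a3 ibp'])
qed

text \<open>One Borel function that is zero off \<open>D\<close> serves on the whole enlargement,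
  because elements of the space vanish on the part of it outside \<open>D\<close>. This covers every
  point that bonds starting in \<open>D\<close> can reach.\<close>

lemma L2_0_representative:
  assumes D: "open D" and \<alpha>: "0 < \<alpha>" and u: "L2_0 D \<alpha> u"
  obtains w where "w \<in> borel_measurable borel" "\<And>x. x \<notin> D \<Longrightarrow> w x = 0" "AE x in lborel. x \<in> enlargement D \<alpha> \<longrightarrow> u x = w x"
proof -
  have enl: "open (enlargement D \<alpha>)"
  proof -
    have "enlargement D \<alpha> = (\<lambda>x. infdist x D) -` {..<\<alpha>}" unfolding enlargement_def by auto
    then show ?thesis by (auto intro!: open_vimage continuous_intros)
  qed
  have um: "u \<in> borel_measurable (lebesgue_on D)" using u unfolding L2_0_def L2_on_def by simp
  obtain w where w: "w \<in> borel_measurable borel" "\<And>x. x \<notin> D \<Longrightarrow> w x = 0" "AE x in lborel. x \<in> D \<longrightarrow> u x = w x"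
    using borel_representative[OF _ um] D by auto
  have "AE x in lborel. x \<in> enlargement D \<alpha> - D \<longrightarrow> u x = 0"
    using u enl D unfolding L2_0_def by (subst (asm) AE_lebesgue_on_iff_lborel)
      (auto intro!: sets_completionI_sets)
  with w(3) have "AE x in lborel. x \<in> enlargement D \<alpha> \<longrightarrow> u x = w x" by eventually_elim (use w(2) in auto)
  with w show ?thesis using that by blast
qed

lemma C1_L2_norm_bounded:
  assumes "C1_L2 (L2_on D) D T b b'"
  obtains \<beta> where "\<And>t. t \<in> {0..T} \<Longrightarrow> norm2 (lebesgue_on D) (b t) \<le> \<beta>"
proof -
  let ?M = "lebesgue_on D"
  have sq: "square_integrable ?M (b t)" "square_integrable ?M (b' t)" if "t \<in> {0..T}" for t
    using assms that unfolding C1_L2_def L2_on_def square_integrable_def by auto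
  have "continuous_on {0..T} (\<lambda>t. norm2 ?M (b t))" unfolding continuous_on_def
  proof
    fix t assume t: "t \<in> {0..T}"
    have "((\<lambda>s. norm2 ?M (\<lambda>x. (b s x - b t x) / (s - t) - b' t x)) \<longlongrightarrow> 0) (at t within {0..T})"
      using assms t unfolding C1_L2_def L2_norm_def norm2_def by auto
    from norm2_tendsto[OF sq(1) t norm2_tendsto_of_diff_quotient[OF sq(1) sq(2)[OF t] t this]]
    show "((\<lambda>s. norm2 ?M (b s)) \<longlongrightarrow> norm2 ?M (b t)) (at t within {0..T})" .
  qed
  then have "bounded ((\<lambda>t. norm2 ?M (b t)) ` {0..T})" by (intro compact_imp_bounded compact_continuous_image compact_Icc)
  then obtain \<beta> where "\<forall>y\<in>(\<lambda>t. norm2 ?M (b t)) ` {0..T}. norm y \<le> \<beta>" unfolding bounded_iff by blast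
  then show ?thesis by (intro that[of \<beta>]) (auto dest!: bspec simp: abs_le_iff)
qed

text \<open>The increment vanishes almost everywhere, so both the linear and the quadratic term of
  \<open>energy_diff_le\<close> are 0; null sets of pairs of points need not be discussed.\<close>

lemma (in bond_energy) energy_cong_AE:
  assumes w: "displacement w" and z: "displacement z" and eq: "AE x in lborel. z x = w x"
  shows "energy z \<le> energy w"
proof -
  have [measurable]: "w \<in> borel_measurable borel" "z \<in> borel_measurable borel" using w z unfolding displacement_def by auto
  have 1: "(LBINT x. grad w x * (z x - w x)) = 0" by (rule integral_eq_zero_AE) (use eq in eventually_elim, simp)
  have ae2: "AE x in lborel. (z x - w x)\<^sup>2 = 0" using eq by eventually_elim simp
  have 2: "(LBINT x. (z x - w x)\<^sup>2) = 0" by (rule integral_eq_zero_AE[OF ae2])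
  have "integrable lborel (\<lambda>x. (z x - w x)\<^sup>2) \<longleftrightarrow> integrable lborel (\<lambda>x :: plane. 0 :: real)"
    by (rule integrable_cong_AE) (use ae2 in auto)
  then show ?thesis using energy_diff_le[OF w z] 1 2 by simp
qed

section \<open>The uniform constant and the estimate along the evolutions\<close>

theorem theorem1:
  fixes D :: "(real^2) set" and J f :: "real \<Rightarrow> real"
    and \<alpha> \<rho> M f'0 f_inf r_bar T \<mu> Gc :: real
    and u0 v0 :: "real^2 \<Rightarrow> real" and b :: "real \<Rightarrow> real^2 \<Rightarrow> real"
  assumes "open D" and "D \<noteq> {}" and "bounded D" and "convex D"
    and "\<alpha> > 0" and "\<rho> > 0"
    and "J \<in> borel_measurable (lebesgue_on {0..})"
    and "\<And>r. 0 \<le> r \<Longrightarrow> r \<le> 1 \<Longrightarrow> 0 \<le> J r \<and> J r < M"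
    and "\<And>r. r > 1 \<Longrightarrow> J r = 0"
    and "\<And>r. r > 0 \<Longrightarrow> f r > 0"
    and "smooth_on {0..} f" and "concave_on {0..} f"
    and "((\<lambda>r. f r / r) \<longlongrightarrow> f'0) (at_right 0)"
    and "(f has_real_derivative f'0) (at 0 within {0..})" and "f'0 > 0"
    and "(f \<longlongrightarrow> f_inf) at_top"
    and "r_bar > 0"
    and "convex_on {0..r_bar} (\<lambda>r. f (r\<^sup>2))" and "concave_on {r_bar..} (\<lambda>r. f (r\<^sup>2))"
    and "\<mu> = pi * f'0 * (\<integral>r. r\<^sup>2 * J r \<partial>lebesgue_on {0..1})"
    and "Gc = 2 * pi * f_inf * (\<integral>r. r\<^sup>2 * J r \<partial>lebesgue_on {0..1})"
    and "LEFM_data D \<alpha> \<mu> Gc u0 v0"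
    and "T > 0"
    and "\<exists>b'. C1_L2 (L2_on D) D T b b'"
  shows "\<exists>C>0. \<forall>(\<epsilon> :: nat \<Rightarrow> real) (u :: nat \<Rightarrow> real \<Rightarrow> real^2 \<Rightarrow> real) ut.
           (\<forall>k. 0 < \<epsilon> k \<and> \<epsilon> k < \<alpha>) \<and> decseq \<epsilon> \<and> \<epsilon> \<longlonglongrightarrow> 0 \<and>
           (\<forall>k. peridynamic_evolution D \<alpha> J f \<rho> b u0 v0 T (\<epsilon> k) (u k) (ut k)) \<longrightarrow>
           (\<forall>k. (SUP t\<in>{0..T}. ereal (PD D J f (\<epsilon> k) (u k t) + \<rho> / 2 * (L2_norm D (ut k t))\<^sup>2)) \<le> ereal C)"
proof -
  note D = assms(1-4) and \<alpha> = assms(5) and \<rho> = assms(6)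
  let ?M = "lebesgue_on D"
  have Db: "D \<in> sets borel" "emeasure lborel D < \<infinity>" using D emeasure_bounded_finite[of D] by auto
  obtain F :: "nat \<Rightarrow> real \<Rightarrow> real" where F: "F 0 = f"
      "\<And>n x. 0 \<le> x \<Longrightarrow> (F n has_real_derivative F (Suc n) x) (at x within {0..})"
    using assms(11) unfolding smooth_on_def by auto
  have fd: "(f has_real_derivative F 1 s) (at s within {0..})" if "0 \<le> s" for s using F(2)[OF that, of 0] F(1) by simp
  note pot = concave_potential[OF assms(10) assms(12) fd assms(13) assms(16)]
  have f_inf: "0 < f_inf" using pot(2)[of 1] assms(10)[of 1] by simp
  have Fm: "(\<lambda>s. F n (max 0 s)) \<in> borel_measurable borel" for n
  proof (rule borel_measurable_continuous_onI)
    have "continuous_on {0..} (F n)" using F(2) by (auto simp: continuous_on_eq_continuous_within intro!: DERIV_continuous)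
    then show "continuous_on UNIV (\<lambda>s. F n (max 0 s))" by (rule continuous_on_compose2) (auto intro!: continuous_intros)
  qed
  have fm: "(\<lambda>s. f (max 0 s)) \<in> borel_measurable borel" using Fm[of 0] F(1) by simp
  obtain k :: "plane \<Rightarrow> real" where k: "k \<in> borel_measurable borel" "\<And>\<xi>. 0 \<le> k \<xi> \<and> k \<xi> \<le> M" "\<And>\<xi>. norm \<xi> > 1 \<Longrightarrow> k \<xi> = 0"
    "AE \<xi> in lborel. norm \<xi> \<le> 1 \<longrightarrow> k \<xi> = J (norm \<xi>)"
    "0 < (\<integral>r. r\<^sup>2 * J r \<partial>lebesgue_on {0..1}) \<or> k = (\<lambda>_. 0)"
    using radial_kernel[OF assms(7) assms(8)] by blast
  \<comment> \<open>Composition with \<open>max 0\<close> extends the potential and its derivative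
    to Borel functions on the line. Among these instances only the horizon \<open>e\<close>
    varies.\<close>
  have bonds: "bond_energy (\<lambda>s. f (max 0 s)) (\<lambda>s. F 1 (max 0 s)) k (F 1 0) f_inf M e D" if "0 < e" for e
    using that k(1-3) Db pot fm Fm[of 1] by unfold_locales (auto simp: max_def)
  have data: "L2_0 D \<alpha> u0" "L2_0 D \<alpha> v0" "SBV D u0"
    "(\<integral>\<^sup>+x. ennreal (\<mu> * (norm (approx_grad u0 x))\<^sup>2) \<partial>?M) + ennreal Gc * hausdorff1 (jump_set D u0) < \<infinity>"
    using assms(22) unfolding LEFM_data_def by auto
  obtain w0 where w0: "w0 \<in> borel_measurable borel" "\<And>x. x \<notin> D \<Longrightarrow> w0 x = 0" "AE x in lborel. x \<in> enlargement D \<alpha> \<longrightarrow> u0 x = w0 x"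
    using L2_0_representative[OF D(1) \<alpha> data(1)] by blast
  have Denl: "D \<subseteq> enlargement D \<alpha>" unfolding enlargement_def using \<alpha> by auto
  have w0D: "AE x in lborel. x \<in> D \<longrightarrow> u0 x = w0 x" using w0(3) by eventually_elim (use Denl in auto)
  \<comment> \<open>A bound on the initial energy for all horizons at once. Unless the kernel
    vanishes, \<mu> and Gc are positive, and the finite LEFM energy controls the gradient and the
    jump set separately.\<close>
  obtain CE where CE: "0 \<le> CE" "\<And>e. 0 < e \<Longrightarrow> bond_energy.energy (\<lambda>s. f (max 0 s)) k e w0 \<le> CE"
  proof (cases "k = (\<lambda>_. 0)")
    case True
    have "bond_energy.energy (\<lambda>s. f (max 0 s)) k e w0 \<le> 0" if "0 < e" for e
      unfolding bond_energy.energy_def[OF bonds[OF that]] by (simp add: True)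
    then show ?thesis by (intro that[of 0]) simp_all
  next
    case False
    then have I: "0 < (\<integral>r. r\<^sup>2 * J r \<partial>lebesgue_on {0..1})" using k(5) by blast
    have \<mu>: "0 < \<mu>" and Gc: "0 < Gc" using I assms(15,20,21) f_inf by auto
    have "hausdorff1 (jump_set D u0) < \<infinity>"
    proof (rule ccontr)
      assume "\<not> hausdorff1 (jump_set D u0) < \<infinity>"
      then have "hausdorff1 (jump_set D u0) = \<infinity>" by (simp add: less_top[symmetric])
      then show False using data(4) Gc by (simp add: ennreal_mult_top)
    qed
    moreover have "(\<integral>\<^sup>+x. ennreal ((norm (approx_grad u0 x))\<^sup>2) \<partial>?M) < \<infinity>"
    proof -
      have [measurable]: "approx_grad u0 \<in> borel_measurable ?M" using data(3) unfolding SBV_def by auto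
      have "(\<integral>\<^sup>+x. ennreal (\<mu> * (norm (approx_grad u0 x))\<^sup>2) \<partial>?M) = ennreal \<mu> * (\<integral>\<^sup>+x. ennreal ((norm (approx_grad u0 x))\<^sup>2) \<partial>?M)"
        using \<mu> by (subst nn_integral_cmult[symmetric]) (auto simp: ennreal_mult)
      then show ?thesis using data(4) \<mu> by (auto simp: ennreal_mult_less_top)
    qed
    ultimately obtain CI where CI: "0 \<le> CI" "\<And>v. v \<noteq> 0 \<Longrightarrow>
      (\<integral>\<^sup>+x. ennreal (indicator {x \<in> D. x + v \<in> D} x * min 1 ((w0 (x + v) - w0 x)\<^sup>2 / norm v)) \<partial>lborel) \<le> ennreal (CI * norm v)"
      using SBV_difference_bound[OF D(1,3,4) data(3) w0(1,2) w0D] by blast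
    obtain CB where CB: "0 \<le> CB" "\<And>v. measure lborel {x \<in> D. x + v \<notin> D} \<le> CB * norm v"
      using convex_boundary_layer[OF D] by blast
    show ?thesis
    proof
      show "0 \<le> (F 1 0 + f_inf) * (CI + 2 * CB) * (LBINT \<xi>. k \<xi>)" using CI(1) CB(1) f_inf pot(4)[of 0] k(2)
        by (intro mult_nonneg_nonneg integral_nonneg_AE AE_I2 add_nonneg_nonneg) auto
      fix e :: real assume "0 < e"
      then interpret bond_energy "\<lambda>s. f (max 0 s)" "\<lambda>s. F 1 (max 0 s)" k "F 1 0" f_inf M e D by (rule bonds)
      show "energy w0 \<le> (F 1 0 + f_inf) * (CI + 2 * CB) * (LBINT \<xi>. k \<xi>)"
        by (rule energy_le_of_difference_bound) (use w0 D CI CB in \<open>auto simp: displacement_def\<close>)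
    qed
  qed
  obtain b' where b': "C1_L2 (L2_on D) D T b b'" using assms(24) by blast
  obtain \<beta> where \<beta>: "\<And>t. t \<in> {0..T} \<Longrightarrow> norm2 ?M (b t) \<le> \<beta>" using C1_L2_norm_bounded[OF b'] by blast
  \<comment> \<open>Load, initial energy and initial velocity, times the growth factor over [0, T];
    every ingredient is independent of the horizon. The added 1 makes the constant positive for zero
    data as well.\<close>
  define C where "C = (\<beta>\<^sup>2 / (2 * \<rho>) + (CE + \<rho> / 2 * (norm2 ?M v0)\<^sup>2)) * exp (2 * T) + 1"
  have Cpos: "0 < C" unfolding C_def using \<rho> CE(1) by (intro add_nonneg_pos mult_nonneg_nonneg add_nonneg_nonneg) auto
  have key: "PD D J f e (u t) + \<rho> / 2 * (L2_norm D (ut t))\<^sup>2 \<le> C"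
    if e: "0 < e" "e < \<alpha>" and evo: "peridynamic_evolution D \<alpha> J f \<rho> b u0 v0 T e u ut" and t: "t \<in> {0..T}"
    for e u ut t
  proof -
    interpret bond_energy "\<lambda>s. f (max 0 s)" "\<lambda>s. F 1 (max 0 s)" k "F 1 0" f_inf M e D by (rule bonds[OF e(1)])
    obtain utt where C1: "C1_L2 (L2_0 D \<alpha>) D T u ut" "C1_L2 (L2_0 D \<alpha>) D T ut utt"
      and eq: "\<And>t. t \<in> {0<..T} \<Longrightarrow> AE x in ?M. \<rho> * utt t x = - grad_PD J f e (u t) x + b t x"
      and init: "AE x in ?M. u 0 x = u0 x" "AE x in ?M. ut 0 x = v0 x"
      using evo unfolding peridynamic_evolution_def by blast
    \<comment> \<open>Representatives are chosen time by time; the energy estimate compares them in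
      pairs, through integrals that do not depend on the choice.\<close>
    have "\<forall>t\<in>{0..T}. \<exists>w. w \<in> borel_measurable borel \<and> (\<forall>x. x \<notin> D \<longrightarrow> w x = 0) \<and> (AE x in lborel. x \<in> enlargement D \<alpha> \<longrightarrow> u t x = w x)"
    proof
      fix t assume "t \<in> {0..T}"
      then have "L2_0 D \<alpha> (u t)" using C1(1) unfolding C1_L2_def by blast
      then obtain w where "w \<in> borel_measurable borel" "\<And>x. x \<notin> D \<Longrightarrow> w x = 0" "AE x in lborel. x \<in> enlargement D \<alpha> \<longrightarrow> u t x = w x"
        using L2_0_representative[OF D(1) \<alpha>] by blast
      then show "\<exists>w. w \<in> borel_measurable borel \<and> (\<forall>x. x \<notin> D \<longrightarrow> w x = 0) \<and> (AE x in lborel. x \<in> enlargement D \<alpha> \<longrightarrow> u t x = w x)"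
        by blast
    qed
    from bchoice[OF this] obtain w where w': "\<forall>t\<in>{0..T}. w t \<in> borel_measurable borel \<and> (\<forall>x. x \<notin> D \<longrightarrow> w t x = 0) \<and>
        (AE x in lborel. x \<in> enlargement D \<alpha> \<longrightarrow> u t x = w t x)" by blast
    have w: "displacement (w t)" "AE x in lborel. x \<in> enlargement D \<alpha> \<longrightarrow> u t x = w t x" if "t \<in> {0..T}" for t
      using bspec[OF w' that] unfolding displacement_def by blast+
    have wD: "AE x in lborel. x \<in> D \<longrightarrow> u t x = w t x" if "t \<in> {0..T}" for t
      using w(2)[OF that] by eventually_elim (use Denl in auto)
    have feq: "f (max 0 s) = f s" "F 1 (max 0 s) = F 1 s" if "0 \<le> s" for s using that by auto
    have PDle: "PD D J f e (u t) \<le> energy (w t)" if "t \<in> {0..T}" for t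
      by (rule PD_le_energy[OF feq fd k(4) e(2) w(1)[OF that] w(2)[OF that]])
    have gradeq: "AE x in lborel. x \<in> D \<longrightarrow> grad_PD J f e (u t) x = grad (w t) x" if "t \<in> {0..T}" for t
      by (rule grad_PD_eq[OF feq fd k(4) e(2) w(1)[OF that] w(2)[OF that]])
    have Ds: "D \<in> sets lebesgue" using Db(1) by (auto intro: sets_completionI_sets)
    have sq: "square_integrable ?M (u t)" "square_integrable ?M (ut t)" "square_integrable ?M (utt t)" "square_integrable ?M (b t)"
      if "t \<in> {0..T}" for t
      using C1 b' that unfolding C1_L2_def L2_0_def L2_on_def square_integrable_def by auto
    have disp: "w t \<in> borel_measurable borel" "\<And>x. x \<notin> D \<Longrightarrow> w t x = 0" if "t \<in> {0..T}" for t
      using w(1)[OF that] unfolding displacement_def by auto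
    define \<Gamma> where "\<Gamma> t = grad (w t)" for t
    \<comment> \<open>This bound and \<open>A\<close> below depend on the horizon and may grow as it
      shrinks, but the conclusion of \<open>energy_estimate\<close> contains neither.\<close>
    define K where "K = 2 * (LBINT \<xi>. \<kappa> \<xi>) / e"
    have K0: "0 \<le> K" using grad_bound[of "\<lambda>_. 0" 0] unfolding K_def by linarith
    have \<Gamma>K: "\<bar>\<Gamma> t x\<bar> \<le> K" for t x unfolding \<Gamma>_def K_def by (rule grad_bound)
    have \<Gamma>m: "\<Gamma> t \<in> borel_measurable borel" if "t \<in> {0..T}" for t
      unfolding \<Gamma>_def by (rule grad_measurable[OF disp(1)[OF that]])
    have \<Gamma>lm: "\<Gamma> t \<in> borel_measurable ?M" if "t \<in> {0..T}" for t
      by (rule measurable_lebesgue_on_of_lborel[OF Db(1) \<Gamma>m[OF that]]) simp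
    have fin: "finite_measure ?M" using Db Ds by (intro finite_measureI) (auto simp: emeasure_restrict_space space_restrict_space)
    have \<Gamma>b: "square_integrable ?M (\<Gamma> t) \<and> norm2 ?M (\<Gamma> t) \<le> sqrt (K\<^sup>2 * measure ?M (space ?M))" if t: "t \<in> {0..T}" for t
    proof -
      interpret fm: finite_measure ?M by (rule fin)
      have sqb: "(\<Gamma> t x)\<^sup>2 \<le> K\<^sup>2" for x using power_mono[OF \<Gamma>K[of t x], of 2] by simp
      have i: "integrable ?M (\<lambda>x. (\<Gamma> t x)\<^sup>2)"
        by (rule fm.integrable_const_bound[of _ "K\<^sup>2"]) (use sqb \<Gamma>lm[OF t] in auto)
      have "(\<integral>x. (\<Gamma> t x)\<^sup>2 \<partial>?M) \<le> (\<integral>x. K\<^sup>2 \<partial>?M)" by (rule integral_mono[OF i]) (use sqb in auto)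
      then show ?thesis using i \<Gamma>lm[OF t] unfolding square_integrable_def norm2_def by (simp add: mult.commute)
    qed
    define A where "A = 4 * (LBINT \<xi>. \<kappa> \<xi>) / e"
    have A0: "0 \<le> A" using K0 unfolding A_def K_def by simp
    have Ediff: "energy (w s) - energy (w t) \<le> (\<integral>x. \<Gamma> t x * (u s x - u t x) \<partial>?M) + A * (\<integral>x. (u s x - u t x)\<^sup>2 \<partial>?M)"
      if s: "s \<in> {0..T}" and t: "t \<in> {0..T}" for s t
    proof -
      have m1: "(\<lambda>x. \<Gamma> t x * (w s x - w t x)) \<in> borel_measurable borel" "(\<lambda>x. (w s x - w t x)\<^sup>2) \<in> borel_measurable borel"
        using disp(1)[OF s] disp(1)[OF t] \<Gamma>m[OF t] by measurable
      have a1: "AE x in lborel. x \<in> D \<longrightarrow> \<Gamma> t x * (u s x - u t x) = \<Gamma> t x * (w s x - w t x)"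
        and a2: "AE x in lborel. x \<in> D \<longrightarrow> (u s x - u t x)\<^sup>2 = (w s x - w t x)\<^sup>2"
        using wD[OF s] wD[OF t] by (eventually_elim, simp)+
      have z: "\<Gamma> t x * (w s x - w t x) = 0" "(w s x - w t x)\<^sup>2 = 0" if "x \<notin> D" for x
        using disp(2)[OF s that] disp(2)[OF t that] by auto
      have "integrable ?M (\<lambda>x. (u s x - u t x)\<^sup>2)"
        using square_integrable_diff[OF sq(1)[OF s] sq(1)[OF t]] unfolding square_integrable_def by simp
      then have "integrable lborel (\<lambda>x. (w s x - w t x)\<^sup>2)" using integrable_lebesgue_on_iff_lborel[OF Db(1) _ m1(2) a2] z(2) by blast
      from energy_diff_le[OF w(1)[OF t] w(1)[OF s] this]
      have "energy (w s) - energy (w t) \<le> (LBINT x. \<Gamma> t x * (w s x - w t x)) + A * (LBINT x. (w s x - w t x)\<^sup>2)"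
        unfolding \<Gamma>_def A_def .
      moreover have "(\<integral>x. \<Gamma> t x * (u s x - u t x) \<partial>?M) = (LBINT x. \<Gamma> t x * (w s x - w t x))"
        by (rule integral_lebesgue_on_eq_lborel[OF Db(1) _ m1(1) a1]) (rule z(1))
      moreover have "(\<integral>x. (u s x - u t x)\<^sup>2 \<partial>?M) = (LBINT x. (w s x - w t x)\<^sup>2)"
        by (rule integral_lebesgue_on_eq_lborel[OF Db(1) _ m1(2) a2]) (rule z(2))
      ultimately show ?thesis by (simp only:)
    qed
    have eq': "AE x in ?M. \<rho> * utt t x = - \<Gamma> t x + b t x" if "t \<in> {0<..T}" for t
    proof -
      have "AE x in ?M. grad_PD J f e (u t) x = \<Gamma> t x"
        unfolding AE_lebesgue_on_iff_lborel[OF Ds] \<Gamma>_def using gradeq[of t] that by simp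
      with eq[OF that] show ?thesis by eventually_elim simp
    qed
    have "energy (w t) + \<rho> / 2 * (norm2 ?M (ut t))\<^sup>2 \<le>
        (\<beta>\<^sup>2 / (2 * \<rho>) + (energy (w 0) + \<rho> / 2 * (norm2 ?M (ut 0))\<^sup>2)) * exp (2 * T)"
    proof (rule energy_estimate[OF \<rho> A0 _ Ediff \<Gamma>b _ _ _ _ eq' \<beta> t])
      show "((\<lambda>s. norm2 ?M (\<lambda>x. (u s x - u t x) / (s - t) - ut t x)) \<longlongrightarrow> 0) (at t within {0..T})"
        "((\<lambda>s. norm2 ?M (\<lambda>x. (ut s x - ut t x) / (s - t) - utt t x)) \<longlongrightarrow> 0) (at t within {0..T})"
        "((\<lambda>s. norm2 ?M (\<lambda>x. ut s x - ut t x)) \<longlongrightarrow> 0) (at t within {0..T})" if "t \<in> {0..T}" for t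
        using C1 that unfolding C1_L2_def L2_norm_def norm2_def by blast+
    qed (use sq energy_nonneg in auto)
    moreover have "energy (w 0) \<le> CE"
    proof -
      have T0: "0 \<in> {0..T}" using assms(23) by simp
      have w0': "displacement w0" unfolding displacement_def using w0 by blast
      have "AE x in lborel. x \<in> D \<longrightarrow> u 0 x = u0 x" using init(1) unfolding AE_lebesgue_on_iff_lborel[OF Ds] .
      then have "AE x in lborel. w 0 x = w0 x" using wD[OF T0] w0D by eventually_elim (use disp(2)[OF T0] w0(2) in metis)
      from energy_cong_AE[OF w0' w(1)[OF T0] this] show ?thesis using CE(2)[OF e(1)] by linarith
    qed
    moreover have "norm2 ?M (ut 0) = norm2 ?M v0"
    proof -
      have T0: "0 \<in> {0..T}" using assms(23) by simp
      have "(\<integral>x. (ut 0 x)\<^sup>2 \<partial>?M) = (\<integral>x. (v0 x)\<^sup>2 \<partial>?M)"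
      proof (rule integral_cong_AE)
        show "(\<lambda>x. (ut 0 x)\<^sup>2) \<in> borel_measurable ?M" using sq(2)[OF T0] unfolding square_integrable_def by auto
        show "(\<lambda>x. (v0 x)\<^sup>2) \<in> borel_measurable ?M" using data(2) unfolding L2_0_def L2_on_def by auto
        show "AE x in ?M. (ut 0 x)\<^sup>2 = (v0 x)\<^sup>2" using init(2) by eventually_elim simp
      qed
      then show ?thesis unfolding norm2_def by simp
    qed
    ultimately have "energy (w t) + \<rho> / 2 * (norm2 ?M (ut t))\<^sup>2 \<le>
        (\<beta>\<^sup>2 / (2 * \<rho>) + (CE + \<rho> / 2 * (norm2 ?M v0)\<^sup>2)) * exp (2 * T)"
      by (smt (verit) exp_gt_zero mult_right_mono)
    then show ?thesis using PDle[OF t] unfolding C_def L2_norm_def norm2_def by linarith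
  qed
  show ?thesis using Cpos key by (intro exI[of _ C] conjI allI impI SUP_least) auto
qed

end
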